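(* Let $\Gamma$ be a connected (finite) graph with $|\Gamma|$ vertices, and fix a vertex $v$ of $\Gamma$. For $n\ge|\Gamma|$ let $\Gamma_n$ denote the graph with $n$ vertices obtained by adding a $2$-valent tree of length $n-|\Gamma|$ to $\Gamma$ at $v$, and let $M_n$ be the adjacency matrix of $\Gamma_n$. For any $\Gamma$ (and $v$) there exists an effective (i.e. effectively computable) constant $N$ such that for all $n\ge N$, either: (1) all the eigenvalues of $M_n$ are of the form $\zeta+\zeta^{-1}$ for some root of unity $\zeta$, and the graphs $\Gamma_n$ are the Dynkin diagrams $A_n$ or $D_n$; or (2) there exists at least one eigenvalue $\lambda$ of $M_n$ of multiplicity one such that $\mathbb{Q}(\lambda^2)$ is not abelian (over $\mathbb{Q}$).
   Context: Adding a $2$-valent tree of length $m$ to $\Gamma$ at $v$ means adjoining a path with $m$ new vertices $w_1,\dots,w_m$ (consecutive ones joined by an edge) and an edge joining $v$ to $w_1$. A number field is called abelian if it is Galois over $\mathbb{Q}$ with abelian Galois group. *)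

theory Defs
  imports
    "HOL-Algebra.Algebraic_Closure_Type"
    "HOL-Algebra.Bij"
    "HOL-Algebra.Embedded_Algebras"
    "HOL-Algebra.Generated_Fields"
    "HOL-Library.Nat_Bijection"
    "Graph_Theory.Graph_Theory"
    "Jordan_Normal_Form.Char_Poly"
begin

section \<open>Graphs\<close>

text \<open>
  A finite simple graph is a \<^locale>\<open>pair_graph\<close>: finitely many vertices and a symmetric,
  irreflexive set of arcs, an undirected edge being the two arcs it carries.  Vertices are
  numbered \<open>0, \<dots>, n - 1\<close>.
\<close>

definition edges_sym :: "nat rel \<Rightarrow> nat rel" where
  "edges_sym E = E \<union> E\<inverse>"

text \<open>
  With \<open>k\<close> vertices in \<open>G\<close>, the new vertices \<open>w\<^sub>1, \<dots>, w\<^sub>m\<close> are \<open>k, \<dots>, k + m - 1\<close>.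
\<close>

definition add_path :: "nat pair_pre_digraph \<Rightarrow> nat \<Rightarrow> nat \<Rightarrow> nat pair_pre_digraph" where
  "add_path G v m = (let k = card (pverts G) in
     \<lparr> pverts = pverts G \<union> {k..<k + m},
       parcs = parcs G
         \<union> edges_sym {(v, w) | w. w = k \<and> 0 < m}
         \<union> edges_sym {(w, Suc w) | w. k \<le> w \<and> Suc w < k + m} \<rparr>)"

definition adjacency_matrix :: "nat pair_pre_digraph \<Rightarrow> complex mat" where
  "adjacency_matrix G = (let n = card (pverts G) in
     mat n n (\<lambda>(i, j). if (i, j) \<in> parcs G then 1 else 0))"

definition dynkin_A :: "nat \<Rightarrow> nat pair_pre_digraph" where
  "dynkin_A n = \<lparr> pverts = {..<n}, parcs = edges_sym {(i, Suc i) | i. Suc i < n} \<rparr>"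

text \<open>
  For \<open>n \<ge> 4\<close>: a path \<open>0, \<dots>, n - 2\<close> whose penultimate vertex \<open>n - 3\<close> carries
  the additional leaf \<open>n - 1\<close>.
\<close>

definition dynkin_D :: "nat \<Rightarrow> nat pair_pre_digraph" where
  "dynkin_D n = \<lparr> pverts = {..<n},
     parcs = edges_sym ({(i, Suc i) | i. Suc i < n - 1} \<union> {(n - 3, n - 1)}) \<rparr>"

definition graph_iso :: "nat pair_pre_digraph \<Rightarrow> nat pair_pre_digraph \<Rightarrow> bool" where
  "graph_iso G H \<longleftrightarrow> digraph_iso (with_proj G) (with_proj H)"

lemma pair_graph_add_path:
  assumes "pair_graph G" "pverts G = {..<card (pverts G)}" "v \<in> pverts G"
  shows "pair_graph (add_path G v m)"
proof -
  interpret pair_graph G by fact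
  define k where "k = card (pverts G)"
  have V: "pverts G = {..<k}" using assms(2) by (simp add: k_def)
  have vk: "v < k" using assms(3) V by auto
  have arcs: "a < k" "b < k" "a \<noteq> b" "(b, a) \<in> parcs G" if "(a, b) \<in> parcs G" for a b
    using in_arcsD1[OF that] in_arcsD2[OF that] pair_no_loops[OF that] V that
      pair_sym_arcs by (auto simp: symmetric_def dest: symD)
  have verts: "pverts (add_path G v m) = {..<k + m}"
    by (auto simp: add_path_def Let_def V k_def[symmetric])
  have inc: "fst e < k + m \<and> snd e < k + m \<and> fst e \<noteq> snd e" if "e \<in> parcs (add_path G v m)" for e
    using that vk arcs by (cases e) (fastforce simp: add_path_def Let_def k_def[symmetric] edges_sym_def)
  then have "parcs (add_path G v m) \<subseteq> {..<k + m} \<times> {..<k + m}" by force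
  then have fin: "finite (parcs (add_path G v m))" by (rule finite_subset) auto
  have "sym (parcs (add_path G v m))"
    by (auto simp: sym_def add_path_def Let_def k_def[symmetric] edges_sym_def intro: arcs)
  then show ?thesis
    using inc fin by unfold_locales (auto simp: verts symmetric_def)
qed

section \<open>Abelian number fields\<close>

abbreviation complex_ring :: "complex ring" where
  "complex_ring \<equiv> ring_of_type_algebra"

definition rat_adjoin :: "complex \<Rightarrow> complex set" where
  "rat_adjoin \<alpha> = generate_field complex_ring {\<alpha>}"

definition number_field :: "complex set \<Rightarrow> bool" where
  "number_field K \<longleftrightarrow>
     subfield K complex_ring \<and> ring.finite_dimension complex_ring \<rat> K"

text \<open>
  Separability is automatic in characteristic 0, so Galois means normal: an irreducible
  rational polynomial with a root in \<open>K\<close> splits over \<open>K\<close>, i.e. all its complex roots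
  lie in \<open>K\<close>.
\<close>

definition galois_over_rat :: "complex set \<Rightarrow> bool" where
  "galois_over_rat K \<longleftrightarrow> number_field K \<and>
     (\<forall>p :: rat poly. Factorial_Ring.irreducible p \<longrightarrow>
        (\<exists>x\<in>K. poly (map_poly of_rat p) x = 0) \<longrightarrow>
        (\<forall>x :: complex. poly (map_poly of_rat p) x = 0 \<longrightarrow> x \<in> K))"

definition galois_group :: "complex set \<Rightarrow> (complex \<Rightarrow> complex) monoid" where
  "galois_group K = (BijGroup K) \<lparr> carrier :=
     {\<sigma> \<in> extensional K. \<sigma> \<in> ring_iso (complex_ring \<lparr>carrier := K\<rparr>) (complex_ring \<lparr>carrier := K\<rparr>)
        \<and> (\<forall>q\<in>\<rat>. \<sigma> q = q)} \<rparr>"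

lemma group_galois_group:
  assumes "number_field K"
  shows "group (galois_group K)"
proof -
  interpret C: field complex_ring by (rule field_from_type_algebra)
  have K: "subfield K complex_ring" using assms by (simp add: number_field_def)
  define R where "R = complex_ring \<lparr>carrier := K\<rparr>"
  interpret R: field R
    unfolding R_def using C.subfield_iff(2)[OF K] .
  have cR: "carrier R = K" by (simp add: R_def)
  define H where "H = {\<sigma> \<in> extensional K. \<sigma> \<in> ring_iso R R \<and> (\<forall>q\<in>\<rat>. \<sigma> q = q)}"
  have one: "1 \<in> K" using R.one_closed cR by (simp add: R_def ring_of_type_algebra_def)
  have add: "x + y \<in> K" if "x \<in> K" "y \<in> K" for x y
    using R.add.m_closed[of x y] that cR by (simp add: R_def ring_of_type_algebra_def)
  have mult: "x * y \<in> K" if "x \<in> K" "y \<in> K" for x y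
    using R.m_closed[of x y] that cR by (simp add: R_def ring_of_type_algebra_def)
  have neg: "- x \<in> K" if x: "x \<in> K" for x
  proof -
    obtain y where "y \<in> K" "y + x = 0"
      using R.a_inv_closed[of x] R.l_neg[of x] x cR
      by (auto simp: R_def ring_of_type_algebra_def)
    then show ?thesis by (metis eq_neg_iff_add_eq_0)
  qed
  have nat: "of_nat n \<in> K" for n
    using R.zero_closed cR by (induction n) (auto simp: R_def ring_of_type_algebra_def intro: add one)
  have int: "of_int n \<in> K" for n
    by (cases n) (auto simp del: of_nat_Suc intro: nat neg)
  have inv: "inverse x \<in> K" if x: "x \<in> K" "x \<noteq> 0" for x
  proof -
    have "x \<in> Units R" using R.field_Units x cR by (simp add: R_def ring_of_type_algebra_def)
    then obtain y where "y \<in> K" "y * x = 1"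
      by (auto simp: Units_def R_def ring_of_type_algebra_def)
    then show ?thesis by (metis inverse_unique mult.commute)
  qed
  have Q: "\<rat> \<subseteq> K"
  proof
    fix q :: complex assume "q \<in> \<rat>"
    then obtain a b where "q = of_int a * inverse (of_int b)" "b > 0"
      by (metis Rats_cases' divide_inverse)
    then show "q \<in> K" by (auto intro!: mult int inv)
  qed
  have iso: "\<sigma> \<in> ring_iso R R \<longleftrightarrow> bij_betw \<sigma> K K \<and> \<sigma> 1 = 1 \<and>
      (\<forall>x\<in>K. \<forall>y\<in>K. \<sigma> (x + y) = \<sigma> x + \<sigma> y \<and> \<sigma> (x * y) = \<sigma> x * \<sigma> y)" for \<sigma>
    by (auto simp: ring_iso_def Ring.ring_hom_def R_def ring_of_type_algebra_def bij_betw_def)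
  interpret B: group "BijGroup K" by (rule group_BijGroup)
  have HB: "H \<subseteq> carrier (BijGroup K)"
    by (auto simp: H_def iso BijGroup_def Bij_def)
  have "subgroup H (BijGroup K)"
  proof (rule B.subgroupI[OF HB])
    have "(\<lambda>x\<in>K. x) \<in> H" using Q one add mult
      by (auto simp: H_def iso bij_betw_def inj_on_def)
    then show "H \<noteq> {}" by blast
  next
    fix \<sigma> assume \<sigma>: "\<sigma> \<in> H"
    then have b: "bij_betw \<sigma> K K" and B: "\<sigma> \<in> Bij K" by (auto simp: H_def iso Bij_def)
    let ?t = "\<lambda>x\<in>K. inv_into K \<sigma> x"
    have t: "?t \<in> Bij K" by (rule restrict_inv_into_Bij[OF B])
    then have tb: "bij_betw ?t K K" by (simp add: Bij_def)
    have tK: "?t x \<in> K" if "x \<in> K" for x using tb that by (auto simp: bij_betw_def)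
    have l: "\<sigma> (?t x) = x" if "x \<in> K" for x
      using b that by (simp add: bij_betw_inv_into_right)
    have r: "?t y = x" if "x \<in> K" "y = \<sigma> x" for x y
      using b that by (auto simp: bij_betw_inv_into_left bij_betw_apply)
    have "?t \<in> H"
      using tb Q \<sigma> by (auto simp: H_def iso one add mult tK l simp del: restrict_apply intro!: r)
    then show "inv\<^bsub>BijGroup K\<^esub> \<sigma> \<in> H"
      using inv_BijGroup[OF B] by simp
  next
    fix \<sigma> \<tau> assume h: "\<sigma> \<in> H" "\<tau> \<in> H"
    then have "\<sigma> \<in> Bij K" "\<tau> \<in> Bij K" by (auto simp: H_def iso Bij_def)
    moreover have "compose K \<sigma> \<tau> \<in> H"
    proof -
      have tK: "\<tau> x \<in> K" if "x \<in> K" for x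
        using h that by (auto simp: H_def iso bij_betw_def)
      show ?thesis using h Q
        by (auto simp: H_def iso compose_def one add mult tK
          intro: bij_betw_trans[unfolded comp_def])
    qed
    ultimately show "\<sigma> \<otimes>\<^bsub>BijGroup K\<^esub> \<tau> \<in> H" by (simp add: BijGroup_def)
  qed
  then show ?thesis
    using B.subgroup_imp_group by (simp add: galois_group_def H_def R_def)
qed

definition abelian_number_field :: "complex set \<Rightarrow> bool" where
  "abelian_number_field K \<longleftrightarrow> galois_over_rat K \<and> comm_group (galois_group K)"

definition root_of_unity :: "complex \<Rightarrow> bool" where
  "root_of_unity \<zeta> \<longleftrightarrow> (\<exists>k>0. \<zeta> ^ k = 1)"

section \<open>Effective computability\<close>

text \<open>
  Kleene's partial recursive functions.  \<open>rec_eval f xs y\<close> says that the program \<open>f\<close> halts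
  on the argument list \<open>xs\<close> with output \<open>y\<close>; recursion and minimisation act on the first
  argument.
\<close>

datatype recf = Zero | Succ | Proj nat | Comp recf "recf list" | PrimRec recf recf | Mu recf

inductive rec_eval :: "recf \<Rightarrow> nat list \<Rightarrow> nat \<Rightarrow> bool" where
  zero: "rec_eval Zero xs 0"
| succ: "rec_eval Succ (x # xs) (Suc x)"
| proj: "i < length xs \<Longrightarrow> rec_eval (Proj i) xs (xs ! i)"
| comp: "list_all2 (\<lambda>g y. rec_eval g xs y) gs ys \<Longrightarrow> rec_eval f ys z \<Longrightarrow>
    rec_eval (Comp f gs) xs z"
| primrec_0: "rec_eval f xs y \<Longrightarrow> rec_eval (PrimRec f g) (0 # xs) y"
| primrec_Suc: "rec_eval (PrimRec f g) (n # xs) y \<Longrightarrow> rec_eval g (n # y # xs) z \<Longrightarrow>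
    rec_eval (PrimRec f g) (Suc n # xs) z"
| mu: "rec_eval f (n # xs) 0 \<Longrightarrow> (\<forall>m<n. \<exists>y>0. rec_eval f (m # xs) y) \<Longrightarrow>
    rec_eval (Mu f) xs n"

lemma rec_eval_deterministic:
  "rec_eval f xs y \<Longrightarrow> rec_eval f xs z \<Longrightarrow> y = z"
proof (induction f xs y arbitrary: z rule: rec_eval.induct)
  case (comp xs gs ys f w)
  from comp.prems obtain ys' where
    ys': "list_all2 (\<lambda>g y. rec_eval g xs y) gs ys'" "rec_eval f ys' z"
    by (cases rule: rec_eval.cases) auto
  have "ys = ys'"
    using comp.IH(1) ys'(1) by (auto simp: list_all2_conv_all_nth intro!: nth_equalityI)
  with comp ys' show ?case by auto
next
  case (primrec_0 f xs y g)
  from primrec_0.prems show ?case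
    by (cases rule: rec_eval.cases) (auto dest: primrec_0.IH)
next
  case (primrec_Suc f g n xs y w)
  from primrec_Suc.prems show ?case
    by (cases rule: rec_eval.cases) (auto dest: primrec_Suc.IH)
next
  case (mu f n xs)
  from mu.prems have z: "rec_eval f (z # xs) 0" "\<forall>m<z. \<exists>y>0. rec_eval f (m # xs) y"
    by (cases rule: rec_eval.cases; auto)+
  show ?case
  proof (rule linorder_cases[of n z])
    assume "n < z"
    then show ?thesis using z(2) mu.IH(1) by fastforce
  next
    assume "z < n"
    then show ?thesis using z(1) mu.IH(2) by fastforce
  qed
qed (auto elim: rec_eval.cases)

text \<open>
  The input to an algorithm: number of vertices, canonical code of the (finite) set of arcs,
  distinguished vertex.
\<close>

definition encode_input :: "nat pair_pre_digraph \<Rightarrow> nat \<Rightarrow> nat list" where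
  "encode_input G v = [card (pverts G), set_encode (prod_encode ` parcs G), v]"

end

theory Submission
  imports Defs "Berlekamp_Zassenhaus.Mahler_Measure"
begin

text \<open>
  Let \<open>P\<^sub>m\<close> be the characteristic polynomial of \<open>\<Gamma>\<^sub>n\<close> for \<open>n = |\<Gamma>| + m\<close>.  It satisfies
  \<open>P\<^sub>m\<^sub>+\<^sub>2 = x P\<^sub>m\<^sub>+\<^sub>1 - P\<^sub>m\<close>, so that for \<open>x = t + 1/t\<close> the polynomial \<open>(t\<^sup>2 - 1) t\<^sup>n P\<^sub>m(x)\<close> has the form
  \<open>t\<^sup>2\<^sup>m\<^sup>+\<^sup>1 A(t) - B(t)\<close> with \<open>A\<close> and \<open>B\<close> independent of \<open>m\<close>.  Unless \<open>\<Gamma>\<^sub>n\<close> is of type \<open>A\<close> or \<open>D\<close>, test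
  vectors show that the Perron eigenvalue \<open>l\<close>, which is simple, is bounded away from 2.  Suppose that
  \<open>K = \<rat>(l\<^sup>2)\<close> is abelian of degree \<open>d\<close>.

  The form \<open>Y = P\<^sub>m\<^sub>+\<^sub>1\<^sup>2 - x P\<^sub>m\<^sub>+\<^sub>1 P\<^sub>m + P\<^sub>m\<^sup>2\<close> does not depend on \<open>m\<close>, and its value at \<open>l\<close> is
  nonzero but exponentially small in \<open>m\<close>.  The Mahler measure of \<open>P\<^sub>m\<close> (in the variable \<open>t\<close>) is bounded
  independently of \<open>m\<close>, and hence so are the other conjugates of \<open>Y(l)\<close> on average.  As the norm of
  \<open>Y(l)\<close> is at least 1 in absolute value, \<open>d\<close> tends to infinity with \<open>m\<close>.

  On the other hand, \<open>t\<^sup>2\<^sup>m\<^sup>+\<^sup>1 A - B\<close> and its derivative have a combination of bounded degree that does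
  not vanish modulo \<open>p\<close> for all primes \<open>p\<close> beyond an explicit bound.  If \<open>d\<close> is large this makes \<open>p\<close> unramified
  in \<open>K\<close>.  Since \<open>K\<close> is abelian, the Frobenius automorphism \<open>\<phi>\<close> satisfies \<open>\<phi>(a) \<equiv> a\<^sup>p \<equiv> T(a)\<close> modulo \<open>p\<close> for all
  conjugates \<open>a\<close> of the generator, where \<open>T(s + 1/s) = s\<^sup>p + 1/s\<^sup>p\<close>.  Equality for all \<open>a\<close> is impossible because
  \<open>T\<close> increases the largest real conjugate, so \<open>p\<^sup>d\<close> divides the nonzero norm of \<open>\<phi>(a) - T(a)\<close>; the bound on
  the Mahler measure then bounds \<open>d\<close>.
\<close>

section \<open>Algebraic integers\<close>

text \<open>No Dedekind theory is used: prime ideals live in the ring of all complex algebraic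
  integers, and "unramified" is replaced by the condition that the derivative of the minimal
  polynomial is outside the ideal at one conjugate. The discriminant of the field is out of control,
  so this must come from the shape of the polynomials. If every conjugate were congruent to another
  one, \<open>FF m\<close> and its derivative would share, modulo the ideal, a factor of degree at
  least \<open>e * card R\<close>, which then divides the nonzero combination \<open>W m\<close> of
  degree at most \<open>4 * k + 3\<close>. Commutativity lets one Frobenius serve all conjugates at
  the same prime: if \<open>b\<close> is the Frobenius image of the generator, then
  \<open>\<sigma> a b = \<sigma> b a\<close>, so a congruence at every \<open>a\<close> says that
  all conjugates of one number lie in the ideal. \<open>T\<close> replaces the plain power because
  \<open>a ^ p\<close> can be as large as \<open>2 ^ p\<close> times the power of the large unit,
  and a loss of \<open>2 ^ p\<close> per conjugate would outweigh the gain \<open>p\<close>;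
  \<open>T\<close> loses only a factor 2. Since the claim is about the square of the eigenvalue
  while the polynomials concern the eigenvalue itself, everything is done relative to
  \<open>\<psi>\<close>, which covers both possible generators.\<close>

lemma algebraic_int_of_int_matrix:
  fixes v :: "'a \<Rightarrow> complex"
  assumes fin: "finite I" and nz: "\<exists>i\<in>I. v i \<noteq> 0"
    and eq: "\<forall>i\<in>I. z * v i = (\<Sum>j\<in>I. of_int (C i j) * v j)"
  shows "algebraic_int z"
proof -
  define r where "r = card I"
  obtain e where e: "bij_betw e {..<r} I"
    using fin ex_bij_betw_nat_finite[of I] by (auto simp: r_def atLeast0LessThan)
  define A where "A = mat r r (\<lambda>(i,j). C (e i) (e j))"
  define w where "w = Matrix.vec r (\<lambda>i. v (e i))"
  have A: "A \<in> carrier_mat r r" and w: "w \<in> carrier_vec r" by (auto simp: A_def w_def)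
  have eI: "e i \<in> I" if "i < r" for i using e that by (auto simp: bij_betw_def)
  have "eigenvector (map_mat of_int A) w z"
    unfolding eigenvector_def
  proof (intro conjI)
    show "w \<in> carrier_vec (dim_row (map_mat of_int A))" using A w by auto
    obtain i where i: "i \<in> I" "v i \<noteq> 0" using nz by auto
    then obtain k where "k < r" "e k = i" using e by (auto simp: bij_betw_def image_iff)
    then have "w $ k \<noteq> 0\<^sub>v r $ k" using i by (auto simp: w_def)
    then show "w \<noteq> 0\<^sub>v (dim_row (map_mat of_int A))" using A by auto
    show "map_mat of_int A *\<^sub>v w = z \<cdot>\<^sub>v w"
    proof (rule eq_vecI)
      fix i assume "i < dim_vec (z \<cdot>\<^sub>v w)"
      then have i: "i < r" by (auto simp: w_def)
      have "(map_mat of_int A *\<^sub>v w) $ i = (\<Sum>j = 0..<r. of_int (C (e i) (e j)) * v (e j))"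
        using i by (auto simp: A_def w_def scalar_prod_def intro!: sum.cong)
      also have "\<dots> = (\<Sum>j\<in>I. of_int (C (e i) j) * v j)"
        using sum.reindex_bij_betw[OF e] by (auto simp: atLeast0LessThan)
      also have "\<dots> = (z \<cdot>\<^sub>v w) $ i" using eq eI[OF i] i by (auto simp: w_def)
      finally show "(map_mat of_int A *\<^sub>v w) $ i = (z \<cdot>\<^sub>v w) $ i" .
    qed (auto simp: A_def w_def)
  qed
  then have "eigenvalue (map_mat of_int A) z" by (auto simp: eigenvalue_def)
  then have "poly (char_poly (map_mat of_int A)) z = 0"
    using eigenvalue_root_char_poly[of "map_mat of_int A" r z] A by auto
  moreover have "char_poly (map_mat of_int A :: complex mat) = map_poly of_int (char_poly A)"
    by (rule of_int_hom.char_poly_hom[OF A])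
  moreover have "lead_coeff (char_poly A) = 1"
    using degree_monic_char_poly[OF A] by auto
  ultimately show ?thesis by (auto simp: algebraic_int_altdef_ipoly)
qed

text \<open>The Z-span of the \<open>v i\<close> is stable under multiplication by \<open>z\<close>.
  Once some \<open>v i\<close> is nonzero, this makes \<open>z\<close> an eigenvalue of an integer
  matrix.\<close>

definition int_stable :: "'a set \<Rightarrow> ('a \<Rightarrow> complex) \<Rightarrow> complex \<Rightarrow> bool" where
  "int_stable I v z \<longleftrightarrow> (\<exists>C. \<forall>i\<in>I. z * v i = (\<Sum>j\<in>I. of_int (C i j) * v j))"

lemma int_stable_add:
  assumes "int_stable I v x" "int_stable I v y"
  shows "int_stable I v (x + y)"
proof -
  obtain C D where "\<forall>i\<in>I. x * v i = (\<Sum>j\<in>I. of_int (C i j) * v j)"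
    "\<forall>i\<in>I. y * v i = (\<Sum>j\<in>I. of_int (D i j) * v j)"
    using assms by (auto simp: int_stable_def)
  then have "\<forall>i\<in>I. (x + y) * v i = (\<Sum>j\<in>I. of_int (C i j + D i j) * v j)"
    by (auto simp: algebra_simps sum.distrib)
  then show ?thesis unfolding int_stable_def by (intro exI[of _ "\<lambda>i j. C i j + D i j"])
qed

lemma int_stable_mult:
  assumes "finite I" "int_stable I v x" "int_stable I v y"
  shows "int_stable I v (x * y)"
proof -
  obtain C D where C: "\<forall>i\<in>I. x * v i = (\<Sum>j\<in>I. of_int (C i j) * v j)"
    and D: "\<forall>i\<in>I. y * v i = (\<Sum>j\<in>I. of_int (D i j) * v j)"
    using assms by (auto simp: int_stable_def)
  have "x * y * v i = (\<Sum>j\<in>I. of_int (\<Sum>k\<in>I. D i k * C k j) * v j)" if "i \<in> I" for i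
  proof -
    have "x * y * v i = x * (\<Sum>k\<in>I. of_int (D i k) * v k)" using D that by (simp add: mult.assoc)
    also have "\<dots> = (\<Sum>k\<in>I. of_int (D i k) * (x * v k))"
      by (simp add: sum_distrib_left mult.left_commute)
    also have "\<dots> = (\<Sum>k\<in>I. \<Sum>j\<in>I. of_int (D i k * C k j) * v j)"
      using C by (auto simp: sum_distrib_left mult.assoc intro!: sum.cong)
    also have "\<dots> = (\<Sum>j\<in>I. of_int (\<Sum>k\<in>I. D i k * C k j) * v j)"
      by (subst sum.swap) (simp add: sum_distrib_right)
    finally show ?thesis .
  qed
  then show ?thesis unfolding int_stable_def
    by (intro exI[of _ "\<lambda>i j. \<Sum>k\<in>I. D i k * C k j"]) auto
qed

lemma monic_power_reduce:
  fixes x :: complex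
  assumes "algebraic_int x"
  obtains m c where "m > 0" "x ^ m = (\<Sum>i<m. of_int (c i) * x ^ i)"
proof -
  obtain p where p: "poly (map_poly of_int p) x = 0" "lead_coeff p = 1"
    using assms by (auto simp: algebraic_int_altdef_ipoly)
  define m where "m = degree p"
  have m: "m > 0"
  proof (rule ccontr)
    assume "\<not> m > 0"
    then obtain a where "p = [:a:]" using degree_eq_zeroE by (auto simp: m_def)
    then show False using p by auto
  qed
  have "0 = (\<Sum>i\<le>m. of_int (coeff p i) * x ^ i)"
    using p by (simp add: poly_altdef m_def)
  also have "\<dots> = (\<Sum>i<m. of_int (coeff p i) * x ^ i) + x ^ m"
    using p by (simp add: m_def lessThan_Suc_atMost[symmetric])
  finally have "x ^ m = (\<Sum>i<m. of_int (- coeff p i) * x ^ i)"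
    by (simp add: sum_negf eq_neg_iff_add_eq_0 add.commute)
  then show ?thesis by (rule that[OF m])
qed

text \<open>Multiplication by \<open>x\<close> raises the first exponent; at \<open>m\<close> the
  monic relation folds it back.\<close>

lemma int_stable_powers:
  fixes x y :: complex
  assumes "m > 0" "x ^ m = (\<Sum>i<m. of_int (c i) * x ^ i)"
  shows "int_stable ({..<m} \<times> {..<n}) (\<lambda>(i,j). x ^ i * y ^ j) x"
proof -
  define C where "C = (\<lambda>(i::nat,j::nat) (i'::nat,j'::nat). if j' = j then
      (if Suc i < m then (if i' = Suc i then 1 else 0) else c i') else (0::int))"
  have "x * (x ^ i * y ^ j) = (\<Sum>q\<in>{..<m} \<times> {..<n}. of_int (C (i,j) q) * (case q of (i',j') \<Rightarrow> x ^ i' * y ^ j'))"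
    if "i < m" "j < n" for i j
  proof -
    have "(\<Sum>q\<in>{..<m} \<times> {..<n}. of_int (C (i,j) q) * (case q of (i',j') \<Rightarrow> x ^ i' * y ^ j'))
       = (\<Sum>(i',j')\<in>{..<m} \<times> {..<n}. of_int (C (i,j) (i',j')) * (x ^ i' * y ^ j'))"
      by (intro sum.cong) auto
    also have "\<dots> = (\<Sum>i'<m. \<Sum>j'<n. of_int (C (i,j) (i',j')) * (x ^ i' * y ^ j'))"
      by (rule sum.cartesian_product[symmetric])
    also have "\<dots> = (\<Sum>i'<m. \<Sum>j'<n. if j' = j then of_int (if Suc i < m then (if i' = Suc i then 1 else 0) else c i') * (x ^ i' * y ^ j) else 0)"
      by (intro sum.cong refl) (simp add: C_def)
    also have "\<dots> = (\<Sum>i'<m. of_int (if Suc i < m then (if i' = Suc i then 1 else 0) else c i') * (x ^ i' * y ^ j))"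
      using that by simp
    also have "\<dots> = x * (x ^ i * y ^ j)"
    proof (cases "Suc i < m")
      case True
      then have "(\<Sum>i'<m. of_int (if Suc i < m then (if i' = Suc i then 1 else 0) else c i') * (x ^ i' * y ^ j))
         = (\<Sum>i'<m. if i' = Suc i then x ^ Suc i * y ^ j else 0)" by (intro sum.cong) auto
      then show ?thesis using True by simp
    next
      case False
      then have "Suc i = m" using that by auto
      then have "x * (x ^ i * y ^ j) = x ^ m * y ^ j" by auto
      then show ?thesis using False assms(2) by (simp add: sum_distrib_right mult.assoc)
    qed
    finally show ?thesis by simp
  qed
  then show ?thesis unfolding int_stable_def by (intro exI[of _ C]) auto
qed

text \<open>The monomials \<open>x ^ i * y ^ j\<close> below the two degrees span
  \<open>Z[x, y]\<close>, which is stable under both numbers and hence under their sum and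
  product.\<close>

lemma algebraic_int_add_mult:
  fixes x y :: complex
  assumes "algebraic_int x" "algebraic_int y"
  shows "algebraic_int (x + y)" "algebraic_int (x * y)"
proof -
  obtain m c where m: "m > 0" "x ^ m = (\<Sum>i<m. of_int (c i) * x ^ i)"
    by (rule monic_power_reduce[OF assms(1)])
  obtain n d where n: "n > 0" "y ^ n = (\<Sum>i<n. of_int (d i) * y ^ i)"
    by (rule monic_power_reduce[OF assms(2)])
  let ?I = "{..<m} \<times> {..<n}" and ?v = "\<lambda>(i,j). x ^ i * y ^ j"
  have X: "int_stable ?I ?v x" by (rule int_stable_powers[OF m])
  obtain C where C: "\<forall>i\<in>{..<n} \<times> {..<m}. y * (case i of (i,j) \<Rightarrow> y ^ i * x ^ j) =
      (\<Sum>j\<in>{..<n} \<times> {..<m}. of_int (C i j) * (case j of (i,j) \<Rightarrow> y ^ i * x ^ j))"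
    using int_stable_powers[OF n, of m x] by (auto simp: int_stable_def)
  \<comment> \<open>\<open>int_stable_powers\<close> treats the first factor only; for
    \<open>y\<close> it was applied with the roles exchanged and is transported here by
    \<open>prod.swap\<close>.\<close>
  have Y: "int_stable ?I ?v y"
    unfolding int_stable_def
  proof (intro exI[of _ "\<lambda>i j. C (prod.swap i) (prod.swap j)"] ballI)
    fix i assume i: "i \<in> ?I"
    have "y * ?v i = y * (case prod.swap i of (i,j) \<Rightarrow> y ^ i * x ^ j)"
      by (cases i) (simp add: mult.commute)
    also have "\<dots> = (\<Sum>j\<in>{..<n} \<times> {..<m}. of_int (C (prod.swap i) j) * (case j of (i,j) \<Rightarrow> y ^ i * x ^ j))"
      using C i by (cases i) auto
    also have "\<dots> = (\<Sum>j\<in>?I. of_int (C (prod.swap i) (prod.swap j)) * ?v j)"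
      by (rule sum.reindex_bij_witness[of _ prod.swap prod.swap]) (auto simp: mult.commute)
    finally show "y * ?v i = (\<Sum>j\<in>?I. of_int (C (prod.swap i) (prod.swap j)) * ?v j)" .
  qed
  have nz: "\<exists>i\<in>?I. ?v i \<noteq> 0" using m n by (intro bexI[of _ "(0,0)"]) auto
  have "algebraic_int z" if z: "int_stable ?I ?v z" for z
  proof -
    obtain C where "\<forall>i\<in>?I. z * ?v i = (\<Sum>j\<in>?I. of_int (C i j) * ?v j)"
      using z unfolding int_stable_def by blast
    then show ?thesis by (intro algebraic_int_of_int_matrix[OF _ nz]) auto
  qed
  then show "algebraic_int (x + y)" "algebraic_int (x * y)"
    using int_stable_add[OF X Y] int_stable_mult[OF _ X Y] by auto
qed

lemma algebraic_int_diff: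
  "algebraic_int x \<Longrightarrow> algebraic_int y \<Longrightarrow> algebraic_int (x - y :: complex)"
  using algebraic_int_add_mult(1)[of x "- y"] by simp

lemma algebraic_int_power: "algebraic_int x \<Longrightarrow> algebraic_int (x ^ n :: complex)"
  by (induction n) (auto intro: algebraic_int_add_mult)

lemma algebraic_int_sum: "(\<And>i. i \<in> I \<Longrightarrow> algebraic_int (f i)) \<Longrightarrow> algebraic_int (sum f I :: complex)"
  by (induction I rule: infinite_finite_induct) (auto intro: algebraic_int_add_mult)

lemma algebraic_int_prod: "(\<And>i. i \<in> I \<Longrightarrow> algebraic_int (f i)) \<Longrightarrow> algebraic_int (prod f I :: complex)"
  by (induction I rule: infinite_finite_induct) (auto intro: algebraic_int_add_mult)

lemmas algebraic_int_intros = algebraic_int_add_mult algebraic_int_diff algebraic_int_power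
  algebraic_int_sum algebraic_int_prod algebraic_int_minus

section \<open>Ideals of the ring of all complex algebraic integers\<close>

text \<open>The ambient ring is not tied to one number field: it must also contain the units
  \<open>s\<close> with \<open>s + 1/s\<close> in the field, and these may generate a larger
  field.\<close>

locale alg_ideal =
  fixes I :: "complex set"
  assumes I_zero: "0 \<in> I"
    and I_add: "x \<in> I \<Longrightarrow> y \<in> I \<Longrightarrow> x + y \<in> I"
    and I_mult: "algebraic_int z \<Longrightarrow> x \<in> I \<Longrightarrow> z * x \<in> I"
    and I_alg: "x \<in> I \<Longrightarrow> algebraic_int x"
begin

lemma I_mult2: "algebraic_int z \<Longrightarrow> x \<in> I \<Longrightarrow> x * z \<in> I"
  by (subst mult.commute) (rule I_mult)

lemma I_neg: "x \<in> I \<Longrightarrow> - x \<in> I"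
  using I_mult[of "-1" x] by simp

lemma I_diff: "x \<in> I \<Longrightarrow> y \<in> I \<Longrightarrow> x - y \<in> I"
  using I_add[of x "-y"] I_neg[of y] by simp

lemma I_sum: "(\<And>i. i \<in> A \<Longrightarrow> f i \<in> I) \<Longrightarrow> sum f A \<in> I"
  by (induction A rule: infinite_finite_induct) (auto intro: I_zero I_add)

end

lemma alg_ideal_algebraic_ints: "alg_ideal {x. algebraic_int x}"
  by unfold_locales (auto intro: algebraic_int_intros)

lemma alg_ideal_principal:
  assumes "algebraic_int a" shows "alg_ideal {a * z | z. algebraic_int z}"
proof
  show "0 \<in> {a * z | z. algebraic_int z}" by (auto intro!: exI[of _ 0])
next
  fix x y :: complex assume "x \<in> {a * z | z. algebraic_int z}" "y \<in> {a * z | z. algebraic_int z}"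
  then obtain u w where "x = a * u" "algebraic_int u" "y = a * w" "algebraic_int w" by auto
  then show "x + y \<in> {a * z | z. algebraic_int z}"
    by (auto intro!: exI[of _ "u + w"] algebraic_int_intros simp: algebra_simps)
next
  fix x z :: complex assume "algebraic_int z" "x \<in> {a * z | z. algebraic_int z}"
  then obtain u where "x = a * u" "algebraic_int u" by auto
  with \<open>algebraic_int z\<close> show "z * x \<in> {a * z | z. algebraic_int z}"
    by (auto intro!: exI[of _ "z * u"] algebraic_int_intros simp: algebra_simps)
qed (use assms in \<open>auto intro: algebraic_int_intros\<close>)

locale prime_ideal_over = alg_ideal +
  fixes p :: nat
  assumes p: "prime p" and p_in: "of_nat p \<in> I" and one_notin: "1 \<notin> I"
    and I_prime: "algebraic_int x \<Longrightarrow> algebraic_int y \<Longrightarrow> x * y \<in> I \<Longrightarrow> x \<in> I \<or> y \<in> I"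
begin

lemma of_int_in_iff: "of_int z \<in> I \<longleftrightarrow> int p dvd z"
proof
  assume "int p dvd z"
  then obtain k where "z = k * int p" by (metis dvd_def mult.commute)
  then show "of_int z \<in> I" using I_mult[OF _ p_in, of "of_int k"] by simp
next
  assume z: "of_int z \<in> I"
  show "int p dvd z"
  proof (rule ccontr)
    assume "\<not> int p dvd z"
    then have "coprime (int p) z" using p by (simp add: prime_imp_coprime)
    then obtain a b where "a * int p + b * z = 1"
      using bezout_int[of "int p" z] by (auto simp: coprime_iff_gcd_eq_1)
    then have "of_int a * of_nat p + of_int b * of_int z = (1::complex)"
      by (metis of_int_1 of_int_add of_int_mult of_int_of_nat_eq)
    moreover have "of_int a * of_nat p + of_int b * of_int z \<in> I"
      using z p_in by (intro I_add I_mult) auto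
    ultimately show False using one_notin by simp
  qed
qed

lemma I_prod:
  "finite A \<Longrightarrow> (\<And>i. i \<in> A \<Longrightarrow> algebraic_int (f i)) \<Longrightarrow> prod f A \<in> I \<Longrightarrow> \<exists>i\<in>A. f i \<in> I"
proof (induction A rule: finite_induct)
  case (insert a A)
  then have "f a \<in> I \<or> prod f A \<in> I"
    by (intro I_prime) (auto intro: algebraic_int_prod)
  then show ?case using insert by auto
qed (use one_notin in auto)

lemma I_power: "algebraic_int x \<Longrightarrow> x ^ n \<in> I \<Longrightarrow> x \<in> I"
  using I_prod[of "{..<n}" "\<lambda>_. x"] by auto

lemma freshman:
  assumes "algebraic_int x" "algebraic_int y"
  shows "(x + y) ^ p - (x ^ p + y ^ p) \<in> I"
proof -
  have p0: "p > 0" using p by (simp add: prime_gt_0_nat)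
  have "(x + y) ^ p = (\<Sum>k\<le>p. of_nat (p choose k) * x ^ k * y ^ (p - k))"
    by (rule binomial_ring)
  also have "{..p} = insert 0 (insert p {1..<p})" using p0 by auto
  also have "(\<Sum>k\<in>\<dots>. of_nat (p choose k) * x ^ k * y ^ (p - k))
     = y ^ p + (x ^ p + (\<Sum>k=1..<p. of_nat (p choose k) * x ^ k * y ^ (p - k)))"
    using p0 by simp
  finally have eq: "(x + y) ^ p - (x ^ p + y ^ p) = (\<Sum>k=1..<p. of_nat (p choose k) * x ^ k * y ^ (p - k))"
    by simp
  have "of_nat (p choose k) * x ^ k * y ^ (p - k) \<in> I" if "k \<in> {1..<p}" for k
  proof -
    have "p dvd (p choose k)" using that p by (intro dvd_choose_prime) auto
    then have "of_int (int (p choose k)) \<in> I" by (subst of_int_in_iff) simp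
    then show ?thesis using assms by (intro I_mult2) (auto intro: algebraic_int_intros)
  qed
  then show ?thesis unfolding eq by (rule I_sum)
qed

text \<open>Fermat's little theorem, by induction with \<open>freshman\<close>; a negative
  \<open>c = - n\<close> is reduced to \<open>n\<close> because \<open>(n + c) ^ p\<close>
  vanishes.\<close>

lemma of_int_power: "of_int c ^ p - of_int c \<in> I"
proof -
  have p0: "p > 0" using p by (simp add: prime_gt_0_nat)
  have nat: "of_nat n ^ p - of_nat n \<in> I" for n
  proof (induction n)
    case (Suc n)
    have "of_nat (Suc n) = (of_nat n + 1 :: complex)" by simp
    then have "of_nat (Suc n) ^ p - (of_nat (Suc n) :: complex) =
        ((of_nat n + 1) ^ p - (of_nat n ^ p + 1 ^ p)) + (of_nat n ^ p - of_nat n)"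
      by (simp only:) simp
    also have "\<dots> \<in> I" using Suc by (intro I_add freshman) auto
    finally show ?case .
  qed (use I_zero p0 in \<open>simp add: power_0_left\<close>)
  show ?thesis
  proof (cases "c \<ge> 0")
    case True
    then obtain n where "c = int n" using nonneg_int_cases by blast
    then show ?thesis using nat[of n] by simp
  next
    case False
    then obtain n where c: "c = - int n" using nonpos_int_cases[of c] by auto
    have "of_int c ^ p - of_int c =
        - ((of_nat n + of_int c) ^ p - (of_nat n ^ p + of_int c ^ p)) - (of_nat n ^ p - of_nat n)"
      using p0 by (simp add: c power_0_left)
    also have "\<dots> \<in> I" by (intro I_diff I_neg nat freshman) auto
    finally show ?thesis .
  qed
qed

end

text \<open>Zorn's lemma gives an ideal maximal among those containing \<open>p\<close> but not 1,
  and maximality makes it prime. The family is nonempty: the multiples of \<open>p\<close> omit 1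
  because \<open>1 / p\<close> is rational but not an integer.\<close>

lemma ex_prime_ideal_over:
  assumes p: "prime p"
  obtains I where "prime_ideal_over I p"
proof -
  define \<A> where "\<A> = {I. alg_ideal I \<and> of_nat p \<in> I \<and> 1 \<notin> I}"
  let ?P = "{of_nat p * z | z. algebraic_int z} :: complex set"
  have p0: "p > 1" using p by (rule prime_gt_1_nat)
  have "?P \<in> \<A>"
  proof -
    have "1 \<notin> ?P"
    proof
      assume "1 \<in> ?P"
      then obtain z :: complex where z: "1 = of_nat p * z" "algebraic_int z" by auto
      then have zz: "z = 1 / of_nat p" using p0 by (auto simp: field_simps)
      have "z \<in> \<int>" using z(2) by (rule rational_algebraic_int_is_int) (simp add: zz)
      then obtain k where "z = of_int k" by (auto elim: Ints_cases)
      then have "of_int 1 = (of_int (int p * k) :: complex)" using z by simp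
      then have "1 = int p * k" by (simp only: of_int_eq_iff)
      then have "int p dvd 1" by (metis dvd_triv_left)
      then show False using p0 by simp
    qed
    moreover have "of_nat p \<in> ?P" by (auto intro!: exI[of _ 1])
    ultimately show ?thesis using alg_ideal_principal[of "of_nat p"] by (simp add: \<A>_def)
  qed
  have "\<exists>M\<in>\<A>. \<forall>U\<in>\<A>. M \<subseteq> U \<longrightarrow> U = M"
  proof (rule subset_Zorn_nonempty)
    show "\<A> \<noteq> {}" using \<open>?P \<in> \<A>\<close> by auto
  next
    fix C assume C: "C \<noteq> {}" "subset.chain \<A> C"
    then have CA: "C \<subseteq> \<A>" and tot: "\<And>U V. U \<in> C \<Longrightarrow> V \<in> C \<Longrightarrow> U \<subseteq> V \<or> V \<subseteq> U"
      by (auto simp: subset_chain_def)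
    have id: "alg_ideal U" "of_nat p \<in> U" "1 \<notin> U" if "U \<in> C" for U using CA that by (auto simp: \<A>_def)
    have "alg_ideal (\<Union>C)"
    proof
      show "0 \<in> \<Union>C" using C(1) id alg_ideal.I_zero by blast
    next
      fix x y assume "x \<in> \<Union>C" "y \<in> \<Union>C"
      then obtain U V where UV: "U \<in> C" "x \<in> U" "V \<in> C" "y \<in> V" by blast
      then have "(x \<in> V \<and> y \<in> V) \<or> (x \<in> U \<and> y \<in> U)" using tot by blast
      then show "x + y \<in> \<Union>C" using UV id alg_ideal.I_add by blast
    next
      fix x z :: complex assume "algebraic_int z" "x \<in> \<Union>C"
      then show "z * x \<in> \<Union>C" using id alg_ideal.I_mult by blast
    next
      fix x assume "x \<in> \<Union>C"
      then show "algebraic_int x" using id alg_ideal.I_alg by blast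
    qed
    moreover have "of_nat p \<in> \<Union>C" using C(1) id by blast
    moreover have "1 \<notin> \<Union>C" using id by blast
    ultimately show "\<Union>C \<in> \<A>" by (simp add: \<A>_def)
  qed
  then obtain M where M: "M \<in> \<A>" and max: "\<And>U. U \<in> \<A> \<Longrightarrow> M \<subseteq> U \<Longrightarrow> U = M" by blast
  interpret M: alg_ideal M using M by (simp add: \<A>_def)
  \<comment> \<open>By maximality the ideal generated by \<open>M\<close> and \<open>x\<close>
    contains 1.\<close>
  have ext: "\<exists>z m. algebraic_int z \<and> m \<in> M \<and> 1 = z * x + m" if x: "algebraic_int x" "x \<notin> M" for x
  proof (rule ccontr)
    assume no: "\<not> ?thesis"
    let ?U = "{z * x + m | z m. algebraic_int z \<and> m \<in> M}"
    have "alg_ideal ?U"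
    proof
      show "0 \<in> ?U" by (auto intro!: exI[of _ 0] M.I_zero)
    next
      fix a b assume "a \<in> ?U" "b \<in> ?U"
      then obtain z m z' m' where "a = z * x + m" "algebraic_int z" "m \<in> M"
        "b = z' * x + m'" "algebraic_int z'" "m' \<in> M" by blast
      then show "a + b \<in> ?U"
        by (intro CollectI exI[of _ "z + z'"] exI[of _ "m + m'"]) (auto intro: algebraic_int_intros M.I_add simp: distrib_right)
    next
      fix a w :: complex assume w: "algebraic_int w" "a \<in> ?U"
      then obtain z m where "a = z * x + m" "algebraic_int z" "m \<in> M" by blast
      with w show "w * a \<in> ?U"
        by (intro CollectI exI[of _ "w * z"] exI[of _ "w * m"]) (auto intro: algebraic_int_intros M.I_mult simp: distrib_left mult.assoc)
    next
      fix a assume "a \<in> ?U"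
      then show "algebraic_int a" using x M.I_alg by (auto intro!: algebraic_int_intros)
    qed
    moreover have MX: "M \<subseteq> ?U"
      by (rule subsetI, rule CollectI, rule exI[of _ 0]) auto
    moreover have "1 \<notin> ?U" using no by blast
    ultimately have "?U = M" using M by (intro max) (auto simp: \<A>_def)
    moreover have "x \<in> ?U" using M.I_zero
      by (intro CollectI exI[of _ 1] exI[of _ 0]) auto
    ultimately show False using x by simp
  qed
  have "prime_ideal_over M p"
  proof (unfold_locales)
    show "prime p" by fact
    show "of_nat p \<in> M" "1 \<notin> M" using M by (auto simp: \<A>_def)
    fix x y assume xy: "algebraic_int x" "algebraic_int y" "x * y \<in> M"
    show "x \<in> M \<or> y \<in> M"
    proof (rule ccontr)
      assume "\<not> (x \<in> M \<or> y \<in> M)"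
      then obtain z m where zm: "algebraic_int z" "m \<in> M" "1 = z * x + m" and yM: "y \<notin> M"
        using ext[OF xy(1)] by blast
      have "y = z * (x * y) + m * y" using zm(3) by (metis mult.assoc mult_1 distrib_right)
      also have "\<dots> \<in> M" using zm(1,2) xy(2,3) by (intro M.I_add M.I_mult[OF _ xy(3)] M.I_mult2)
      finally show False using yM by simp
    qed
  qed
  then show ?thesis by (rule that)
qed

section \<open>Polynomials with algebraic integer coefficients and their congruences\<close>

definition alg_poly :: "complex poly \<Rightarrow> bool" where
  "alg_poly f \<longleftrightarrow> (\<forall>i. algebraic_int (coeff f i))"

lemma alg_poly_0 [simp]: "alg_poly 0" and alg_poly_1 [simp]: "alg_poly 1"
  by (auto simp: alg_poly_def coeff_1)

lemma alg_poly_pCons: "algebraic_int a \<Longrightarrow> alg_poly f \<Longrightarrow> alg_poly (pCons a f)"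
  by (auto simp: alg_poly_def coeff_pCons split: nat.splits)

lemma alg_poly_monom: "algebraic_int a \<Longrightarrow> alg_poly (Polynomial.monom a n)"
  by (auto simp: alg_poly_def)

lemma alg_poly_add: "alg_poly f \<Longrightarrow> alg_poly g \<Longrightarrow> alg_poly (f + g)"
  and alg_poly_diff: "alg_poly f \<Longrightarrow> alg_poly g \<Longrightarrow> alg_poly (f - g)"
  and alg_poly_mult: "alg_poly f \<Longrightarrow> alg_poly g \<Longrightarrow> alg_poly (f * g)"
  and alg_poly_smult: "algebraic_int a \<Longrightarrow> alg_poly f \<Longrightarrow> alg_poly (smult a f)"
  by (auto simp: alg_poly_def coeff_mult intro!: algebraic_int_intros)

lemma alg_poly_sum: "(\<And>i. i \<in> A \<Longrightarrow> alg_poly (f i)) \<Longrightarrow> alg_poly (sum f A)"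
  by (induction A rule: infinite_finite_induct) (auto intro: alg_poly_add)

lemma alg_poly_prod: "(\<And>i. i \<in> A \<Longrightarrow> alg_poly (f i)) \<Longrightarrow> alg_poly (prod f A)"
  by (induction A rule: infinite_finite_induct) (auto intro: alg_poly_mult)

lemma alg_poly_pderiv: "alg_poly f \<Longrightarrow> alg_poly (pderiv f)"
  by (auto simp: alg_poly_def coeff_pderiv simp del: of_nat_Suc intro!: algebraic_int_intros)

lemma alg_poly_of_int [simp]: "alg_poly (map_poly of_int f)"
  by (auto simp: alg_poly_def coeff_map_poly)

lemmas alg_poly_intros = alg_poly_pCons alg_poly_monom alg_poly_add alg_poly_diff alg_poly_mult
  alg_poly_smult alg_poly_sum alg_poly_prod alg_poly_pderiv

lemma alg_poly_poly: "alg_poly f \<Longrightarrow> algebraic_int x \<Longrightarrow> algebraic_int (poly f x)"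
  by (simp add: poly_altdef) (auto simp: alg_poly_def intro!: algebraic_int_intros)

context alg_ideal begin

definition pcong :: "complex poly \<Rightarrow> complex poly \<Rightarrow> bool" where
  "pcong f g \<longleftrightarrow> (\<forall>i. coeff f i - coeff g i \<in> I)"

lemma pcong_refl [simp]: "pcong f f"
  by (simp add: pcong_def I_zero)

lemma pcong_sym: "pcong f g \<Longrightarrow> pcong g f"
  unfolding pcong_def by (metis I_neg minus_diff_eq)

lemma pcong_diff: "pcong f f' \<Longrightarrow> pcong g g' \<Longrightarrow> pcong (f - g) (f' - g')"
proof -
  assume "pcong f f'" "pcong g g'"
  moreover have "coeff f i - coeff g i - (coeff f' i - coeff g' i) = (coeff f i - coeff f' i) - (coeff g i - coeff g' i)" for i
    by simp
  ultimately show ?thesis unfolding pcong_def by (metis I_diff coeff_diff)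
qed

lemma pcong_mult:
  assumes "pcong f f'" "pcong g g'" "alg_poly g" "alg_poly f'"
  shows "pcong (f * g) (f' * g')"
  unfolding pcong_def
proof
  fix n
  have "coeff (f * g) n - coeff (f' * g') n =
      (\<Sum>i\<le>n. coeff f i * coeff g (n - i) - coeff f' i * coeff g' (n - i))"
    by (simp add: coeff_mult sum_subtractf)
  also have "\<dots> \<in> I"
  proof (rule I_sum)
    fix i
    have "coeff f i * coeff g (n - i) - coeff f' i * coeff g' (n - i) =
      (coeff f i - coeff f' i) * coeff g (n - i) + coeff f' i * (coeff g (n - i) - coeff g' (n - i))"
      by (simp add: algebra_simps)
    also have "\<dots> \<in> I" using assms
      by (intro I_add I_mult I_mult2) (auto simp: pcong_def alg_poly_def)
    finally show "coeff f i * coeff g (n - i) - coeff f' i * coeff g' (n - i) \<in> I" .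
  qed
  finally show "coeff (f * g) n - coeff (f' * g') n \<in> I" .
qed

lemma pcong_prod:
  assumes "\<And>i. i \<in> A \<Longrightarrow> pcong (f i) (g i)" "\<And>i. i \<in> A \<Longrightarrow> alg_poly (f i)" "\<And>i. i \<in> A \<Longrightarrow> alg_poly (g i)"
  shows "pcong (prod f A) (prod g A)"
  using assms
  by (induction A rule: infinite_finite_induct) (auto intro!: pcong_mult alg_poly_prod)

lemma pcong_pderiv: "pcong f g \<Longrightarrow> pcong (pderiv f) (pderiv g)"
  unfolding pcong_def
  by (auto simp: coeff_pderiv right_diff_distrib[symmetric] simp del: of_nat_Suc intro!: I_mult)

text \<open>Descending induction: coefficient \<open>i + degree U\<close> of the product is
  \<open>coeff V i\<close> plus terms with higher coefficients of \<open>V\<close>. It serves twice: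
  for the ideal of all algebraic integers it shows that a cofactor of a monic factor is integral,
  and for a prime ideal it forces a product of too small degree to vanish.\<close>

lemma monic_mult_coeffs:
  assumes U: "lead_coeff U = 1" "alg_poly U"
    and UV: "\<And>j. j \<ge> degree U \<Longrightarrow> coeff (U * V) j \<in> I"
  shows "coeff V i \<in> I"
proof (induction "degree V - i" arbitrary: i rule: less_induct)
  case less
  show ?case
  proof (cases "i > degree V")
    case True
    then show ?thesis by (simp add: coeff_eq_0 I_zero)
  next
    case False
    let ?n = "i + degree U"
    have "coeff (U * V) ?n = (\<Sum>j\<le>?n. coeff U j * coeff V (?n - j))" by (rule coeff_mult)
    also have "\<dots> = (\<Sum>j\<le>degree U. coeff U j * coeff V (?n - j))"
      by (rule sum.mono_neutral_right) (auto simp: coeff_eq_0)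
    also have "\<dots> = coeff V i + (\<Sum>j<degree U. coeff U j * coeff V (?n - j))"
      using U(1) by (simp add: lessThan_Suc_atMost[symmetric])
    finally have eq: "coeff V i = coeff (U * V) ?n - (\<Sum>j<degree U. coeff U j * coeff V (?n - j))"
      by simp
    have "coeff V (?n - j) \<in> I" if "j < degree U" for j
    proof (cases "?n - j > degree V")
      case True
      then show ?thesis by (simp add: coeff_eq_0 I_zero)
    next
      case F: False
      show ?thesis by (rule less.hyps) (use that F in auto)
    qed
    then show ?thesis unfolding eq using U(2)
      by (intro I_diff I_sum I_mult UV) (auto simp: alg_poly_def)
  qed
qed

end

context prime_ideal_over begin

text \<open>Raising to the power \<open>p\<close> is additive modulo \<open>I\<close> and fixes
  integers, so it passes through integer polynomials.\<close>

lemma poly_frobenius: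
  assumes x: "algebraic_int x"
  shows "poly (map_poly of_int h) (x ^ p) - poly (map_poly of_int h) x ^ p \<in> I"
proof (induction h)
  case 0
  then show ?case using p by (simp add: I_zero power_0_left prime_gt_0_nat)
next
  case (pCons c h)
  let ?h = "map_poly of_int h :: complex poly"
  have m: "map_poly of_int (pCons c h) = (pCons (of_int c) ?h :: complex poly)"
    using pCons.hyps by (simp add: map_poly_pCons)
  have ah: "algebraic_int (poly ?h x)" using x by (intro alg_poly_poly) auto
  have "poly (map_poly of_int (pCons c h)) (x ^ p) - poly (map_poly of_int (pCons c h)) x ^ p
     = x ^ p * (poly ?h (x ^ p) - poly ?h x ^ p) - (of_int c ^ p - of_int c)
       - ((of_int c + x * poly ?h x) ^ p - (of_int c ^ p + (x * poly ?h x) ^ p))"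
    unfolding m by (simp add: algebra_simps power_mult_distrib)
  also have "\<dots> \<in> I"
    using x ah by (intro I_diff[OF I_diff[OF I_mult[OF _ pCons.IH] of_int_power] freshman] algebraic_int_intros) auto
  finally show ?case .
qed

end

section \<open>Abelian extensions and the Frobenius automorphism\<close>

interpretation of_rat_poly_hom: map_poly_inj_comm_ring_hom "of_rat :: rat \<Rightarrow> complex" ..

abbreviation rpoly :: "rat poly \<Rightarrow> complex \<Rightarrow> complex" where
  "rpoly r x \<equiv> poly (map_poly of_rat r) x"

lemma rpoly_simps [simp]:
  "rpoly (r + s) x = rpoly r x + rpoly s x"
  "rpoly (r - s) x = rpoly r x - rpoly s x"
  "rpoly (- r) x = - rpoly r x"
  "rpoly (r * s) x = rpoly r x * rpoly s x"
  "rpoly (pCons q r) x = of_rat q + x * rpoly r x"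
  by (simp_all add: hom_distribs map_poly_pCons)

text \<open>The ring \<open>Q[\<alpha>]\<close>, which is the generated field once
  \<open>\<alpha>\<close> has a minimal polynomial (\<open>rat_adjoin_eq\<close>). Writing elements
  as polynomial values makes conjugation a substitution.\<close>

definition rat_values :: "complex \<Rightarrow> complex set" where
  "rat_values \<alpha> = {rpoly r \<alpha> | r. True}"

lemma rat_valuesI: "rpoly r \<alpha> \<in> rat_values \<alpha>"
  by (auto simp: rat_values_def)

lemma rat_values_rat: "of_rat q \<in> rat_values \<alpha>"
  using rat_valuesI[of "[:q:]" \<alpha>] by simp

lemma rat_values_self: "\<alpha> \<in> rat_values \<alpha>"
  using rat_valuesI[of "[:0,1:]" \<alpha>] by simp

lemma rat_values_add: "x \<in> rat_values \<alpha> \<Longrightarrow> y \<in> rat_values \<alpha> \<Longrightarrow> x + y \<in> rat_values \<alpha>"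
  unfolding rat_values_def by (auto simp flip: rpoly_simps(1))

lemma rat_values_diff: "x \<in> rat_values \<alpha> \<Longrightarrow> y \<in> rat_values \<alpha> \<Longrightarrow> x - y \<in> rat_values \<alpha>"
  unfolding rat_values_def by (auto simp flip: rpoly_simps(2))

lemma rat_values_minus: "x \<in> rat_values \<alpha> \<Longrightarrow> - x \<in> rat_values \<alpha>"
  unfolding rat_values_def by (auto simp flip: rpoly_simps(3))

lemma rat_values_mult: "x \<in> rat_values \<alpha> \<Longrightarrow> y \<in> rat_values \<alpha> \<Longrightarrow> x * y \<in> rat_values \<alpha>"
  unfolding rat_values_def by (auto simp flip: rpoly_simps(4))

lemma rat_values_rpoly: "x \<in> rat_values \<alpha> \<Longrightarrow> rpoly r x \<in> rat_values \<alpha>"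
  by (induction r) (auto intro: rat_values_add rat_values_mult rat_values_rat simp: rat_values_rat[of 0, simplified])

lemma rat_values_mono: "x \<in> rat_values \<alpha> \<Longrightarrow> rat_values x \<subseteq> rat_values \<alpha>"
  using rat_values_rpoly by (auto simp: rat_values_def[of x])

lemma rat_values_sum: "(\<And>i. i \<in> A \<Longrightarrow> f i \<in> rat_values \<alpha>) \<Longrightarrow> sum f A \<in> rat_values \<alpha>"
  using rat_values_rat[of 0 \<alpha>]
  by (induction A rule: infinite_finite_induct) (auto intro: rat_values_add)

lemma rat_values_prod: "(\<And>i. i \<in> A \<Longrightarrow> f i \<in> rat_values \<alpha>) \<Longrightarrow> prod f A \<in> rat_values \<alpha>"
  using rat_values_rat[of 1 \<alpha>]
  by (induction A rule: infinite_finite_induct) (auto intro: rat_values_mult)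

text \<open>If \<open>f\<close> did not divide \<open>r\<close>, the two would be coprime, and a
  Bezout identity evaluated at the common root would read 0 = 1.\<close>

lemma irreducible_rpoly_dvd:
  assumes f: "irreducible f" and a: "rpoly f a = 0" "rpoly r a = 0"
  shows "f dvd r"
proof (rule ccontr)
  assume "\<not> f dvd r"
  then have "coprime f r" using f by (simp add: irreducible_imp_prime_elem_gcd prime_elem_imp_coprime)
  then have "fst (bezout_coefficients f r) * f + snd (bezout_coefficients f r) * r = 1"
    using bezout_coefficients_fst_snd[of f r] by (simp add: coprime_iff_gcd_eq_1)
  then have "rpoly (fst (bezout_coefficients f r) * f + snd (bezout_coefficients f r) * r) a = rpoly 1 a" by simp
  then show False using a by simp
qed

lemma minimal_rpoly_exists:
  assumes "algebraic_int \<alpha>"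
  obtains f where "irreducible f" "lead_coeff f = 1" "rpoly f \<alpha> = 0"
proof -
  obtain p where p: "poly (map_poly of_int p) \<alpha> = 0" "lead_coeff p = 1"
    using assms by (auto simp: algebraic_int_altdef_ipoly)
  define P where "P = (\<lambda>g::rat poly. lead_coeff g = 1 \<and> rpoly g \<alpha> = 0)"
  have "P (map_poly of_int p)"
    using p by (simp add: P_def map_poly_map_poly o_def)
  then obtain f where f: "P f" and min: "\<And>g. P g \<Longrightarrow> degree f \<le> degree g"
    using ex_has_least_nat[of P _ degree] by blast
  have f1: "lead_coeff f = 1" and f0: "rpoly f \<alpha> = 0" using f by (auto simp: P_def)
  have fnz: "f \<noteq> 0" using f1 by auto
  have low: "degree f \<le> degree g" if g: "g \<noteq> 0" "rpoly g \<alpha> = 0" for g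
  proof -
    have "P (smult (inverse (lead_coeff g)) g)" using g
      by (simp add: P_def of_rat_hom.map_poly_hom_smult)
    then have "degree f \<le> degree (smult (inverse (lead_coeff g)) g)" by (rule min)
    then show ?thesis using g by simp
  qed
  have deg: "degree f > 0"
  proof (rule ccontr)
    assume "\<not> degree f > 0"
    then obtain c where "f = [:c:]" using degree_eq_zeroE by auto
    then show False using f1 f0 by auto
  qed
  have "irreducible f"
  proof (rule irreducibleI)
    show "f \<noteq> 0" by fact
    show "\<not> f dvd 1" using deg by (simp add: poly_dvd_1)
    fix a b assume ab: "f = a * b"
    have nz: "a \<noteq> 0" "b \<noteq> 0" using ab fnz by auto
    have dd: "degree f = degree a + degree b" using ab nz by (simp add: degree_mult_eq)
    have "rpoly a \<alpha> = 0 \<or> rpoly b \<alpha> = 0" using f0 ab by simp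
    then have "degree f \<le> degree a \<or> degree f \<le> degree b" using low nz by blast
    then have "degree a = 0 \<or> degree b = 0" using dd by auto
    then show "a dvd 1 \<or> b dvd 1" using nz by (auto simp: is_unit_iff_degree)
  qed
  then show ?thesis using f1 f0 by (rule that)
qed

locale rat_ext =
  fixes f :: "rat poly" and \<alpha> :: complex
  assumes irr: "irreducible f" and monic: "lead_coeff f = 1" and root: "rpoly f \<alpha> = 0"
begin

definition F :: "complex poly" where "F = map_poly of_rat f"
definition R :: "complex set" where "R = {z. rpoly f z = 0}"

text \<open>The embedding of \<open>Q(\<alpha>)\<close> that sends \<open>\<alpha>\<close> to its
  conjugate \<open>a\<close>. The polynomial picked by \<open>SOME\<close> is immaterial by
  \<open>rpoly_transfer\<close>.\<close>

definition \<sigma> :: "complex \<Rightarrow> complex \<Rightarrow> complex" where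
  "\<sigma> a x = rpoly (SOME r. rpoly r \<alpha> = x) a"

lemma f_nz: "f \<noteq> 0" using monic by auto

lemma F_monic: "lead_coeff F = 1" and deg_F: "degree F = degree f"
  using monic by (auto simp: F_def)

lemma F_nz: "F \<noteq> 0" using F_monic by auto

lemma fin_R: "finite R"
  using F_nz poly_roots_finite[of F] by (simp add: R_def F_def)

lemma \<alpha>_R: "\<alpha> \<in> R" using root by (simp add: R_def)

lemma dvd_iff: "a \<in> R \<Longrightarrow> rpoly r a = 0 \<longleftrightarrow> f dvd r"
  using irreducible_rpoly_dvd[OF irr] by (auto simp: R_def elim!: dvdE)

lemma rpoly_transfer:
  assumes "a \<in> R" "b \<in> R" "rpoly r a = rpoly s a" shows "rpoly r b = rpoly s b"
  using dvd_iff[OF assms(1), of "r - s"] dvd_iff[OF assms(2), of "r - s"] assms(3) by simp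

lemma \<sigma>_rpoly: "a \<in> R \<Longrightarrow> \<sigma> a (rpoly r \<alpha>) = rpoly r a"
  unfolding \<sigma>_def by (rule rpoly_transfer[OF \<alpha>_R]) (auto intro: someI)

lemma \<sigma>_\<alpha>: "a \<in> R \<Longrightarrow> \<sigma> a \<alpha> = a"
  using \<sigma>_rpoly[of a "[:0,1:]"] by simp

lemma \<sigma>_rat: "a \<in> R \<Longrightarrow> \<sigma> a (of_rat q) = of_rat q"
  using \<sigma>_rpoly[of a "[:q:]"] by simp

lemma \<sigma>_add: "a \<in> R \<Longrightarrow> x \<in> rat_values \<alpha> \<Longrightarrow> y \<in> rat_values \<alpha> \<Longrightarrow> \<sigma> a (x + y) = \<sigma> a x + \<sigma> a y"
  unfolding rat_values_def using \<sigma>_rpoly[of a] by clarsimp (metis rpoly_simps(1))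

lemma \<sigma>_diff: "a \<in> R \<Longrightarrow> x \<in> rat_values \<alpha> \<Longrightarrow> y \<in> rat_values \<alpha> \<Longrightarrow> \<sigma> a (x - y) = \<sigma> a x - \<sigma> a y"
  unfolding rat_values_def using \<sigma>_rpoly[of a] by clarsimp (metis rpoly_simps(2))

lemma \<sigma>_mult: "a \<in> R \<Longrightarrow> x \<in> rat_values \<alpha> \<Longrightarrow> y \<in> rat_values \<alpha> \<Longrightarrow> \<sigma> a (x * y) = \<sigma> a x * \<sigma> a y"
  unfolding rat_values_def using \<sigma>_rpoly[of a] by clarsimp (metis rpoly_simps(4))

lemma \<sigma>_sum: "a \<in> R \<Longrightarrow> (\<And>i. i \<in> A \<Longrightarrow> g i \<in> rat_values \<alpha>) \<Longrightarrow> \<sigma> a (sum g A) = (\<Sum>i\<in>A. \<sigma> a (g i))"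
  using \<sigma>_rat[of a 0]
  by (induction A rule: infinite_finite_induct) (auto simp: \<sigma>_add rat_values_sum)

lemma \<sigma>_prod: "a \<in> R \<Longrightarrow> (\<And>i. i \<in> A \<Longrightarrow> g i \<in> rat_values \<alpha>) \<Longrightarrow> \<sigma> a (prod g A) = (\<Prod>i\<in>A. \<sigma> a (g i))"
  using \<sigma>_rat[of a 1]
  by (induction A rule: infinite_finite_induct) (auto simp: \<sigma>_mult rat_values_prod)

lemma \<sigma>_poly: "a \<in> R \<Longrightarrow> x \<in> rat_values \<alpha> \<Longrightarrow> \<sigma> a (rpoly r x) = rpoly r (\<sigma> a x)"
  using \<sigma>_rat[of a 0]
  by (induction r) (auto simp: \<sigma>_add \<sigma>_mult \<sigma>_rat rat_values_rat rat_values_rpoly rat_values_mult)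

lemma \<sigma>_id: "x \<in> rat_values \<alpha> \<Longrightarrow> \<sigma> \<alpha> x = x"
  using \<sigma>_rpoly[OF \<alpha>_R] by (auto simp: rat_values_def)

lemma \<sigma>_eq_0_iff: "a \<in> R \<Longrightarrow> x \<in> rat_values \<alpha> \<Longrightarrow> \<sigma> a x = 0 \<longleftrightarrow> x = 0"
  using \<sigma>_rpoly dvd_iff \<alpha>_R by (auto simp: rat_values_def)

lemma int_poly_rpoly: "poly (map_poly of_int q) x = rpoly (map_poly of_int q) x"
  by (simp add: map_poly_map_poly o_def)

lemma \<sigma>_algebraic_int:
  assumes "a \<in> R" "x \<in> rat_values \<alpha>" "algebraic_int x" shows "algebraic_int (\<sigma> a x)"
proof -
  obtain q where q: "poly (map_poly of_int q) x = 0" "lead_coeff q = 1"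
    using assms(3) by (auto simp: algebraic_int_altdef_ipoly)
  have "poly (map_poly of_int q) (\<sigma> a x) = \<sigma> a (poly (map_poly of_int q) x)"
    unfolding int_poly_rpoly using \<sigma>_poly assms by simp
  also have "\<dots> = 0" using q \<sigma>_rat[OF assms(1), of 0] by simp
  finally show ?thesis using q by (auto simp: algebraic_int_altdef_ipoly)
qed

text \<open>Separability: an irreducible \<open>f\<close> that shares a root with its derivative
  would divide it, against the degrees.\<close>

lemma F_deriv: "a \<in> R \<Longrightarrow> poly (pderiv F) a \<noteq> 0"
proof
  assume a: "a \<in> R" "poly (pderiv F) a = 0"
  have "pderiv F = map_poly of_rat (pderiv f)"
    by (simp add: F_def of_rat_hom.map_poly_pderiv)
  then have "f dvd pderiv f" using a dvd_iff by simp
  moreover have df: "degree f \<noteq> 0" using irr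
    by (metis F_def \<alpha>_R R_def degree_eq_zeroE dvd_iff irreducible_def is_unit_triv leading_coeff_0_iff mem_Collect_eq monic one_pCons pCons_0_0 degree_pCons_0 coeff_pCons_0 zero_neq_one)
  ultimately show False
    using dvd_imp_degree_le[of f "pderiv f"] by (auto simp: degree_pderiv pderiv_eq_0_iff)
qed

lemma F_prod: "F = (\<Prod>a\<in>R. [:-a, 1:])"
proof -
  have "rsquarefree F"
    unfolding rsquarefree_roots using F_deriv by (auto simp: R_def F_def)
  then have "smult (lead_coeff F) (\<Prod>z|poly F z = 0. [:-z, 1:]) = F"
    by (rule complex_poly_decompose_rsquarefree)
  then show ?thesis using F_monic by (simp add: R_def F_def)
qed

lemma card_R: "card R = degree f"
proof -
  have "degree F = card R" unfolding F_prod by (subst degree_prod_eq_sum_degree) auto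
  then show ?thesis using deg_F by simp
qed

lemma degree_pos: "degree f > 0"
  using card_R \<alpha>_R fin_R card_gt_0_iff[of R] by auto

text \<open>Reduced modulo \<open>f\<close>, a polynomial representing \<open>x\<close> has degree
  below \<open>card R\<close> but takes the value \<open>x\<close> at all conjugates, so it is the
  constant \<open>x\<close>. This replaces the Galois correspondence.\<close>

lemma fixed_rat:
  assumes x: "x \<in> rat_values \<alpha>" and fixed: "\<And>a. a \<in> R \<Longrightarrow> \<sigma> a x = x"
  shows "x \<in> \<rat>"
proof -
  obtain r where r: "x = rpoly r \<alpha>" using x by (auto simp: rat_values_def)
  define s where "s = r mod f"
  have "f dvd r - s" by (simp add: s_def minus_mod_eq_mult_div)
  then have rs: "rpoly s a = rpoly r a" if "a \<in> R" for a
    using dvd_iff[OF that, of "r - s"] by simp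
  have sx: "rpoly s a = x" if "a \<in> R" for a
    using fixed[OF that] \<sigma>_rpoly[OF that] rs[OF that] r by simp
  define g where "g = map_poly of_rat s - [:x:]"
  have "degree s < degree f" using degree_pos degree_mod_less[of f s] f_nz
    by (metis degree_0 degree_mod_less s_def)
  then have dg: "degree g < card R" unfolding card_R g_def
    using degree_diff_less[of "map_poly of_rat s" "degree f" "[:x:]"] degree_pos by auto
  have "g = 0"
  proof (rule ccontr)
    assume g: "g \<noteq> 0"
    have "R \<subseteq> {z. poly g z = 0}" using sx by (auto simp: g_def)
    then have "card R \<le> card {z. poly g z = 0}" by (rule card_mono[OF poly_roots_finite[OF g]])
    also have "\<dots> \<le> degree g" by (rule card_poly_roots_bound[OF g])
    finally show False using dg by simp
  qed
  then have "coeff (map_poly of_rat s) 0 = coeff [:x:] 0" by (simp add: g_def)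
  then show ?thesis by (simp add: coeff_map_poly) (metis Rats_of_rat)
qed

text \<open>By Horner's scheme the coefficients of the quotient by \<open>X - x\<close> are rational
  polynomials in \<open>x\<close>, so embeddings act on them through \<open>x\<close>.\<close>

lemma coeff_synthetic_div:
  assumes a: "a \<in> R" and x: "x \<in> rat_values \<alpha>"
  shows "coeff (synthetic_div (map_poly of_rat g) x) j \<in> rat_values \<alpha> \<and>
    \<sigma> a (coeff (synthetic_div (map_poly of_rat g) x) j) = coeff (synthetic_div (map_poly of_rat g) (\<sigma> a x)) j"
proof (induction g arbitrary: j)
  case 0
  then show ?case using rat_values_rat[of 0] \<sigma>_rat[OF a, of 0] by simp
next
  case (pCons c g)
  then show ?case using rat_values_rpoly[OF x] \<sigma>_poly[OF a x]
    by (simp add: map_poly_pCons coeff_pCons split: nat.splits)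
qed

end

lemma (in rat_ext) rat_values_inverse:
  assumes "x \<in> rat_values \<alpha>" "x \<noteq> 0" shows "inverse x \<in> rat_values \<alpha>"
proof -
  obtain r where r: "x = rpoly r \<alpha>" using assms(1) by (auto simp: rat_values_def)
  have "\<not> f dvd r" using dvd_iff[OF \<alpha>_R] assms(2) r by auto
  then have "coprime f r" using irr by (simp add: irreducible_imp_prime_elem_gcd prime_elem_imp_coprime)
  then have "fst (bezout_coefficients f r) * f + snd (bezout_coefficients f r) * r = 1"
    using bezout_coefficients_fst_snd[of f r] by (simp add: coprime_iff_gcd_eq_1)
  then have "rpoly (fst (bezout_coefficients f r) * f + snd (bezout_coefficients f r) * r) \<alpha> = rpoly 1 \<alpha>" by simp
  then have "rpoly (snd (bezout_coefficients f r)) \<alpha> * x = 1" using root r by simp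
  then have "inverse x = rpoly (snd (bezout_coefficients f r)) \<alpha>"
    by (metis inverse_unique mult.commute)
  then show ?thesis by (simp add: rat_valuesI)
qed

lemma (in rat_ext) rat_adjoin_eq: "rat_adjoin \<alpha> = rat_values \<alpha>"
proof -
  interpret C: field complex_ring by (rule field_from_type_algebra)
  have neg: "\<ominus>\<^bsub>complex_ring\<^esub> x = - x" for x :: complex
    by (rule C.minus_equality) (auto simp: ring_of_type_algebra_def)
  have inv: "inv\<^bsub>complex_ring\<^esub> x = inverse x" if "x \<noteq> 0" for x :: complex
    by (rule C.comm_inv_char) (use that in \<open>auto simp: ring_of_type_algebra_def\<close>)
  note G = generate_field.intros[where R = complex_ring and H = "{\<alpha>}"]
  have one: "1 \<in> rat_adjoin \<alpha>" using G(1) by (simp add: rat_adjoin_def ring_of_type_algebra_def)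
  have add: "x + y \<in> rat_adjoin \<alpha>" if "x \<in> rat_adjoin \<alpha>" "y \<in> rat_adjoin \<alpha>" for x y
    using G(5) that by (simp add: rat_adjoin_def ring_of_type_algebra_def)
  have mult: "x * y \<in> rat_adjoin \<alpha>" if "x \<in> rat_adjoin \<alpha>" "y \<in> rat_adjoin \<alpha>" for x y
    using G(6) that by (simp add: rat_adjoin_def ring_of_type_algebra_def)
  have minus: "- x \<in> rat_adjoin \<alpha>" if "x \<in> rat_adjoin \<alpha>" for x
    using G(3)[of x] that neg by (simp add: rat_adjoin_def)
  have inverse: "inverse x \<in> rat_adjoin \<alpha>" if "x \<in> rat_adjoin \<alpha>" for x
  proof (cases "x = 0")
    case False
    then show ?thesis
      using G(4)[of x] that inv by (simp add: rat_adjoin_def ring_of_type_algebra_def)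
  qed (use that in simp)
  have zero: "0 \<in> rat_adjoin \<alpha>" using add[OF one minus[OF one]] by simp
  have nat: "of_nat n \<in> rat_adjoin \<alpha>" for n
    using zero one add by (induction n) auto
  have int: "of_int n \<in> rat_adjoin \<alpha>" for n
    by (cases n) (auto simp del: of_nat_Suc intro: nat minus)
  have rat: "of_rat q \<in> rat_adjoin \<alpha>" for q
  proof (cases q)
    case (Fract a b)
    then have "of_rat q = (of_int a * inverse (of_int b) :: complex)"
      by (simp add: of_rat_rat divide_inverse)
    then show ?thesis by (auto intro: mult int inverse)
  qed
  have self: "\<alpha> \<in> rat_adjoin \<alpha>" using G(2) by (simp add: rat_adjoin_def)
  have "rpoly r \<alpha> \<in> rat_adjoin \<alpha>" for r
    by (induction r) (auto intro: zero rat add mult self)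
  moreover have "h \<in> rat_values \<alpha>" if "h \<in> rat_adjoin \<alpha>" for h
    using that unfolding rat_adjoin_def
  proof (induction rule: generate_field.induct)
    case one
    then show ?case using rat_values_rat[of 1] by (simp add: ring_of_type_algebra_def)
  next
    case (m_inv h)
    then have "h \<noteq> 0" by (simp add: ring_of_type_algebra_def)
    then show ?case using m_inv.IH inv[of h] rat_values_inverse by simp
  next
    case (eng_add a b)
    then show ?case using rat_values_add[of a \<alpha> b] by (simp add: ring_of_type_algebra_def)
  next
    case (eng_mult a b)
    then show ?case using rat_values_mult[of a \<alpha> b] by (simp add: ring_of_type_algebra_def)
  qed (auto simp: neg rat_values_minus rat_values_self)
  ultimately show ?thesis by (auto simp: rat_values_def)
qed

text \<open>The abelian hypothesis restated for embeddings. The group \<open>galois_group\<close>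
  enters only through \<open>abelian_extI\<close>; from there on only these two properties are
  used.\<close>

locale abelian_ext = rat_ext +
  assumes normal: "R \<subseteq> rat_values \<alpha>"
    and comm: "a \<in> R \<Longrightarrow> b \<in> R \<Longrightarrow> x \<in> rat_values \<alpha> \<Longrightarrow> \<sigma> a (\<sigma> b x) = \<sigma> b (\<sigma> a x)"

context rat_ext begin

lemma \<sigma>_in_R: "a \<in> R \<Longrightarrow> b \<in> R \<Longrightarrow> b \<in> rat_values \<alpha> \<Longrightarrow> \<sigma> a b \<in> R"
  using \<sigma>_poly[of a b f] \<sigma>_rat[of a 0] by (simp add: R_def)

lemma \<sigma>_inj: "a \<in> R \<Longrightarrow> inj_on (\<sigma> a) (rat_values \<alpha>)"
proof (rule inj_onI)
  fix x y assume h: "a \<in> R" "x \<in> rat_values \<alpha>" "y \<in> rat_values \<alpha>" "\<sigma> a x = \<sigma> a y"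
  then have "\<sigma> a (x - y) = 0" by (simp add: \<sigma>_diff)
  then show "x = y" using \<sigma>_eq_0_iff[OF h(1), of "x - y"] rat_values_diff h by auto
qed

context
  assumes norm: "R \<subseteq> rat_values \<alpha>"
begin

lemma \<sigma>_values: "a \<in> R \<Longrightarrow> x \<in> rat_values \<alpha> \<Longrightarrow> \<sigma> a x \<in> rat_values \<alpha>"
proof -
  assume h: "a \<in> R" "x \<in> rat_values \<alpha>"
  then obtain r where "x = rpoly r \<alpha>" by (auto simp: rat_values_def)
  then show ?thesis using h norm \<sigma>_rpoly[OF h(1)] rat_values_rpoly[of a] by auto
qed

lemma \<sigma>_bij_R: "a \<in> R \<Longrightarrow> bij_betw (\<sigma> a) R R"
proof -
  assume a: "a \<in> R"
  have "inj_on (\<sigma> a) R" using \<sigma>_inj[OF a] norm by (rule inj_on_subset)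
  moreover have "\<sigma> a ` R \<subseteq> R" using \<sigma>_in_R[OF a] norm by auto
  ultimately show ?thesis using endo_inj_surj[OF fin_R] by (simp add: bij_betw_def)
qed

lemma \<sigma>_comp: "a \<in> R \<Longrightarrow> b \<in> R \<Longrightarrow> x \<in> rat_values \<alpha> \<Longrightarrow> \<sigma> a (\<sigma> b x) = \<sigma> (\<sigma> a b) x"
proof -
  assume a: "a \<in> R" "b \<in> R" "x \<in> rat_values \<alpha>"
  obtain r where "x = rpoly r \<alpha>" using a(3) by (auto simp: rat_values_def)
  then show ?thesis using a \<sigma>_rpoly \<sigma>_poly norm \<sigma>_in_R by (auto simp: subset_iff)
qed

lemma \<sigma>_bij: "a \<in> R \<Longrightarrow> bij_betw (\<sigma> a) (rat_values \<alpha>) (rat_values \<alpha>)"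
proof -
  assume a: "a \<in> R"
  obtain b where b: "b \<in> R" "\<sigma> a b = \<alpha>" using \<sigma>_bij_R[OF a] \<alpha>_R by (metis bij_betw_imp_surj_on imageE)
  have "x \<in> \<sigma> a ` rat_values \<alpha>" if x: "x \<in> rat_values \<alpha>" for x
  proof -
    have "\<sigma> a (\<sigma> b x) = x" using \<sigma>_comp[OF a b(1) x] b \<sigma>_id[OF x] by simp
    then show ?thesis using \<sigma>_values[OF b(1) x] by (metis imageI)
  qed
  then show ?thesis using \<sigma>_inj[OF a] \<sigma>_values[OF a] by (auto simp: bij_betw_def)
qed

lemma restrict_\<sigma>_galois:
  assumes a: "a \<in> R"
  shows "restrict (\<sigma> a) (rat_values \<alpha>) \<in> carrier (galois_group (rat_values \<alpha>))"
proof -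
  have "bij_betw (restrict (\<sigma> a) (rat_values \<alpha>)) (rat_values \<alpha>) (rat_values \<alpha>)"
    using \<sigma>_bij[OF a] by (simp add: bij_betw_restrict_eq)
  then show ?thesis
    using \<sigma>_rat[OF a] \<sigma>_rat[OF a, of 1] rat_values_rat[of _ \<alpha>] rat_values_rat[of 1 \<alpha>]
    by (auto simp: galois_group_def ring_iso_def Ring.ring_hom_def ring_of_type_algebra_def
        \<sigma>_add[OF a] \<sigma>_mult[OF a] rat_values_add rat_values_mult \<sigma>_values[OF a] bij_betw_def elim!: Rats_cases)
qed

end

text \<open>Normality is applied to \<open>f\<close> itself, which has the root
  \<open>\<alpha>\<close> in the field. The restricted embeddings are then elements of the Galois
  group, whose product is \<open>compose\<close>.\<close>

lemma abelian_extI: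
  assumes ab: "abelian_number_field (rat_values \<alpha>)"
  shows "abelian_ext f \<alpha>"
proof
  have gal: "galois_over_rat (rat_values \<alpha>)" and cg: "comm_group (galois_group (rat_values \<alpha>))"
    using ab by (auto simp: abelian_number_field_def)
  show norm: "R \<subseteq> rat_values \<alpha>"
    using gal irr root rat_values_self[of \<alpha>] by (auto simp: galois_over_rat_def R_def)
  interpret G: comm_group "galois_group (rat_values \<alpha>)" by fact
  fix a b x assume h: "a \<in> R" "b \<in> R" "x \<in> rat_values \<alpha>"
  let ?K = "rat_values \<alpha>"
  have r: "restrict (\<sigma> c) ?K \<in> carrier (galois_group ?K)" "restrict (\<sigma> c) ?K \<in> Bij ?K" if "c \<in> R" for c
    using restrict_\<sigma>_galois[OF norm that] \<sigma>_bij[OF norm that]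
    by (auto simp: Bij_def bij_betw_restrict_eq)
  have "compose ?K (restrict (\<sigma> a) ?K) (restrict (\<sigma> b) ?K) = compose ?K (restrict (\<sigma> b) ?K) (restrict (\<sigma> a) ?K)"
    using G.m_comm[OF r(1)[OF h(1)] r(1)[OF h(2)]] r(2) h
    by (simp add: galois_group_def BijGroup_def)
  from fun_cong[OF this, of x] show "\<sigma> a (\<sigma> b x) = \<sigma> b (\<sigma> a x)"
    using h \<sigma>_values[OF norm] by (simp add: compose_def)
qed

end

section \<open>Norms, the Frobenius automorphism and divisibility by p\<close>

lemma int_coeffs_poly:
  fixes p :: "complex poly"
  assumes "\<And>i. coeff p i \<in> \<int>"
  obtains h where "p = map_poly of_int h"
proof (rule that[of "map_poly (\<lambda>c. \<lfloor>Re c\<rfloor>) p"], rule poly_eqI)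
  fix i
  obtain z where "coeff p i = of_int z" using assms[of i] by (auto elim: Ints_cases)
  then show "coeff p i = coeff (map_poly of_int (map_poly (\<lambda>c. \<lfloor>Re c\<rfloor>) p)) i"
    by (simp add: coeff_map_poly)
qed

lemma alg_poly_monic_factor:
  assumes "alg_poly U" "lead_coeff U = 1" "alg_poly (U * V)"
  shows "alg_poly V"
  using alg_ideal.monic_mult_coeffs[OF alg_ideal_algebraic_ints assms(2,1), of V] assms(3)
  by (auto simp: alg_poly_def)

context abelian_ext begin

abbreviation "K \<equiv> rat_values \<alpha>"
abbreviation "dF \<equiv> poly (pderiv F)"

lemma dF_K: "dF \<alpha> \<in> K" and \<sigma>_dF: "a \<in> R \<Longrightarrow> \<sigma> a (dF \<alpha>) = dF a"
proof -
  have d: "pderiv F = map_poly of_rat (pderiv f)"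
    by (simp add: F_def of_rat_hom.map_poly_pderiv)
  show "dF \<alpha> \<in> K" unfolding d by (rule rat_valuesI)
  show "a \<in> R \<Longrightarrow> \<sigma> a (dF \<alpha>) = dF a" unfolding d by (rule \<sigma>_rpoly)
qed

lemma \<sigma>_inverse_exists:
  assumes "c \<in> R" shows "\<exists>b\<in>R. \<forall>x\<in>K. \<sigma> c (\<sigma> b x) = x"
proof -
  obtain b where b: "b \<in> R" "\<sigma> c b = \<alpha>"
    using \<sigma>_bij_R[OF normal assms] \<alpha>_R by (metis bij_betw_imp_surj_on imageE)
  have "\<sigma> c (\<sigma> b x) = x" if "x \<in> K" for x
    using \<sigma>_comp[OF normal assms b(1) that] \<sigma>_id[OF that] b by simp
  then show ?thesis using b(1) by blast
qed

lemma fixed_int: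
  assumes "x \<in> K" "algebraic_int x" "\<And>a. a \<in> R \<Longrightarrow> \<sigma> a x = x"
  shows "x \<in> \<int>"
  using rational_algebraic_int_is_int[OF assms(2) fixed_rat[OF assms(1,3)]] .

text \<open>An embedding merely permutes the factors, so the product is fixed by all embeddings and
  hence rational.\<close>

lemma norm_int:
  assumes "x \<in> K" "algebraic_int x"
  shows "(\<Prod>a\<in>R. \<sigma> a x) \<in> \<int>"
proof (rule fixed_int)
  show "(\<Prod>a\<in>R. \<sigma> a x) \<in> K" using assms by (intro rat_values_prod \<sigma>_values[OF normal])
  show "algebraic_int (\<Prod>a\<in>R. \<sigma> a x)" using assms by (intro algebraic_int_prod \<sigma>_algebraic_int)
  fix c assume c: "c \<in> R"
  have "\<sigma> c (\<Prod>a\<in>R. \<sigma> a x) = (\<Prod>a\<in>R. \<sigma> c (\<sigma> a x))"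
    using assms c by (intro \<sigma>_prod \<sigma>_values[OF normal])
  also have "\<dots> = (\<Prod>a\<in>R. \<sigma> (\<sigma> c a) x)"
    using \<sigma>_comp[OF normal c _ assms(1)] by (intro prod.cong) auto
  also have "\<dots> = (\<Prod>a\<in>R. \<sigma> a x)"
    by (rule prod.reindex_bij_betw[OF \<sigma>_bij_R[OF normal c]])
  finally show "\<sigma> c (\<Prod>a\<in>R. \<sigma> a x) = (\<Prod>a\<in>R. \<sigma> a x)" .
qed

lemma norm_ge_1:
  assumes "x \<in> K" "algebraic_int x" "x \<noteq> 0"
  shows "1 \<le> (\<Prod>a\<in>R. cmod (\<sigma> a x))"
proof -
  obtain z where z: "(\<Prod>a\<in>R. \<sigma> a x) = of_int z" using norm_int[OF assms(1,2)] by (auto elim: Ints_cases)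
  have "(\<Prod>a\<in>R. \<sigma> a x) \<noteq> 0" using fin_R \<sigma>_eq_0_iff assms by auto
  then have "z \<noteq> 0" using z by auto
  then have "1 \<le> \<bar>z\<bar>" by auto
  then have "1 \<le> cmod (\<Prod>a\<in>R. \<sigma> a x)" unfolding z by simp
  then show ?thesis by (simp add: prod_norm)
qed

lemma coeff_prod_linear:
  assumes c: "c \<in> R" and "finite A" "\<And>a. a \<in> A \<Longrightarrow> y a \<in> K"
  shows "coeff (\<Prod>a\<in>A. [:y a, 1:]) i \<in> K \<and>
    \<sigma> c (coeff (\<Prod>a\<in>A. [:y a, 1:]) i) = coeff (\<Prod>a\<in>A. [:\<sigma> c (y a), 1:]) i"
  using assms(2,3)
proof (induction A arbitrary: i rule: finite_induct)
  case empty
  then show ?case using rat_values_rat[of 0] rat_values_rat[of 1] \<sigma>_rat[OF c, of 0] \<sigma>_rat[OF c, of 1]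
    by (cases i) auto
next
  case (insert b A)
  have *: "coeff ([:u, 1:] * P) i = u * coeff P i + (if i = 0 then 0 else coeff P (i - 1))" for u :: complex and P
    by (cases i) (auto simp: coeff_pCons)
  have y: "y b \<in> K" using insert by auto
  have IH: "coeff (\<Prod>a\<in>A. [:y a, 1:]) j \<in> K"
    "\<sigma> c (coeff (\<Prod>a\<in>A. [:y a, 1:]) j) = coeff (\<Prod>a\<in>A. [:\<sigma> c (y a), 1:]) j" for j
    using insert by auto
  have z: "\<sigma> c 0 = 0" "0 \<in> K" using \<sigma>_rat[OF c, of 0] rat_values_rat[of 0] by auto
  show ?case
    unfolding prod.insert[OF insert(1,2)] *
    using y IH z c by (auto intro!: rat_values_add rat_values_mult simp: \<sigma>_add \<sigma>_mult rat_values_mult)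
qed

text \<open>The permutation argument of \<open>norm_int\<close> for all elementary symmetric
  functions at once. The norm alone is not enough in \<open>divisible_by_p\<close>, since it may be
  divisible by \<open>p\<close>.\<close>

lemma conj_prod_int_coeffs:
  assumes x: "x \<in> K" "algebraic_int x"
  shows "coeff (\<Prod>a\<in>R. [:\<sigma> a x, 1:]) i \<in> \<int>"
proof (rule fixed_int)
  have K: "\<sigma> a x \<in> K" if "a \<in> R" for a using that x \<sigma>_values[OF normal] by auto
  note c = coeff_prod_linear[OF _ fin_R, of _ "\<lambda>a. \<sigma> a x", OF _ K]
  show "coeff (\<Prod>a\<in>R. [:\<sigma> a x, 1:]) i \<in> K" using c[OF \<alpha>_R] by blast
  have "alg_poly (\<Prod>a\<in>R. [:\<sigma> a x, 1:])"
    using x by (intro alg_poly_intros \<sigma>_algebraic_int) auto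
  then show "algebraic_int (coeff (\<Prod>a\<in>R. [:\<sigma> a x, 1:]) i)" by (simp add: alg_poly_def)
  fix b assume b: "b \<in> R"
  have "\<sigma> b (coeff (\<Prod>a\<in>R. [:\<sigma> a x, 1:]) i) = coeff (\<Prod>a\<in>R. [:\<sigma> b (\<sigma> a x), 1:]) i"
    using c[OF b] by blast
  also have "(\<Prod>a\<in>R. [:\<sigma> b (\<sigma> a x), 1:]) = (\<Prod>a\<in>R. [:\<sigma> (\<sigma> b a) x, 1:])"
    using \<sigma>_comp[OF normal b _ x(1)] by (intro prod.cong) auto
  also have "\<dots> = (\<Prod>a\<in>R. [:\<sigma> a x, 1:])"
    by (rule prod.reindex_bij_betw[OF \<sigma>_bij_R[OF normal b]])
  finally show "\<sigma> b (coeff (\<Prod>a\<in>R. [:\<sigma> a x, 1:]) i) = coeff (\<Prod>a\<in>R. [:\<sigma> a x, 1:]) i" .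
qed

context
  assumes alg: "algebraic_int \<alpha>"
begin

lemma R_algebraic_int: "a \<in> R \<Longrightarrow> algebraic_int a"
  using \<sigma>_algebraic_int[OF _ rat_values_self alg] \<sigma>_\<alpha> by metis

lemma alg_poly_F: "alg_poly F"
  unfolding F_prod using R_algebraic_int by (intro alg_poly_intros) auto

lemma F_int: obtains g where "F = map_poly of_int g"
proof -
  have "coeff F i \<in> \<int>" for i
  proof (rule rational_algebraic_int_is_int)
    show "algebraic_int (coeff F i)" using alg_poly_F by (simp add: alg_poly_def)
    show "coeff F i \<in> \<rat>" by (simp add: F_def coeff_map_poly)
  qed
  then obtain g where "F = map_poly of_int g" by (rule int_coeffs_poly)
  then show ?thesis by (rule that)
qed

lemma alg_dF: "algebraic_int x \<Longrightarrow> algebraic_int (dF x)"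
  using alg_poly_F by (intro alg_poly_poly alg_poly_pderiv)

lemma alg_poly_synthetic_div: "a \<in> R \<Longrightarrow> alg_poly (synthetic_div F a)"
proof -
  assume a: "a \<in> R"
  have "[:-a, 1:] * synthetic_div F a = F"
    using synthetic_div_correct'[of a F] a by (simp add: R_def F_def)
  then show ?thesis using alg_poly_F R_algebraic_int[OF a]
    by (intro alg_poly_monic_factor[of "[:-a, 1:]" "synthetic_div F a"]) (simp_all only: alg_poly_intros algebraic_int_minus alg_poly_0 algebraic_int_1 lead_coeff_pCons, simp_all)
qed

text \<open>Euler's dual basis: the sum of \<open>\<sigma> a x * F / (X - a)\<close> over the
  conjugates has traces as coefficients, hence rational integers, and interpolates
  \<open>\<sigma> c x * dF c\<close>. So \<open>dF \<alpha>\<close> carries every algebraic integer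
  of the field into \<open>Z[\<alpha>]\<close>, and the second conclusion gives the traces
  explicitly.\<close>

lemma dual_poly:
  assumes x: "x \<in> K" "algebraic_int x"
  shows "\<exists>h. (\<forall>c\<in>R. poly (map_poly of_int h) c = \<sigma> c x * dF c) \<and>
    (\<forall>i. of_int (coeff h i) = (\<Sum>a\<in>R. \<sigma> a x * coeff (synthetic_div F a) i))"
proof -
  define H where "H = (\<Sum>a\<in>R. smult (\<sigma> a x) (synthetic_div F a))"
  have cH: "coeff H i = (\<Sum>a\<in>R. \<sigma> a x * coeff (synthetic_div F a) i)" for i
    by (simp add: H_def coeff_sum)
  have \<sigma>xK: "\<sigma> a x \<in> K" if "a \<in> R" for a using \<sigma>_values[OF normal that] x by auto
  have sd: "coeff (synthetic_div F a) i \<in> K" "\<sigma> c (coeff (synthetic_div F a) i) = coeff (synthetic_div F (\<sigma> c a)) i"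
    if "a \<in> R" "c \<in> R" for a c i
    using coeff_synthetic_div[OF that(2), of a f] that normal by (auto simp: F_def)
  have "coeff H i \<in> \<int>" for i
  proof (rule fixed_int)
    show "coeff H i \<in> K" unfolding cH using \<sigma>xK sd by (intro rat_values_sum rat_values_mult) auto
    show "algebraic_int (coeff H i)" unfolding cH
      using alg_poly_synthetic_div x by (intro algebraic_int_sum algebraic_int_add_mult \<sigma>_algebraic_int) (auto simp: alg_poly_def)
    fix c assume c: "c \<in> R"
    have "\<sigma> c (coeff H i) = (\<Sum>a\<in>R. \<sigma> (\<sigma> c a) x * coeff (synthetic_div F (\<sigma> c a)) i)"
      unfolding cH using c \<sigma>xK sd \<sigma>_comp[OF normal c _ x(1)]
      by (subst \<sigma>_sum) (auto simp: \<sigma>_mult rat_values_mult)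
    also have "\<dots> = coeff H i" unfolding cH
      by (rule sum.reindex_bij_betw[OF \<sigma>_bij_R[OF normal c]])
    finally show "\<sigma> c (coeff H i) = coeff H i" .
  qed
  then obtain h where h: "H = map_poly of_int h" by (rule int_coeffs_poly)
  have "poly H c = \<sigma> c x * dF c" if c: "c \<in> R" for c
  proof -
    have F: "F = [:-a, 1:] * synthetic_div F a" if "a \<in> R" for a
      using synthetic_div_correct'[of a F] that by (simp add: R_def F_def)
    \<comment> \<open>Lagrange interpolation: at the root \<open>c\<close> only the summand
      \<open>a = c\<close> survives, with value \<open>dF c\<close>.\<close>
    have "poly (synthetic_div F a) c = (if a = c then dF c else 0)" if a: "a \<in> R" for a
    proof (cases "a = c")
      case True
      have "pderiv F = pderiv ([:-c, 1:] * synthetic_div F c)" using F[OF c] by simp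
      then have "dF c = poly (synthetic_div F c) c" by (simp add: pderiv_mult pderiv_pCons del: mult_pCons_left)
      then show ?thesis using True by simp
    next
      case False
      have "poly F c = (c - a) * poly (synthetic_div F a) c" by (subst F[OF a]) (simp add: left_diff_distrib)
      then show ?thesis using False c by (auto simp: R_def F_def)
    qed
    then have "poly H c = (\<Sum>a\<in>R. \<sigma> a x * (if a = c then dF c else 0))"
      by (simp add: H_def poly_sum)
    also have "\<dots> = (\<Sum>a\<in>R. if a = c then \<sigma> c x * dF c else 0)" by (intro sum.cong) auto
    also have "\<dots> = \<sigma> c x * dF c" using c fin_R by simp
    finally show ?thesis .
  qed
  moreover have "of_int (coeff h i) = (\<Sum>a\<in>R. \<sigma> a x * coeff (synthetic_div F a) i)" for i
    using cH[of i] by (simp add: h coeff_map_poly)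
  ultimately show ?thesis unfolding h by blast
qed

text \<open>As \<open>F(\<alpha> ^ p)\<close> is congruent to \<open>F(\<alpha>) ^ p = 0\<close> and
  \<open>F\<close> splits, \<open>\<alpha> ^ p\<close> is congruent to some conjugate
  \<open>b\<close>. This settles the congruence on \<open>Z[\<alpha>]\<close>; a general
  \<open>x\<close> is multiplied by \<open>dF \<alpha>\<close> to get there, and the factor is
  cancelled because it is outside the prime ideal.\<close>

lemma frobenius_exists:
  assumes I: "prime_ideal_over I p" and unr: "dF \<alpha> \<notin> I"
  shows "\<exists>b\<in>R. \<forall>x\<in>K. algebraic_int x \<longrightarrow> \<sigma> b x - x ^ p \<in> I"
proof -
  interpret I: prime_ideal_over I p by fact
  obtain g where g: "F = map_poly of_int g" by (rule F_int)
  have p0: "p > 0" using I.p by (simp add: prime_gt_0_nat)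
  have "poly F (\<alpha> ^ p) - poly F \<alpha> ^ p \<in> I" unfolding g by (rule I.poly_frobenius[OF alg])
  then have "poly F (\<alpha> ^ p) \<in> I" using \<alpha>_R p0 by (simp add: R_def F_def power_0_left)
  then have "(\<Prod>a\<in>R. \<alpha> ^ p - a) \<in> I" by (subst (asm) F_prod) (simp add: poly_prod)
  then have "\<exists>b\<in>R. \<alpha> ^ p - b \<in> I"
    by (rule I.I_prod[OF fin_R, rotated]) (intro algebraic_int_diff algebraic_int_power alg R_algebraic_int)
  then obtain b where b: "b \<in> R" "\<alpha> ^ p - b \<in> I" by blast
  have b': "b - \<alpha> ^ p \<in> I" using I.I_neg[OF b(2)] by simp
  have ab: "algebraic_int b" using R_algebraic_int b by auto
  \<comment> \<open>Congruent arguments give congruent values: division by the monic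
    \<open>X - \<alpha> ^ p\<close> leaves a quotient with integral coefficients.\<close>
  have sub: "poly q b - poly q (\<alpha> ^ p) \<in> I" if q: "alg_poly q" for q
  proof -
    define s where "s = synthetic_div q (\<alpha> ^ p)"
    have s: "q = [:- (\<alpha> ^ p), 1:] * s + [:poly q (\<alpha> ^ p):]"
      using synthetic_div_correct'[of "\<alpha> ^ p" q] by (simp add: s_def)
    have "poly q b = (b - \<alpha> ^ p) * poly s b + poly q (\<alpha> ^ p)" by (subst s) (simp add: left_diff_distrib)
    moreover have "alg_poly s"
    proof -
      have "[:- (\<alpha> ^ p), 1:] * s = q - [:poly q (\<alpha> ^ p):]" using s by (simp add: algebra_simps)
      moreover have "alg_poly (q - [:poly q (\<alpha> ^ p):])"
        using q alg by (intro alg_poly_intros alg_poly_poly algebraic_int_intros) auto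
      ultimately show ?thesis
        using alg
        by (intro alg_poly_monic_factor[of "[:- (\<alpha> ^ p), 1:]" s]) (simp_all only: alg_poly_intros algebraic_int_power algebraic_int_minus alg_poly_0 algebraic_int_1 lead_coeff_pCons, simp_all)
    qed
    ultimately show ?thesis using b' ab alg_poly_poly[of s b] by (simp add: I.I_mult2)
  qed
  have "\<sigma> b x - x ^ p \<in> I" if x: "x \<in> K" "algebraic_int x" for x
  proof -
    obtain h where h: "\<And>c. c \<in> R \<Longrightarrow> poly (map_poly of_int h) c = \<sigma> c x * dF c"
      using dual_poly[OF x] by blast
    define dg where "dg = pderiv g"
    have dg: "pderiv F = map_poly of_int dg" by (simp add: g dg_def of_int_hom.map_poly_pderiv)
    let ?h = "map_poly of_int h :: complex poly"
    have ah: "poly ?h \<alpha> = x * dF \<alpha>" using h[OF \<alpha>_R] \<sigma>_id[OF x(1)] by simp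
    have 1: "\<sigma> b x * dF b - poly ?h (\<alpha> ^ p) \<in> I"
      using sub[of ?h] h[OF b(1)] by simp
    have 2: "poly ?h (\<alpha> ^ p) - (x * dF \<alpha>) ^ p \<in> I"
      using I.poly_frobenius[OF alg, of h] ah by simp
    have 3: "dF b - dF (\<alpha> ^ p) \<in> I" using sub[OF alg_poly_pderiv[OF alg_poly_F]] .
    have 4: "dF (\<alpha> ^ p) - dF \<alpha> ^ p \<in> I" unfolding dg by (rule I.poly_frobenius[OF alg])
    have ax: "algebraic_int (\<sigma> b x)" using x b by (intro \<sigma>_algebraic_int)
    \<comment> \<open>The first two differences lead from \<open>\<sigma> b x * dF b\<close> to
      \<open>(x * dF \<alpha>) ^ p\<close>; the last two exchange \<open>dF b\<close> for
      \<open>dF \<alpha> ^ p\<close>.\<close>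
    have "(\<sigma> b x - x ^ p) * dF \<alpha> ^ p = (\<sigma> b x * dF b - poly ?h (\<alpha> ^ p)) + (poly ?h (\<alpha> ^ p) - (x * dF \<alpha>) ^ p)
        - \<sigma> b x * (dF b - dF (\<alpha> ^ p)) - \<sigma> b x * (dF (\<alpha> ^ p) - dF \<alpha> ^ p)"
      by (simp add: algebra_simps power_mult_distrib)
    also have "\<dots> \<in> I"
      by (intro I.I_diff[OF I.I_diff[OF I.I_add[OF 1 2] I.I_mult[OF ax 3]] I.I_mult[OF ax 4]])
    finally have "\<sigma> b x - x ^ p \<in> I \<or> dF \<alpha> ^ p \<in> I"
      using ax x alg_dF[OF alg] by (intro I.I_prime) (auto intro: algebraic_int_intros)
    then show ?thesis using unr I.I_power[OF alg_dF[OF alg]] by blast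
  qed
  then show ?thesis using b(1) by blast
qed

text \<open>The multipliers \<open>z\<close> for which \<open>p\<close> divides \<open>g * z\<close>
  form an ideal \<open>Q\<close>. It contains \<open>p\<close>, and by \<open>dual_poly\<close>
  every \<open>dF c\<close>, because the traces occurring there are integers in \<open>I\<close> and
  so multiples of \<open>p\<close>. It remains to find in \<open>Q\<close> an integer prime to
  \<open>p\<close>.\<close>

lemma divisible_by_p:
  assumes I: "prime_ideal_over I p" and unr: "dF \<alpha> \<notin> I"
    and g: "g \<in> K" "algebraic_int g" "\<And>a. a \<in> R \<Longrightarrow> \<sigma> a g \<in> I"
  shows "\<exists>z. algebraic_int z \<and> g = of_nat p * z"
proof -
  interpret I: prime_ideal_over I p by fact
  define J where "J = {of_nat p * z | z :: complex. algebraic_int z}"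
  interpret J: alg_ideal J unfolding J_def by (rule alg_ideal_principal) simp
  define Q where "Q = {z. algebraic_int z \<and> g * z \<in> J}"
  interpret Q: alg_ideal Q
  proof
    show "0 \<in> Q" by (simp add: Q_def J.I_zero)
    show "x + y \<in> Q" if "x \<in> Q" "y \<in> Q" for x y
      using that by (auto simp: Q_def distrib_left intro: J.I_add algebraic_int_intros)
    show "z * x \<in> Q" if "algebraic_int z" "x \<in> Q" for z x
      using that J.I_mult[of z "g * x"] by (auto simp: Q_def mult.left_commute intro: algebraic_int_intros)
  qed (auto simp: Q_def)
  have dFQ: "dF c \<in> Q" if c: "c \<in> R" for c
  proof -
    \<comment> \<open>With \<open>\<sigma> b\<close> inverse to \<open>\<sigma> c\<close>, the
      polynomial dual to \<open>\<sigma> b g\<close> takes the value \<open>g * dF c\<close> at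
      \<open>c\<close>.\<close>
    obtain b where b: "b \<in> R" "\<And>x. x \<in> K \<Longrightarrow> \<sigma> c (\<sigma> b x) = x"
      using \<sigma>_inverse_exists[OF c] by blast
    have bg: "\<sigma> b g \<in> K" "algebraic_int (\<sigma> b g)"
      using b g \<sigma>_values[OF normal] \<sigma>_algebraic_int by auto
    obtain h where h: "\<forall>c\<in>R. poly (map_poly of_int h) c = \<sigma> c (\<sigma> b g) * dF c"
      and hc: "\<forall>i. of_int (coeff h i) = (\<Sum>a\<in>R. \<sigma> a (\<sigma> b g) * coeff (synthetic_div F a) i)"
      using dual_poly[OF bg] by blast
    have "int p dvd coeff h i" for i
    proof -
      have "\<sigma> a (\<sigma> b g) \<in> I" if a: "a \<in> R" for a
        using \<sigma>_comp[OF normal a b(1) g(1)] g(3)[of "\<sigma> a b"] \<sigma>_in_R[OF a b(1)] normal b(1) by auto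
      then have "(\<Sum>a\<in>R. \<sigma> a (\<sigma> b g) * coeff (synthetic_div F a) i) \<in> I"
        using alg_poly_synthetic_div by (intro I.I_sum I.I_mult2) (auto simp: alg_poly_def)
      then have "of_int (coeff h i) \<in> I" using hc by auto
      then show ?thesis by (simp add: I.of_int_in_iff)
    qed
    then have "of_int (coeff h i) \<in> J" for i
    proof -
      obtain k where "coeff h i = int p * k" using \<open>\<And>i. int p dvd coeff h i\<close> by (auto simp: dvd_def)
      then show ?thesis by (auto simp: J_def intro!: exI[of _ "of_int k"])
    qed
    then have "poly (map_poly of_int h) c \<in> J"
      using R_algebraic_int[OF c] by (simp add: poly_altdef) (auto intro!: J.I_sum J.I_mult2 algebraic_int_power)
    then have "g * dF c \<in> J" using h c b(2)[OF g(1)] by simp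
    then show ?thesis using alg_dF[OF R_algebraic_int[OF c]] by (simp add: Q_def)
  qed
  have pQ: "of_nat p \<in> Q" using g(2) by (auto simp: Q_def J_def mult.commute)
  \<comment> \<open>Some \<open>dF a\<close> may lie in \<open>I\<close> although
    \<open>dF \<alpha>\<close> does not, so the norm of \<open>dF \<alpha>\<close> need not be prime
    to \<open>p\<close>. A suitable coefficient of this integer polynomial takes its place.\<close>
  define N where "N = (\<Prod>a\<in>R. [:dF a, 1:])"
  have adF: "algebraic_int (dF a)" if "a \<in> R" for a using alg_dF R_algebraic_int that by auto
  define S where "S = {a\<in>R. dF a \<notin> I}"
  have finS: "finite S" and SR: "S \<subseteq> R" using fin_R by (auto simp: S_def)
  have cS: "card S > 0" using unr \<alpha>_R finS by (auto simp: S_def card_gt_0_iff)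
  \<comment> \<open>Modulo \<open>I\<close>, coefficient \<open>e\<close> of \<open>N\<close> is the
    product of the \<open>dF a\<close> outside \<open>I\<close>, hence not in \<open>I\<close>;
    modulo \<open>Q\<close>, \<open>N\<close> is a pure power of \<open>X\<close> of exponent above
    \<open>e\<close>, hence the coefficient lies in \<open>Q\<close>.\<close>
  define e where "e = card (R - S)"
  have eR: "e < card R" using cS finS SR fin_R card_mono[OF fin_R SR] by (simp add: e_def card_Diff_subset)
  have lin: "alg_poly [:dF a, 1:]" if "a \<in> R" for a
    using adF[OF that] by (auto intro!: alg_poly_intros)
  have X: "alg_poly [:0, 1:]" by (auto intro!: alg_poly_intros)
  have NI: "I.pcong N ([:0, 1:] ^ e * (\<Prod>a\<in>S. [:dF a, 1:]))"
  proof -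
    have "N = (\<Prod>a\<in>R - S. [:dF a, 1:]) * (\<Prod>a\<in>S. [:dF a, 1:])"
      unfolding N_def using fin_R SR by (metis prod.subset_diff)
    moreover have "I.pcong (\<Prod>a\<in>R - S. [:dF a, 1:]) (\<Prod>a\<in>R - S. [:0, 1:])"
      by (rule I.pcong_prod) (auto simp: I.pcong_def coeff_pCons S_def I.I_zero adF alg_poly_pCons split: nat.splits)
    moreover have "alg_poly (\<Prod>a\<in>S. [:dF a, 1:])" using lin SR by (intro alg_poly_prod) auto
    moreover have "alg_poly (\<Prod>a\<in>R - S. [:0, 1:])" using X by (intro alg_poly_prod) auto
    ultimately have "I.pcong N ((\<Prod>a\<in>R - S. [:0, 1:]) * (\<Prod>a\<in>S. [:dF a, 1:]))"
      using I.pcong_mult I.pcong_refl by metis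
    then show ?thesis by (simp add: e_def)
  qed
  have NQ: "Q.pcong N ([:0, 1:] ^ card R)"
  proof -
    have "Q.pcong N (\<Prod>a\<in>R. [:0, 1:])" unfolding N_def
      by (rule Q.pcong_prod) (auto simp: Q.pcong_def coeff_pCons dFQ Q.I_zero adF alg_poly_pCons split: nat.splits)
    then show ?thesis by simp
  qed
  have "coeff N e \<in> \<int>"
    using conj_prod_int_coeffs[OF dF_K alg_dF[OF alg], of e] \<sigma>_dF by (simp add: N_def cong: prod.cong)
  then obtain z where z: "coeff N e = of_int z" by (auto elim: Ints_cases)
  have "coeff ([:0, 1:] ^ e * (\<Prod>a\<in>S. [:dF a, 1:])) e = coeff (\<Prod>a\<in>S. [:dF a, 1:]) 0"
    by (simp only: x_as_monom monom_power) (simp add: coeff_monom_mult)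
  also have "\<dots> = (\<Prod>a\<in>S. dF a)"
    using poly_prod[of "\<lambda>a. [:dF a, 1:]" S 0] by (simp add: poly_0_coeff_0)
  finally have "of_int z - (\<Prod>a\<in>S. dF a) \<in> I" using NI z by (metis I.pcong_def)
  moreover have "(\<Prod>a\<in>S. dF a) \<notin> I"
  proof
    assume "(\<Prod>a\<in>S. dF a) \<in> I"
    then have "\<exists>a\<in>S. dF a \<in> I" using adF by (intro I.I_prod[OF finS]) (auto simp: S_def)
    then show False by (auto simp: S_def)
  qed
  ultimately have "of_int z \<notin> I" using I.I_diff[of "of_int z" "of_int z - (\<Prod>a\<in>S. dF a)"] by auto
  then have "\<not> int p dvd z" by (simp add: I.of_int_in_iff)
  then have "coprime (int p) z" using I.p by (simp add: prime_imp_coprime)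
  then obtain u w where uw: "u * int p + w * z = 1"
    using bezout_int[of "int p" z] by (auto simp: coprime_iff_gcd_eq_1)
  have "coeff ([:0, 1:] ^ card R) e = (0 :: complex)"
    using eR by (simp only: x_as_monom monom_power) simp
  then have "of_int z \<in> Q" using NQ z by (metis Q.pcong_def diff_zero)
  then have "of_int u * of_nat p + of_int w * of_int z \<in> Q"
    using pQ by (intro Q.I_add Q.I_mult) auto
  moreover have "of_int u * of_nat p + of_int w * of_int z = (1::complex)"
    using uw by (metis of_int_1 of_int_add of_int_mult of_int_of_nat_eq)
  ultimately have "1 \<in> Q" by simp
  then show ?thesis by (auto simp: Q_def J_def)
qed

text \<open>For \<open>g = b - T(\<alpha>)\<close>, commutativity gives
  \<open>\<sigma> a g = \<sigma> b a - T(a)\<close>, so all conjugates of \<open>g\<close> lie in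
  \<open>I\<close> and \<open>p\<close> divides \<open>g\<close>. Either \<open>g = 0\<close> and
  \<open>T\<close> maps conjugates to conjugates, or the norm of \<open>g / p\<close> is at least 1.
  The permutation \<open>\<pi>\<close> is \<open>\<sigma> b\<close>.\<close>

lemma frobenius_dichotomy:
  assumes I: "prime_ideal_over I p" and unr: "dF \<alpha> \<notin> I"
    and T: "\<And>a. a \<in> R \<Longrightarrow> poly (map_poly of_int T) a - a ^ p \<in> I"
  shows "(\<forall>a\<in>R. poly (map_poly of_int T) a \<in> R) \<or>
    (\<exists>\<pi>. bij_betw \<pi> R R \<and> real p ^ card R \<le> (\<Prod>a\<in>R. cmod (\<pi> a - poly (map_poly of_int T) a)))"
proof -
  interpret I: prime_ideal_over I p by fact
  let ?T = "\<lambda>x. poly (map_poly of_int T) x :: complex"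
  obtain b where b: "b \<in> R" "\<And>x. x \<in> K \<Longrightarrow> algebraic_int x \<Longrightarrow> \<sigma> b x - x ^ p \<in> I"
    using frobenius_exists[OF I unr] by blast
  define g where "g = b - ?T \<alpha>"
  have TK: "?T x \<in> K" if "x \<in> K" for x using rat_values_rpoly[OF that] by (simp add: int_poly_rpoly)
  have bK: "b \<in> K" using b normal by auto
  have gK: "g \<in> K" unfolding g_def using bK TK[OF rat_values_self] by (rule rat_values_diff)
  have ag: "algebraic_int g" unfolding g_def
    using R_algebraic_int b alg by (intro algebraic_int_diff alg_poly_poly) auto
  have sg: "\<sigma> a g = \<sigma> b a - ?T a" if a: "a \<in> R" for a
  proof -
    have "\<sigma> a g = \<sigma> a b - \<sigma> a (?T \<alpha>)" unfolding g_def
      using a bK TK[OF rat_values_self] by (rule \<sigma>_diff)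
    moreover have "\<sigma> a b = \<sigma> b a"
      using comm[OF a b(1) rat_values_self] \<sigma>_\<alpha> a b by simp
    moreover have "\<sigma> a (?T \<alpha>) = ?T a"
      using \<sigma>_rpoly[OF a] by (simp add: int_poly_rpoly)
    ultimately show ?thesis by simp
  qed
  have sI: "\<sigma> a g \<in> I" if a: "a \<in> R" for a
  proof -
    have "\<sigma> a g = (\<sigma> b a - a ^ p) - (?T a - a ^ p)" using sg[OF a] by simp
    also have "\<dots> \<in> I" using a normal by (intro I.I_diff b T R_algebraic_int) auto
    finally show ?thesis .
  qed
  obtain z where z: "algebraic_int z" "g = of_nat p * z" using divisible_by_p[OF I unr gK ag sI] by blast
  have p0: "p > 0" using I.p by (simp add: prime_gt_0_nat)
  show ?thesis
  proof (cases "g = 0")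
    case True
    have "?T a \<in> R" if a: "a \<in> R" for a
    proof -
      have "\<sigma> b a - ?T a = 0" using sg[OF a] True \<sigma>_rat[OF a, of 0] by simp
      moreover have "\<sigma> b a \<in> R" using \<sigma>_in_R[OF b(1) a] normal a by auto
      ultimately show ?thesis by simp
    qed
    then show ?thesis by blast
  next
    case False
    have zK: "z \<in> K"
    proof -
      have "z = of_rat (1 / of_nat p) * g" using z p0 by (simp add: of_rat_divide)
      then show ?thesis using rat_values_mult[OF rat_values_rat gK] by metis
    qed
    have "cmod (\<sigma> b a - ?T a) = real p * cmod (\<sigma> a z)" if a: "a \<in> R" for a
    proof -
      have "\<sigma> a g = \<sigma> a (of_rat (of_nat p)) * \<sigma> a z"
        unfolding z(2) using \<sigma>_mult[OF a rat_values_rat zK, of "of_nat p"] by simp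
      then have "\<sigma> b a - ?T a = of_nat p * \<sigma> a z" using sg[OF a] \<sigma>_rat[OF a, of "of_nat p"] by simp
      then show ?thesis by (simp add: norm_mult)
    qed
    then have "(\<Prod>a\<in>R. cmod (\<sigma> b a - ?T a)) = real p ^ card R * (\<Prod>a\<in>R. cmod (\<sigma> a z))"
      by (simp add: prod.distrib cong: prod.cong)
    moreover have "1 \<le> (\<Prod>a\<in>R. cmod (\<sigma> a z))" using zK z False by (intro norm_ge_1) auto
    ultimately have "real p ^ card R \<le> (\<Prod>a\<in>R. cmod (\<sigma> b a - ?T a))" by (simp add: mult_le_cancel_left1)
    then show ?thesis using \<sigma>_bij_R[OF normal b(1)] by blast
  qed
qed

end
end

section \<open>Ramification detected by repeated factors modulo a prime ideal\<close>

text \<open>This is \<open>x ^ e\<close> times \<open>x ^ e + 1 / x ^ e - a\<close>, the factor of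
  \<open>FF m\<close> that belongs to the conjugate \<open>a\<close>.\<close>

definition quad :: "nat \<Rightarrow> complex \<Rightarrow> complex poly" where
  "quad e a = Polynomial.monom 1 (2 * e) - Polynomial.monom a e + 1"

lemma alg_poly_quad: "algebraic_int a \<Longrightarrow> alg_poly (quad e a)"
  unfolding quad_def by (intro alg_poly_intros alg_poly_1) auto

lemma poly_quad: "poly (quad e a) x = (x ^ e)\<^sup>2 - a * x ^ e + 1"
  by (simp add: quad_def poly_monom power_mult[symmetric] mult.commute)

lemma degree_quad: "e > 0 \<Longrightarrow> degree (quad e a) = 2 * e"
  and lead_coeff_quad: "e > 0 \<Longrightarrow> lead_coeff (quad e a) = 1"
proof -
  assume e: "e > 0"
  have 1: "coeff (quad e a) (2 * e) = 1" using e by (simp add: quad_def coeff_1)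
  moreover have "degree (quad e a) \<le> 2 * e"
    by (rule degree_le) (auto simp: quad_def coeff_1)
  ultimately show d: "degree (quad e a) = 2 * e" using le_degree[of "quad e a" "2 * e"] by auto
  show "lead_coeff (quad e a) = 1" unfolding d by (rule 1)
qed

lemma quad_nz: "e > 0 \<Longrightarrow> quad e a \<noteq> 0"
  using lead_coeff_quad[of e a] by auto

lemma monic_prod_quad:
  assumes "e > 0" shows "lead_coeff (\<Prod>a\<in>A. quad e (g a)) = 1"
    and "finite A \<Longrightarrow> degree (\<Prod>a\<in>A. quad e (g a)) = 2 * e * card A"
  unfolding lead_coeff_prod using lead_coeff_quad[OF assms] assms
  by (simp_all add: degree_prod_eq_sum_degree quad_nz degree_quad)

context prime_ideal_over begin

text \<open>Modulo \<open>I\<close> every factor \<open>quad e a\<close> may be replaced by that of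
  a representative of its class. Each class has at least two members, so the product
  \<open>R2\<close> over the non-representatives divides both \<open>FF\<close> and its derivative,
  hence \<open>W\<close>. Since at least half of \<open>R\<close> are non-representatives,
  \<open>R2\<close> has degree at least \<open>e * card R\<close>, more than \<open>W\<close>; so
  \<open>W\<close> vanishes modulo \<open>I\<close>.\<close>

lemma everywhere_ramified:
  fixes R :: "complex set"
  assumes fin: "finite R" and alg: "\<And>a. a \<in> R \<Longrightarrow> algebraic_int a" and e: "e > 0"
    and mult: "\<And>a. a \<in> R \<Longrightarrow> \<exists>b\<in>R. b \<noteq> a \<and> a - b \<in> I"
    and G: "FF = (\<Prod>a\<in>R. quad e a) * S" "alg_poly S"
    and W: "W = U * pderiv FF - FF * C" "alg_poly U" "alg_poly C"
    and deg: "degree W < e * card R"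
  shows "coeff W i \<in> I"
proof -
  \<comment> \<open>The choice depends only on the residue class of \<open>a\<close>, since
    congruent numbers have the same set of candidates.\<close>
  define rep where "rep = (\<lambda>a. SOME c. c \<in> {c\<in>R. a - c \<in> I})"
  have rep: "rep a \<in> R" "a - rep a \<in> I" if "a \<in> R" for a
    using someI[of "\<lambda>c. c \<in> {c\<in>R. a - c \<in> I}" a] that by (auto simp: rep_def I_zero)
  have rep_eq: "rep a = rep b" if "a - b \<in> I" for a b
  proof -
    have "a - c \<in> I \<longleftrightarrow> b - c \<in> I" for c
      using I_add[OF that, of "b - c"] I_diff[OF _ that, of "a - c"] by auto
    then show ?thesis by (simp add: rep_def)
  qed
  have rep_rep: "rep (rep a) = rep a" if "a \<in> R" for a
    using rep_eq[OF rep(2)[OF that]] by simp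
  define D where "D = rep ` R"
  have DR: "D \<subseteq> R" and finD: "finite D" using rep fin by (auto simp: D_def)
  have repD: "rep c = c" if "c \<in> D" for c using that rep_rep by (auto simp: D_def)
  \<comment> \<open>A second member of the class; on representatives this is an injection from
    \<open>D\<close> into \<open>R - D\<close>.\<close>
  define par where "par = (\<lambda>a. SOME b. b \<in> R \<and> b \<noteq> a \<and> a - b \<in> I)"
  have par: "par a \<in> R" "par a \<noteq> a" "a - par a \<in> I" if "a \<in> R" for a
    using someI_ex[of "\<lambda>b. b \<in> R \<and> b \<noteq> a \<and> a - b \<in> I"] mult[OF that] by (auto simp: par_def)
  have rp: "rep (par c) = c" if "c \<in> D" for c
    using rep_eq[OF par(3)[of c]] repD[OF that] DR that by auto
  have "inj_on par D" by (rule inj_on_inverseI[of _ rep]) (rule rp)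
  moreover have "par ` D \<subseteq> R - D"
  proof
    fix y assume "y \<in> par ` D"
    then obtain c where c: "c \<in> D" "y = par c" by blast
    then have "rep y \<noteq> y" using rp par(2)[of c] DR by auto
    then show "y \<in> R - D" using repD par(1)[of c] c DR by auto
  qed
  ultimately have "card D \<le> card (R - D)" using fin by (intro card_inj_on_le) auto
  moreover have "card R = card D + card (R - D)"
    using fin DR by (simp add: card_Diff_subset finD card_mono)
  ultimately have cardR: "card R \<le> 2 * card (R - D)" by simp
  define G0 where "G0 = (\<Prod>b\<in>R. quad e (rep b))"
  define R2 where "R2 = (\<Prod>b\<in>R - D. quad e (rep b))"
  have arep: "algebraic_int (rep b)" if "b \<in> R" for b using alg rep that by auto
  have aq: "alg_poly (quad e (rep b))" if "b \<in> R" for b using arep[OF that] by (rule alg_poly_quad)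
  have aR2: "alg_poly R2" unfolding R2_def using aq by (intro alg_poly_prod) auto
  have aG0: "alg_poly G0" unfolding G0_def using aq by (intro alg_poly_prod) auto
  have GG: "pcong (\<Prod>a\<in>R. quad e a) G0" unfolding G0_def
  proof (rule pcong_prod)
    fix a assume a: "a \<in> R"
    show "pcong (quad e a) (quad e (rep a))"
      using rep(2)[OF a] I_neg[OF rep(2)[OF a]] by (auto simp: pcong_def quad_def I_zero)
  qed (use alg alg_poly_quad aq in auto)
  define H where "H = (\<Prod>b\<in>D. quad e (rep b))"
  have aH: "alg_poly H" unfolding H_def using aq DR by (intro alg_poly_prod) auto
  have G0H: "G0 = R2 * H" unfolding G0_def R2_def H_def using prod.subset_diff[OF DR fin] by blast
  \<comment> \<open>The cofactor of \<open>R2\<close> in the derivative of \<open>G0\<close>: the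
    factor omitted by the product rule equals that of its representative, so it can be omitted from
    the part over \<open>D\<close> and \<open>R2\<close> stays intact.\<close>
  define H' where "H' = (\<Sum>a\<in>R. (\<Prod>b\<in>D - {rep a}. quad e (rep b)) * pderiv (quad e (rep a)))"
  have aH': "alg_poly H'" unfolding H'_def using aq DR
    by (intro alg_poly_sum alg_poly_mult alg_poly_prod alg_poly_pderiv) auto
  have "pderiv G0 = (\<Sum>a\<in>R. (\<Prod>b\<in>R - {a}. quad e (rep b)) * pderiv (quad e (rep a)))"
    unfolding G0_def by (rule pderiv_prod)
  also have "\<dots> = (\<Sum>a\<in>R. R2 * (\<Prod>b\<in>D - {rep a}. quad e (rep b)) * pderiv (quad e (rep a)))"
  proof (intro sum.cong refl arg_cong2[of _ _ _ _ "(*)"])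
    fix a assume a: "a \<in> R"
    have "quad e (rep a) * (\<Prod>b\<in>R - {a}. quad e (rep b)) = G0"
      unfolding G0_def using prod.remove[OF fin a, of "\<lambda>b. quad e (rep b)"] by simp
    also have "\<dots> = quad e (rep a) * (\<Prod>b\<in>R - {rep a}. quad e (rep b))"
      unfolding G0_def using prod.remove[OF fin rep(1)[OF a], of "\<lambda>b. quad e (rep b)"] rep_rep[OF a] by simp
    finally have "(\<Prod>b\<in>R - {a}. quad e (rep b)) = (\<Prod>b\<in>R - {rep a}. quad e (rep b))"
      using quad_nz[OF e] by simp
    also have "R - {rep a} = (R - D) \<union> (D - {rep a})" using a DR by (auto simp: D_def)
    also have "(\<Prod>b\<in>\<dots>. quad e (rep b)) = R2 * (\<Prod>b\<in>D - {rep a}. quad e (rep b))"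
      unfolding R2_def using fin finD by (intro prod.union_disjoint) auto
    finally show "(\<Prod>b\<in>R - {a}. quad e (rep b)) = R2 * (\<Prod>b\<in>D - {rep a}. quad e (rep b))" .
  qed
  also have "\<dots> = R2 * H'" by (simp add: H'_def sum_distrib_left mult.assoc)
  finally have dG0: "pderiv G0 = R2 * H'" .
  have FF0: "pcong FF (G0 * S)" unfolding G(1) using G(2) aG0 by (intro pcong_mult GG) auto
  define V where "V = U * (H' * S + H * pderiv S) - H * S * C"
  have aV: "alg_poly V" unfolding V_def using aH aH' G(2) W(2,3)
    by (intro alg_poly_diff alg_poly_mult alg_poly_add alg_poly_pderiv)
  have aFF: "alg_poly FF" unfolding G(1) using G(2) alg alg_poly_quad by (intro alg_poly_mult alg_poly_prod) auto
  have "pcong W (U * pderiv (G0 * S) - G0 * S * C)"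
    unfolding W(1) using FF0 W(2,3) aFF aG0 G(2)
    by (intro pcong_diff pcong_mult pcong_pderiv alg_poly_pderiv alg_poly_mult) auto
  also have "U * pderiv (G0 * S) - G0 * S * C = R2 * V"
    unfolding pderiv_mult[of G0 S] dG0 V_def by (simp add: G0H algebra_simps)
  finally have WV: "pcong W (R2 * V)" .
  have "e * card R \<le> e * (2 * card (R - D))" using cardR by (rule mult_le_mono2)
  moreover have "degree R2 = 2 * e * card (R - D)"
    unfolding R2_def using fin by (intro monic_prod_quad(2)[OF e]) auto
  then have "degree R2 = e * (2 * card (R - D))" by simp
  ultimately have dR2: "degree W < degree R2" using deg by linarith
  have V: "coeff V j \<in> I" for j
  proof (rule monic_mult_coeffs[OF _ aR2])
    show "lead_coeff R2 = 1" unfolding R2_def by (rule monic_prod_quad(1)[OF e])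
    fix j assume "j \<ge> degree R2"
    then have "coeff W j = 0" using dR2 by (intro coeff_eq_0) auto
    then show "coeff (R2 * V) j \<in> I" using pcong_sym[OF WV] by (metis pcong_def diff_zero)
  qed
  have "coeff (R2 * V) i \<in> I" using V aR2 by (auto simp: coeff_mult alg_poly_def intro!: I_sum I_mult)
  then show ?thesis using WV I_add[of "coeff W i - coeff (R2 * V) i" "coeff (R2 * V) i"] by (auto simp: pcong_def)
qed

end

text \<open>The derivative at \<open>a\<close> is the product of the differences
  \<open>a - b\<close>, one of which must lie in the prime ideal.\<close>

lemma (in abelian_ext) congruent_root:
  assumes "prime_ideal_over I p" "algebraic_int \<alpha>" "a \<in> R" "poly (pderiv F) a \<in> I"
  shows "\<exists>b\<in>R. b \<noteq> a \<and> a - b \<in> I"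
proof -
  interpret I: prime_ideal_over I p by fact
  have "F = [:-a, 1:] * (\<Prod>b\<in>R - {a}. [:-b, 1:])"
    unfolding F_prod using prod.remove[OF fin_R assms(3)] .
  then have "poly (pderiv F) a = poly (pderiv ([:-a, 1:] * (\<Prod>b\<in>R - {a}. [:-b, 1:]))) a" by simp
  also have "\<dots> = (\<Prod>b\<in>R - {a}. a - b)"
    by (simp add: pderiv_mult pderiv_pCons poly_prod del: mult_pCons_left)
  finally have "(\<Prod>b\<in>R - {a}. a - b) \<in> I" using assms(4) by simp
  then have "\<exists>b\<in>R - {a}. a - b \<in> I"
    using fin_R R_algebraic_int[OF assms(2)] assms(3) by (intro I.I_prod) (auto intro: algebraic_int_diff)
  then show ?thesis by blast
qed

lemma (in rat_ext) R_rat_values_eq: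
  assumes "R \<subseteq> rat_values \<alpha>" "a \<in> R"
  shows "rat_values a = rat_values \<alpha>"
proof
  show "rat_values a \<subseteq> rat_values \<alpha>" using assms by (intro rat_values_mono) auto
  obtain b where b: "b \<in> R" "\<sigma> a b = \<alpha>"
    using \<sigma>_bij_R[OF assms] \<alpha>_R by (metis bij_betw_imp_surj_on imageE)
  obtain r where "b = rpoly r \<alpha>" using b assms by (auto simp: rat_values_def)
  then have "\<alpha> = rpoly r a" using b \<sigma>_rpoly[OF assms(2)] by simp
  then show "rat_values \<alpha> \<subseteq> rat_values a" by (metis rat_values_mono rat_valuesI)
qed

text \<open>A coefficient of \<open>W\<close> outside \<open>I\<close> excludes
  \<open>everywhere_ramified\<close>, so some conjugate \<open>a0\<close> has derivative outside
  \<open>I\<close>. By normality \<open>a0\<close> generates the same field and takes over the role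
  of \<open>\<alpha>\<close>.\<close>

theorem abelian_frobenius:
  assumes ab: "abelian_number_field (rat_values \<alpha>)" and ext: "rat_ext f \<alpha>"
    and alg: "algebraic_int \<alpha>" and I: "prime_ideal_over I p"
    and R: "R = rat_ext.R f" and e: "e > 0"
    and T: "\<And>a. a \<in> R \<Longrightarrow> poly (map_poly of_int T) a - a ^ p \<in> I"
    and G: "FF = (\<Prod>a\<in>R. quad e a) * S" "alg_poly S"
    and W: "W = U * pderiv FF - FF * C" "alg_poly U" "alg_poly C"
    and deg: "degree W < e * card R" and Wi: "coeff W i \<notin> I"
  shows "(\<forall>a\<in>R. poly (map_poly of_int T) a \<in> R) \<or>
    (\<exists>\<pi>. bij_betw \<pi> R R \<and> real p ^ card R \<le> (\<Prod>a\<in>R. cmod (\<pi> a - poly (map_poly of_int T) a)))"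
proof -
  interpret rat_ext f \<alpha> by fact
  interpret A: abelian_ext f \<alpha> by (rule abelian_extI[OF ab])
  interpret I: prime_ideal_over I p by fact
  have "\<exists>a0\<in>R. poly (pderiv F) a0 \<notin> I"
  proof (rule ccontr)
    assume "\<not> ?thesis"
    then have "\<And>a. a \<in> R \<Longrightarrow> \<exists>b\<in>R. b \<noteq> a \<and> a - b \<in> I"
      using A.congruent_root[OF I alg] R by blast
    then have "coeff W i \<in> I"
      using fin_R A.R_algebraic_int[OF alg] R
      by (intro I.everywhere_ramified[OF _ _ e _ G W deg]) auto
    then show False using Wi by simp
  qed
  then obtain a0 where a0: "a0 \<in> R" "poly (pderiv F) a0 \<notin> I" by blast
  interpret B: rat_ext f a0 using irr monic a0 R by unfold_locales (auto simp: R_def)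
  interpret B: abelian_ext f a0
    using B.abelian_extI ab R_rat_values_eq[OF A.normal] a0 R by simp
  have "algebraic_int a0" using A.R_algebraic_int[OF alg] a0 R by simp
  from B.frobenius_dichotomy[OF this I _ T] a0 R show ?thesis by blast
qed

section \<open>Largest eigenvalues of graphs\<close>

lemma bounded_functions_convergent_subseq:
  fixes x :: "nat \<Rightarrow> nat \<Rightarrow> real"
  assumes "\<And>s i. i < n \<Longrightarrow> \<bar>x s i\<bar> \<le> B"
  shows "\<exists>r. strict_mono r \<and> (\<forall>i<n. convergent (\<lambda>s. x (r s) i))"
  using assms
proof (induction n)
  case 0
  then show ?case by (auto intro!: exI[of _ id] simp: strict_mono_def)
next
  case (Suc n)
  then obtain r where r: "strict_mono r" "\<And>i. i < n \<Longrightarrow> convergent (\<lambda>s. x (r s) i)" by force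
  obtain q where q: "strict_mono q" "monoseq (\<lambda>s. x (r (q s)) n)"
    using seq_monosub[of "\<lambda>s. x (r s) n"] by auto
  have "Bseq (\<lambda>s. x (r (q s)) n)" using Suc.prems[of n] by (intro BseqI'[of _ B]) auto
  then have c: "convergent (\<lambda>s. x (r (q s)) n)" using q(2) by (rule Bseq_monoseq_convergent)
  have "convergent (\<lambda>s. x ((r \<circ> q) s) i)" if "i < Suc n" for i
  proof (cases "i = n")
    case False
    then have "convergent (\<lambda>s. x (r s) i)" using that r by auto
    then show ?thesis using convergent_subseq_convergent[OF _ q(1), of "\<lambda>s. x (r s) i"] by (simp add: o_def)
  qed (use c in simp)
  then show ?case using strict_mono_o[OF r(1) q(1)] by blast
qed

locale conn_graph =
  fixes n :: nat and E :: "nat rel"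
  assumes n_pos: "n > 0" and E_sub: "E \<subseteq> {..<n} \<times> {..<n}" and E_sym: "sym E"
    and conn: "\<And>i j. i < n \<Longrightarrow> j < n \<Longrightarrow> (i, j) \<in> E\<^sup>*"
begin

definition adj :: "nat \<Rightarrow> nat \<Rightarrow> real" where "adj i j = (if (i, j) \<in> E then 1 else 0)"
definition app :: "(nat \<Rightarrow> real) \<Rightarrow> nat \<Rightarrow> real" where "app x i = (\<Sum>j<n. adj i j * x j)"
definition inn :: "(nat \<Rightarrow> real) \<Rightarrow> (nat \<Rightarrow> real) \<Rightarrow> real" where "inn x y = (\<Sum>i<n. x i * y i)"

lemma adj_nonneg: "adj i j \<ge> 0" and adj_le: "adj i j \<le> 1" and adj_sym: "adj i j = adj j i"
  using E_sym by (auto simp: adj_def sym_def)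

lemma inn_sym: "inn x (app y) = inn y (app x)"
proof -
  have "inn x (app y) = (\<Sum>i<n. \<Sum>j<n. adj i j * x i * y j)"
    by (simp add: inn_def app_def sum_distrib_left mult_ac)
  also have "\<dots> = (\<Sum>j<n. \<Sum>i<n. adj j i * x i * y j)"
    by (subst sum.swap) (simp add: adj_sym)
  also have "\<dots> = inn y (app x)"
    by (simp add: inn_def app_def sum_distrib_left mult_ac)
  finally show ?thesis .
qed

lemma inn_add: "inn (\<lambda>i. x i + t * z i) (\<lambda>i. y i + s * u i) = inn x y + s * inn x u + t * inn z y + t * s * inn z u"
  by (simp add: inn_def algebra_simps sum.distrib sum_distrib_left)

lemma app_add: "app (\<lambda>i. x i + t * z i) = (\<lambda>i. app x i + t * app z i)"
  by (rule ext) (simp add: app_def algebra_simps sum.distrib sum_distrib_left)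

lemma inn_commute: "inn x y = inn y x"
  by (simp add: inn_def mult.commute)

lemma inn_self_nonneg: "inn x x \<ge> 0"
  by (simp add: inn_def sum_nonneg)

lemma inn_self_0: "inn x x = 0 \<Longrightarrow> i < n \<Longrightarrow> x i = 0"
  by (simp add: inn_def sum_nonneg_eq_0_iff)

text \<open>Compactness of the unit sphere: near-maximisers have a subsequence that converges in
  every coordinate.\<close>

lemma rayleigh_attained:
  obtains y where "inn y y = 1" "\<And>x. inn x x = 1 \<Longrightarrow> inn x (app x) \<le> inn y (app y)"
proof -
  define S where "S = {inn x (app x) | x. inn x x = 1}"
  have le1: "\<bar>x i\<bar> \<le> 1" if "inn x x = 1" "i < n" for x i
  proof -
    have "(x i)\<^sup>2 \<le> inn x x"
      using that member_le_sum[of i "{..<n}" "\<lambda>i. x i * x i"] by (simp add: inn_def power2_eq_square)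
    then show ?thesis using that abs_le_square_iff[of "x i" 1] by simp
  qed
  have bnd: "inn x (app x) \<le> real n * real n" if x: "inn x x = 1" for x
  proof -
    have "\<bar>app x i\<bar> \<le> real n" if "i < n" for i
    proof -
      have "\<bar>app x i\<bar> \<le> (\<Sum>j<n. \<bar>adj i j * x j\<bar>)" unfolding app_def by (rule sum_abs)
      also have "\<dots> \<le> (\<Sum>j<n. 1)"
        using le1[OF x] adj_nonneg adj_le by (intro sum_mono) (auto simp: abs_mult intro!: mult_le_one)
      finally show ?thesis by simp
    qed
    then have "\<bar>x i * app x i\<bar> \<le> real n" if "i < n" for i
      using le1[OF x that] that mult_mono[of "\<bar>x i\<bar>" 1 "\<bar>app x i\<bar>" "real n"] by (auto simp: abs_mult)
    then have "(\<Sum>i<n. x i * app x i) \<le> (\<Sum>i<n. real n)"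
      by (intro sum_mono) (auto intro: order_trans[OF abs_ge_self])
    then show ?thesis by (simp add: inn_def)
  qed
  have bdd: "bdd_above S" using bnd by (auto simp: S_def bdd_above_def)
  have ne: "S \<noteq> {}"
  proof -
    have "inn (\<lambda>i. if i = 0 then 1 else 0) (\<lambda>i. if i = 0 then 1 else 0) = (\<Sum>i<n. if i = 0 then 1 else 0)"
      unfolding inn_def by (intro sum.cong) auto
    also have "\<dots> = 1" using n_pos by simp
    finally show ?thesis unfolding S_def by blast
  qed
  have "\<exists>x. inn x x = 1 \<and> inn x (app x) > Sup S - 1 / real (Suc s)" for s
  proof -
    have "Sup S - 1 / real (Suc s) < Sup S" by simp
    then obtain a where "a \<in> S" "Sup S - 1 / real (Suc s) < a"
      using less_cSup_iff[OF ne bdd] by blast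
    then show ?thesis unfolding S_def by blast
  qed
  then obtain x where x: "\<And>s. inn (x s) (x s) = 1" "\<And>s. inn (x s) (app (x s)) > Sup S - 1 / real (Suc s)" by metis
  obtain r where r: "strict_mono r" "\<And>i. i < n \<Longrightarrow> convergent (\<lambda>s. x (r s) i)"
    using bounded_functions_convergent_subseq[of n x 1] le1 x(1) by blast
  define y where "y = (\<lambda>i. lim (\<lambda>s. x (r s) i))"
  have lim: "(\<lambda>s. x (r s) i) \<longlonglongrightarrow> y i" if "i < n" for i
    using r(2)[OF that] by (simp add: y_def convergent_LIMSEQ_iff)
  have "(\<lambda>s. inn (x (r s)) (x (r s))) \<longlonglongrightarrow> inn y y"
    unfolding inn_def by (intro tendsto_sum tendsto_mult lim) auto
  then have y1: "inn y y = 1" using x(1) by (simp add: LIMSEQ_const_iff)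
  have la: "(\<lambda>s. app (x (r s)) i) \<longlonglongrightarrow> app y i" for i
    unfolding app_def by (intro tendsto_sum tendsto_mult lim tendsto_const) auto
  have "(\<lambda>s. inn (x (r s)) (app (x (r s)))) \<longlonglongrightarrow> inn y (app y)"
    unfolding inn_def by (intro tendsto_sum tendsto_mult lim la) auto
  moreover have "(\<lambda>s. Sup S - 1 / real (Suc (r s))) \<longlonglongrightarrow> Sup S - 0"
    using LIMSEQ_subseq_LIMSEQ[OF LIMSEQ_inverse_real_of_nat r(1)]
    by (intro tendsto_diff tendsto_const) (simp add: o_def inverse_eq_divide)
  ultimately have "Sup S \<le> inn y (app y)"
    using x(2) by (intro LIMSEQ_le[of "\<lambda>s. Sup S - 1 / real (Suc (r s))" "Sup S"]) (auto intro: less_imp_le)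
  then have "inn z (app z) \<le> inn y (app y)" if "inn z z = 1" for z
  proof -
    have "inn z (app z) \<in> S" using that unfolding S_def by blast
    from cSup_upper[OF this bdd] show ?thesis using \<open>Sup S \<le> inn y (app y)\<close> by simp
  qed
  then show ?thesis using y1 that by blast
qed

lemma zero_spreads:
  assumes y: "\<And>i. i < n \<Longrightarrow> y i \<ge> 0" "\<And>i. i < n \<Longrightarrow> app y i = l * y i" and i: "i < n" "y i = 0" "j < n"
  shows "y j = 0"
  using conn[OF i(1,3)]
proof (induction rule: rtrancl_induct)
  case (step a b)
  have ab: "a < n" "b < n" using step E_sub by auto
  have "(\<Sum>k<n. adj a k * y k) = 0" using y(2)[OF ab(1)] step by (simp add: app_def)
  then have "adj a b * y b = 0"
    using ab y(1) adj_nonneg by (subst (asm) sum_nonneg_eq_0_iff) auto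
  then show ?case using step by (simp add: adj_def)
qed (use i in simp)

text \<open>Passing to absolute values does not lower the Rayleigh quotient, so there is a
  nonnegative maximiser. It is an eigenvector by variation, and connectedness excludes zero
  entries.\<close>

theorem perron_frobenius:
  obtains l w where "\<And>i. i < n \<Longrightarrow> w i > 0" "\<And>i. i < n \<Longrightarrow> app w i = l * w i"
    "\<And>x. inn x (app x) \<le> l * inn x x"
proof -
  obtain y where y: "inn y y = 1" "\<And>x. inn x x = 1 \<Longrightarrow> inn x (app x) \<le> inn y (app y)"
    by (rule rayleigh_attained) blast
  define l where "l = inn y (app y)"
  have ray: "inn x (app x) \<le> l * inn x x" for x
  proof (cases "inn x x = 0")
    case True
    then have "inn x (app x) = 0" using inn_self_0[OF True] by (simp add: inn_def)
    then show ?thesis using True by simp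
  next
    case False
    then have pos: "inn x x > 0" using inn_self_nonneg[of x] by simp
    define c where "c = 1 / sqrt (inn x x)"
    have c2: "c * c * inn x x = 1" using pos by (simp add: c_def)
    have "inn (\<lambda>i. 0 + c * x i) (\<lambda>i. 0 + c * x i) = 1" unfolding inn_add using c2 by (simp add: inn_def)
    then have "inn (\<lambda>i. 0 + c * x i) (app (\<lambda>i. 0 + c * x i)) \<le> l" unfolding l_def by (rule y(2))
    then have "c * c * inn x (app x) \<le> l" unfolding app_add inn_add by (simp add: inn_def app_def)
    then have "c * c * inn x (app x) * inn x x \<le> l * inn x x" using pos by (intro mult_right_mono) auto
    then show ?thesis using c2 by (metis mult.assoc mult.commute mult_1)
  qed
  define w where "w = (\<lambda>i. \<bar>y i\<bar>)"
  have ww: "inn w w = 1" using y(1) by (simp add: w_def inn_def)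
  have "inn y (app y) \<le> inn w (app w)"
  proof -
    have "y i * app y i \<le> \<bar>y i\<bar> * app w i" for i
    proof -
      have "\<bar>app y i\<bar> \<le> (\<Sum>j<n. \<bar>adj i j * y j\<bar>)" unfolding app_def by (rule sum_abs)
      also have "\<dots> = app w i" using adj_nonneg by (simp add: app_def w_def abs_mult)
      finally have "\<bar>y i\<bar> * \<bar>app y i\<bar> \<le> \<bar>y i\<bar> * app w i" by (rule mult_left_mono) simp
      then show ?thesis using abs_ge_self[of "y i * app y i"] by (simp add: abs_mult)
    qed
    then show ?thesis by (auto simp: inn_def w_def intro: sum_mono)
  qed
  then have wl: "inn w (app w) = l" using ray[of w] ww by (simp add: l_def)
  define z where "z = (\<lambda>i. app w i - l * w i)"
  have zz: "inn z z = inn z (app w) - l * inn z w"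
    by (simp add: z_def inn_def algebra_simps sum_subtractf sum.distrib sum_distrib_left)
  \<comment> \<open>First variation: the Rayleigh inequality for \<open>w + t z\<close>, where
    \<open>z\<close> is the residual of the eigenvalue equation, divided by
    \<open>t\<close>.\<close>
  have ineq: "2 * inn z z \<le> t * (l * inn z z - inn z (app z))" if t: "t > 0" for t
  proof -
    have "inn (\<lambda>i. w i + t * z i) (app (\<lambda>i. w i + t * z i)) \<le> l * inn (\<lambda>i. w i + t * z i) (\<lambda>i. w i + t * z i)"
      by (rule ray)
    then have "inn w (app w) + t * inn w (app z) + t * inn z (app w) + t * t * inn z (app z)
       \<le> l * (inn w w + t * inn w z + t * inn z w + t * t * inn z z)"
      unfolding app_add inn_add .
    then have "t * (2 * inn z z) \<le> t * (t * (l * inn z z - inn z (app z)))"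
      unfolding zz using inn_sym[of w z] inn_commute[of w z] wl ww by (simp add: algebra_simps)
    then show ?thesis using t by simp
  qed
  have "inn z z = 0"
  proof (rule ccontr)
    assume "inn z z \<noteq> 0"
    then have p: "inn z z > 0" using inn_self_nonneg[of z] by simp
    let ?d = "l * inn z z - inn z (app z)"
    have d0: "?d \<ge> 0" using ray[of z] by simp
    \<comment> \<open>A small enough \<open>t\<close> contradicts \<open>ineq\<close>; the summand 1
      avoids a division by zero.\<close>
    have "2 * inn z z \<le> (inn z z / (?d + 1)) * ?d" using p d0 by (intro ineq) (auto intro!: divide_pos_pos)
    also have "\<dots> \<le> inn z z" using p d0 by (simp add: divide_simps)
    finally show False using p by simp
  qed
  then have eig: "app w i = l * w i" if "i < n" for i using inn_self_0[OF _ that, of z] by (simp add: z_def)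
  have "w i > 0" if i: "i < n" for i
  proof (rule ccontr)
    assume "\<not> w i > 0"
    then have "w i = 0" by (simp add: w_def)
    then have "w j = 0" if "j < n" for j
      using zero_spreads[of w l i j] eig i that by (simp add: w_def)
    then have "inn w w = 0" by (simp add: inn_def)
    then show False using ww by simp
  qed
  then show ?thesis using eig ray that by blast
qed

text \<open>Paired with the positive eigenvector, the nonnegative defects sum to zero by
  symmetry.\<close>

lemma supersolution_eq:
  assumes w: "\<And>i. i < n \<Longrightarrow> w i > 0" "\<And>i. i < n \<Longrightarrow> app w i = l * w i"
    and y: "\<And>i. i < n \<Longrightarrow> app y i \<ge> l * y i" and i: "i < n"
  shows "app y i = l * y i"
proof -
  have "inn w (app y) = inn y (app w)" by (rule inn_sym)
  also have "\<dots> = (\<Sum>i<n. w i * (l * y i))" unfolding inn_def using w(2) by (intro sum.cong) auto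
  finally have "(\<Sum>i<n. w i * (app y i - l * y i)) = 0" by (simp add: inn_def algebra_simps sum_subtractf)
  moreover have "w i * (app y i - l * y i) \<ge> 0" if "i < n" for i
    using w(1)[OF that] y[OF that] by simp
  ultimately have "w i * (app y i - l * y i) = 0" using i by (subst (asm) sum_nonneg_eq_0_iff) auto
  then show ?thesis using w(1)[OF i] by simp
qed

text \<open>The moduli of \<open>u\<close>, extended by zero, form a supersolution, hence an
  eigenvector, and one zero entry spreads to all. With \<open>A\<close> everything this gives
  simplicity of \<open>l\<close>; with \<open>i0\<close> outside \<open>A\<close> it shows that
  \<open>l\<close> is not an eigenvalue of a proper subgraph.\<close>

lemma subgraph_eigenvector_zero:
  assumes w: "\<And>i. i < n \<Longrightarrow> w i > 0" "\<And>i. i < n \<Longrightarrow> app w i = l * w i"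
    and A: "A \<subseteq> {..<n}" "D \<subseteq> E"
    and u: "\<And>i. i \<in> A \<Longrightarrow> (\<Sum>j\<in>A. (if (i, j) \<in> D then 1 else 0) * u j) = complex_of_real l * u i"
    and z: "i0 < n" "i0 \<in> A \<Longrightarrow> u i0 = 0" and i: "i \<in> A"
  shows "u i = 0"
proof -
  have l0: "l \<ge> 0"
  proof -
    have "app w 0 \<ge> 0" unfolding app_def using w(1) adj_nonneg by (intro sum_nonneg mult_nonneg_nonneg) (auto intro: less_imp_le)
    then show ?thesis using w[OF n_pos] by (simp add: zero_le_mult_iff)
  qed
  define y where "y = (\<lambda>i. if i \<in> A then cmod (u i) else 0)"
  have "app y i \<ge> l * y i" if "i < n" for i
  proof (cases "i \<in> A")
    case True
    have "l * cmod (u i) = cmod (\<Sum>j\<in>A. (if (i, j) \<in> D then 1 else 0) * u j)"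
      using u[OF True] l0 by (simp add: norm_mult)
    also have "\<dots> \<le> (\<Sum>j\<in>A. cmod ((if (i, j) \<in> D then 1 else 0) * u j))" by (rule norm_sum)
    also have "\<dots> \<le> (\<Sum>j\<in>A. adj i j * y j)"
      using A(2) by (intro sum_mono) (auto simp: y_def adj_def)
    also have "\<dots> \<le> app y i" unfolding app_def
      using A(1) adj_nonneg by (intro sum_mono2) (auto simp: y_def)
    finally show ?thesis using True by (simp add: y_def)
  next
    case False
    have "app y i \<ge> 0" unfolding app_def using adj_nonneg by (intro sum_nonneg) (auto simp: y_def)
    then show ?thesis using False by (simp add: y_def)
  qed
  then have "app y i = l * y i" if "i < n" for i using supersolution_eq[OF w _ that] by blast
  moreover have "y i0 = 0" using z by (simp add: y_def)
  ultimately have "y i = 0"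
    using zero_spreads[of y l i0 i] z i A by (auto simp: y_def split: if_splits)
  then show ?thesis using i by (simp add: y_def)
qed

end

section \<open>Characteristic polynomials: pendant vertices and simple eigenvalues\<close>

definition nat_mat :: "nat \<Rightarrow> (nat \<Rightarrow> nat \<Rightarrow> 'a) \<Rightarrow> 'a mat" where
  "nat_mat n a = mat n n (\<lambda>(i, j). a i j)"

lemma nat_mat_carrier [simp]: "nat_mat n a \<in> carrier_mat n n"
  by (simp add: nat_mat_def)

lemma char_poly_matrix_nat_mat:
  "char_poly_matrix (nat_mat n a) = mat n n (\<lambda>(i, j). (if i = j then [:0, 1:] else 0) - [:a i j:])"
  by (rule eq_matI) (auto simp: char_poly_matrix_def nat_mat_def)

lemma const_poly_minus_1: "[:- 1:] = (- 1 :: 'a :: comm_ring_1 poly)"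
  by (metis minus_pCons minus_zero one_pCons)

text \<open>Laplace expansion along the last row and then along the last remaining column, each with
  few nonzero entries because the last vertex is a leaf attached to its predecessor.\<close>

lemma char_poly_leaf:
  fixes a :: "nat \<Rightarrow> nat \<Rightarrow> 'a :: comm_ring_1"
  assumes row: "\<And>j. j \<le> Suc n \<Longrightarrow> a (Suc n) j = (if j = n then 1 else 0)"
    and col: "\<And>j. j \<le> Suc n \<Longrightarrow> a j (Suc n) = (if j = n then 1 else 0)"
  shows "char_poly (nat_mat (Suc (Suc n)) a) =
    [:0, 1:] * char_poly (nat_mat (Suc n) a) - char_poly (nat_mat n a)"
proof -
  let ?b = "\<lambda>i j. (if i = j then [:0, 1:] else 0) - [:a i j:]"
  define N where "N = mat (Suc (Suc n)) (Suc (Suc n)) (\<lambda>(i, j). ?b i j)"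
  have N: "N \<in> carrier_mat (Suc (Suc n)) (Suc (Suc n))" by (simp add: N_def)
  have Ni: "N $$ (i, j) = ?b i j" if "i \<le> Suc n" "j \<le> Suc n" for i j
    using that by (simp add: N_def)
  define L where "L = mat_delete N (Suc n) n"
  have L: "L \<in> carrier_mat (Suc n) (Suc n)" using mat_delete_carrier[OF N, of "Suc n" n] by (simp add: L_def)
  have dL: "mat_delete L n n = char_poly_matrix (nat_mat n a)"
    unfolding char_poly_matrix_nat_mat
    by (rule eq_matI) (simp_all add: L_def mat_delete_def N_def)
  have Lin: "L $$ (i, n) = (if i = n then - 1 else 0)" if "i < Suc n" for i
    using col[of i] that by (auto simp: L_def mat_delete_def N_def const_poly_minus_1)
  have "det L = (\<Sum>i<Suc n. L $$ (i, n) * cofactor L i n)"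
    by (rule laplace_expansion_column[OF L]) simp
  also have "\<dots> = (\<Sum>i<Suc n. if i = n then - cofactor L i n else 0)"
    by (intro sum.cong refl) (simp add: Lin)
  also have "\<dots> = - cofactor L n n"
    by (simp only: sum.delta finite_lessThan lessThan_iff lessI if_True)
  also have "\<dots> = - char_poly (nat_mat n a)"
    unfolding cofactor_def dL char_poly_def by simp
  finally have detL: "det L = - char_poly (nat_mat n a)" .
  have dN: "mat_delete N (Suc n) (Suc n) = char_poly_matrix (nat_mat (Suc n) a)"
    unfolding char_poly_matrix_nat_mat
    by (rule eq_matI) (simp_all add: mat_delete_def N_def)
  have cofs: "cofactor N (Suc n) n = - det L" "cofactor N (Suc n) (Suc n) = char_poly (nat_mat (Suc n) a)"
    by (simp_all add: cofactor_def L_def dN char_poly_def)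
  have Nin: "N $$ (Suc n, j) = (if j = Suc n then [:0, 1:] else if j = n then - 1 else 0)" if "j < Suc (Suc n)" for j
    using row[of j] that by (auto simp: N_def const_poly_minus_1)
  have "det N = (\<Sum>j<Suc (Suc n). N $$ (Suc n, j) * cofactor N (Suc n) j)"
    by (rule laplace_expansion_row[OF N]) simp
  also have "\<dots> = (\<Sum>j<Suc (Suc n). (if j = Suc n then [:0, 1:] * cofactor N (Suc n) (Suc n) else 0)
      + (if j = n then - cofactor N (Suc n) n else 0))"
  proof (rule sum.cong[OF refl])
    fix j assume "j \<in> {..<Suc (Suc n)}"
    then show "N $$ (Suc n, j) * cofactor N (Suc n) j = (if j = Suc n then [:0, 1:] * cofactor N (Suc n) (Suc n) else 0)
      + (if j = n then - cofactor N (Suc n) n else 0)"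
      using Nin[of j] by (cases "j = Suc n"; cases "j = n") simp_all
  qed
  also have "\<dots> = [:0, 1:] * cofactor N (Suc n) (Suc n) - cofactor N (Suc n) n"
    by (simp only: sum.distrib sum.delta finite_lessThan lessThan_iff lessI less_SucI if_True) simp
  also have "\<dots> = [:0, 1:] * char_poly (nat_mat (Suc n) a) - char_poly (nat_mat n a)"
    unfolding cofs detL by simp
  finally show ?thesis
    unfolding char_poly_def char_poly_matrix_nat_mat N_def .
qed

lemma const_poly_sum: "(\<Sum>k\<in>A. [:f k:]) = [:\<Sum>k\<in>A. f k:]"
  by (induction A rule: infinite_finite_induct) auto

text \<open>Put the eigenvector \<open>w\<close> into the last column of a unit matrix and multiply
  the characteristic matrix by it: the last column becomes \<open>(X - l) w\<close>. Taking out
  \<open>X - l\<close> leaves \<open>N'\<close>, and the root is simple if \<open>N'\<close> is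
  invertible at \<open>l\<close>.\<close>

lemma order_char_poly_simple:
  fixes a :: "nat \<Rightarrow> nat \<Rightarrow> complex"
  assumes N: "N = Suc n" and sym: "\<And>i j. a i j = a j i"
    and w: "\<And>i. i < N \<Longrightarrow> (\<Sum>j<N. a i j * w j) = l * w i" "w n \<noteq> 0" "(\<Sum>i<N. w i * w i) \<noteq> 0"
    and uniq: "\<And>u. (\<And>i. i < N \<Longrightarrow> (\<Sum>j<N. a i j * u j) = l * u i) \<Longrightarrow> u n = 0 \<Longrightarrow> (\<And>i. i < N \<Longrightarrow> u i = 0)"
  shows "Polynomial.order l (char_poly (nat_mat (N) a)) = 1"
proof -
  have n: "n < N" by (simp add: N)
  let ?b = "\<lambda>i j. (if i = j then [:0, 1:] else 0) - [:a i j:]"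
  define C where "C = mat N N (\<lambda>(i, j). ?b i j)"
  define S where "S = mat N N (\<lambda>(i, j). if j = n then [:w i:] else if i = j then 1 else 0)"
  define N' where "N' = mat N N (\<lambda>(i, j). if j = n then [:w i:] else ?b i j)"
  define Dg where "Dg = mat N N (\<lambda>(i, j). if i = j then (if j = n then [:-l, 1:] else 1) else 0)"
  have car: "C \<in> carrier_mat N N" "S \<in> carrier_mat N N" "N' \<in> carrier_mat N N" "Dg \<in> carrier_mat N N"
    by (auto simp: C_def S_def N'_def Dg_def)
  have CS: "C * S = N' * Dg"
  proof (rule eq_matI)
    fix i j assume "i < dim_row (N' * Dg)" "j < dim_col (N' * Dg)"
    then have ij: "i < N" "j < N" by (auto simp: N'_def Dg_def)
    have L: "(C * S) $$ (i, j) = (\<Sum>k<N. ?b i k * (if j = n then [:w k:] else if k = j then 1 else 0))"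
      using ij by (simp add: C_def S_def scalar_prod_def atLeast0LessThan)
    have R: "(N' * Dg) $$ (i, j) = (\<Sum>k<N. (if k = n then [:w i:] else ?b i k) * (if k = j then (if j = n then [:-l, 1:] else 1) else 0))"
      using ij by (simp add: N'_def Dg_def scalar_prod_def atLeast0LessThan)
    have R': "(N' * Dg) $$ (i, j) = (if j = n then [:w i:] else ?b i j) * (if j = n then [:-l, 1:] else 1)"
    proof -
      have "(\<Sum>k<N. (if k = n then [:w i:] else ?b i k) * (if k = j then (if j = n then [:-l, 1:] else 1) else 0))
         = (\<Sum>k<N. if k = j then (if k = n then [:w i:] else ?b i k) * (if j = n then [:-l, 1:] else 1) else 0)"
        by (rule sum.cong[OF refl]) (simp only: mult_zero_right split: if_split, blast)
      then show ?thesis unfolding R using ij by (simp only: sum.delta' sum.delta finite_lessThan lessThan_iff if_True)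
    qed
    show "(C * S) $$ (i, j) = (N' * Dg) $$ (i, j)"
    proof (cases "j = n")
      case True
      have "(C * S) $$ (i, j) = (\<Sum>k<N. (if i = k then [:0, 1:] * [:w k:] else 0) - [:a i k:] * [:w k:])"
        unfolding L using True by (intro sum.cong) (auto simp: left_diff_distrib)
      also have "\<dots> = [:0, 1:] * [:w i:] - (\<Sum>k<N. [:a i k * w k:])"
        using ij by (simp add: sum_subtractf mult.commute)
      also have "\<dots> = [:0, 1:] * [:w i:] - [:l * w i:]"
        using w(1)[OF ij(1)] by (simp only: const_poly_sum)
      finally show ?thesis unfolding R' using True by simp
    next
      case False
      then have "(C * S) $$ (i, j) = (\<Sum>k<N. if k = j then ?b i k else 0)"
        unfolding L by (intro sum.cong[OF refl]) (simp only: if_False mult_zero_right mult_1_right split: if_split, blast)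
      then have "(C * S) $$ (i, j) = ?b i j" using ij by (simp only: sum.delta finite_lessThan lessThan_iff if_True)
      with R' False show ?thesis by (simp only: if_False mult_1_right)
    qed
  qed (simp_all add: C_def S_def N'_def Dg_def)
  have detC: "det C = char_poly (nat_mat N a)"
    unfolding char_poly_def char_poly_matrix_nat_mat C_def by simp
  have "det S = prod_list (diag_mat S)"
    by (rule det_upper_triangular[OF _ car(2)]) (auto simp: S_def N)
  also have "\<dots> = (\<Prod>i<N. S $$ (i, i))" using car(2) by (simp add: prod_list_diag_prod atLeast0LessThan)
  also have "\<dots> = [:w n:]" by (simp add: S_def N)
  finally have detS: "det S = [:w n:]" .
  have "det Dg = prod_list (diag_mat Dg)"
    by (rule det_upper_triangular[OF _ car(4)]) (auto simp: Dg_def N)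
  also have "\<dots> = (\<Prod>i<N. Dg $$ (i, i))" using car(4) by (simp add: prod_list_diag_prod atLeast0LessThan)
  also have "\<dots> = [:-l, 1:]" by (simp add: Dg_def N)
  finally have detD: "det Dg = [:-l, 1:]" .
  have eq: "det C * [:w n:] = det N' * [:-l, 1:]"
    using det_mult[OF car(1,2)] det_mult[OF car(3,4)] CS detS detD by simp
  define N1 where "N1 = mat N N (\<lambda>(i, j). if j = n then w i else (if i = j then l else 0) - a i j)"
  have N1: "N1 \<in> carrier_mat N N" by (simp add: N1_def)
  have ev: "poly (det N') l = det N1"
    by (rule poly_det_cong[OF N1 car(3)]) (auto simp: N'_def N1_def)
  have "det N1 \<noteq> 0"
  proof
    assume "det N1 = 0"
    then obtain v where v: "v \<in> carrier_vec N" "v \<noteq> 0\<^sub>v N" "N1 *\<^sub>v v = 0\<^sub>v N"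
      using det_0_iff_vec_prod_zero[OF N1] by blast
    define u where "u = (\<lambda>i. if i = n then 0 else v $ i)"
    have eqn: "l * u i - (\<Sum>j<N. a i j * u j) + w i * v $ n = 0" if i: "i < N" for i
    proof -
      have "0 = (N1 *\<^sub>v v) $ i" using v(3) i by simp
      also have "\<dots> = (\<Sum>j<N. (if j = n then w i else (if i = j then l else 0) - a i j) * v $ j)"
        using i v(1) by (simp add: N1_def scalar_prod_def atLeast0LessThan)
      also have "\<dots> = (\<Sum>j<N. (if j = i then l * u i else 0) - a i j * u j + (if j = n then w i * v $ n else 0))"
        by (intro sum.cong) (auto simp: u_def algebra_simps)
      also have "\<dots> = l * u i - (\<Sum>j<N. a i j * u j) + w i * v $ n"
        using i by (simp only: sum.distrib sum_subtractf sum.delta finite_lessThan lessThan_iff if_True n)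
      finally show ?thesis by simp
    qed
    \<comment> \<open>Pairing with \<open>w\<close>, on which the symmetric matrix acts as
      \<open>l\<close>, cancels the terms with \<open>u\<close> and leaves \<open>v $ n\<close>
      times a nonzero sum of squares.\<close>
    have "w i * (l * u i - (\<Sum>j<N. a i j * u j) + w i * v $ n) = 0" if "i < N" for i
      using eqn[OF that] by (simp only: mult_zero_right)
    then have "0 = (\<Sum>i<N. w i * (l * u i - (\<Sum>j<N. a i j * u j) + w i * v $ n))"
      by (intro sum.neutral[symmetric] ballI) (simp only: lessThan_iff)
    also have "\<dots> = (\<Sum>i<N. l * w i * u i) - (\<Sum>i<N. \<Sum>j<N. w i * (a i j * u j)) + (\<Sum>i<N. w i * w i) * v $ n"
    proof -
      have "(\<Sum>i<N. w i * (l * u i - (\<Sum>j<N. a i j * u j) + w i * v $ n)) =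
          (\<Sum>i<N. l * w i * u i - w i * (\<Sum>j<N. a i j * u j) + w i * w i * v $ n)"
        by (rule sum.cong[OF refl]) (simp only: distrib_left right_diff_distrib mult.assoc mult.left_commute)
      also have "\<dots> = (\<Sum>i<N. l * w i * u i) - (\<Sum>i<N. w i * (\<Sum>j<N. a i j * u j)) + (\<Sum>i<N. w i * w i * v $ n)"
        by (simp only: sum.distrib sum_subtractf)
      finally show ?thesis by (simp only: sum_distrib_left sum_distrib_right)
    qed
    finally have z: "0 = (\<Sum>i<N. l * w i * u i) - (\<Sum>i<N. \<Sum>j<N. w i * (a i j * u j)) + (\<Sum>i<N. w i * w i) * v $ n" .
    have "(\<Sum>i<N. \<Sum>j<N. w i * (a i j * u j)) = (\<Sum>j<N. (\<Sum>i<N. a j i * w i) * u j)"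
    proof (subst sum.swap, rule sum.cong[OF refl])
      fix j
      have "w i * (a i j * u j) = a j i * w i * u j" for i using sym[of i j] by simp
      then show "(\<Sum>i<N. w i * (a i j * u j)) = (\<Sum>i<N. a j i * w i) * u j"
        by (simp only: sum_distrib_right)
    qed
    also have "\<dots> = (\<Sum>j<N. l * w j * u j)" using w(1) by (intro sum.cong) auto
    finally have vn: "v $ n = 0" using w(3) z by simp
    have "(\<Sum>j<N. a i j * u j) = l * u i" if "i < N" for i using eqn[OF that] vn by simp
    then have "u i = 0" if "i < N" for i using uniq[of u] that by (simp add: u_def)
    then have "v $ i = 0" if "i < N" for i using that vn by (cases "i = n") (simp, metis u_def)
    then have "v = 0\<^sub>v N" using v(1) by (intro eq_vecI) auto
    then show False using v(2) by simp
  qed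
  then have nz: "poly (det N') l \<noteq> 0" using ev by simp
  then have N'nz: "det N' \<noteq> 0" by auto
  have "Polynomial.order l (det C * [:w n:]) = Polynomial.order l (det N') + Polynomial.order l [:-l, 1:]"
    unfolding eq using N'nz by (intro order_mult) (simp only: mult_eq_0_iff pCons_eq_0_iff, simp)
  also have "Polynomial.order l (det N') = 0" using nz by (rule order_0I)
  also have "Polynomial.order l [:-l, 1:] = 1" using order_power_n_n[of l 1] by simp
  finally have "Polynomial.order l (det C * [:w n:]) = 1" by simp
  moreover have "Polynomial.order l (det C * [:w n:]) = Polynomial.order l (det C)"
    using w(2) by (simp add: order_smult)
  ultimately show ?thesis by (simp add: detC)
qed

section \<open>Classification of graphs with a long hanging path\<close>

locale simple_conn_graph = conn_graph +
  assumes irrefl: "(i, i) \<notin> E"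
begin

definition nbrs :: "nat \<Rightarrow> nat set" where "nbrs i = {j. (i, j) \<in> E}"

lemma nbrs_sym: "j \<in> nbrs i \<longleftrightarrow> i \<in> nbrs j"
  using E_sym by (auto simp: nbrs_def sym_def)

lemma nbrs_less: "j \<in> nbrs i \<Longrightarrow> j < n" "j \<in> nbrs i \<Longrightarrow> i < n"
  using E_sub by (auto simp: nbrs_def)

lemma closed_all:
  assumes "i < n" "i \<in> A" "\<And>i. i \<in> A \<Longrightarrow> nbrs i \<subseteq> A" "j < n" shows "j \<in> A"
  using conn[OF assms(1,4)]
  by (induction rule: rtrancl_induct) (use assms in \<open>auto simp: nbrs_def\<close>)

lemma app_ge:
  assumes "\<And>i. x i \<ge> 0" "Y \<subseteq> nbrs z" shows "sum x Y \<le> app x z"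
proof -
  have "sum x Y = (\<Sum>y\<in>Y. adj z y * x y)"
    using assms(2) by (intro sum.cong) (auto simp: adj_def nbrs_def)
  also have "\<dots> \<le> app x z" unfolding app_def
    using assms nbrs_less adj_nonneg by (intro sum_mono2) auto
  finally show ?thesis .
qed

text \<open>A path that leaves the vertex \<open>u r\<close> and whose other vertices have no further neighbours.\<close>

definition hanging_path :: "(nat \<Rightarrow> nat) \<Rightarrow> nat \<Rightarrow> bool" where
  "hanging_path u r \<longleftrightarrow> r > 0 \<and> inj_on u {..r} \<and> (\<forall>i\<le>r. u i < n) \<and> nbrs (u 0) = {u 1} \<and>
    (\<forall>i. 0 < i \<and> i < r \<longrightarrow> nbrs (u i) = {u (i - 1), u (Suc i)})"

lemma hanging_path_nbrs:
  assumes "hanging_path u r" "i < r"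
  shows "nbrs (u i) = {u j | j. j = Suc i \<or> i = Suc j}"
proof (cases i)
  case 0
  then have "nbrs (u i) = {u 1}" using assms by (auto simp: hanging_path_def)
  then show ?thesis using 0 by auto
next
  case (Suc i')
  then have "nbrs (u i) = {u (i - 1), u (Suc i)}" using assms by (auto simp: hanging_path_def)
  then show ?thesis using Suc by auto
qed

lemma hanging_path_end:
  assumes h: "hanging_path u r" and i: "i \<le> r" "u i \<in> nbrs (u r)" shows "Suc i = r"
proof -
  have inj: "inj_on u {..r}" using h by (auto simp: hanging_path_def)
  have "i \<noteq> r" using i(2) irrefl by (auto simp: nbrs_def)
  then have ir: "i < r" using i by simp
  have "u r \<in> nbrs (u i)" using i(2) nbrs_sym by simp
  then obtain j where j: "u r = u j" "j = Suc i \<or> i = Suc j" using hanging_path_nbrs[OF h ir] by auto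
  then have "j \<le> r" using ir by auto
  then have "r = j" using inj_onD[OF inj j(1)] by auto
  then show ?thesis using j ir by auto
qed

text \<open>Entries 12, 11, ..., 1 along the path going away from \<open>u r\<close>, then 0 by
  truncated subtraction; \<open>g\<close> gives the entries off the path. The linear decrease makes
  the path interior harmless: there the neighbours sum to at least twice the entry.\<close>

definition test_vector :: "(nat \<Rightarrow> nat) \<Rightarrow> nat \<Rightarrow> (nat \<Rightarrow> real) \<Rightarrow> nat \<Rightarrow> real" where
  "test_vector u r g z = (if z \<in> u ` {..r} then real (12 - (r - inv_into {..r} u z)) else g z)"

text \<open>The neighbours sum to at least twice the entry everywhere, and at \<open>u r\<close>,
  where the entry is 12, to at least 25. This excess of 1, weighted by 12, is compared with the
  squared length of the vector in the Rayleigh quotient.\<close>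

lemma hanging_path_sup:
  assumes h: "hanging_path u r" and r: "r \<ge> 12"
    and H: "finite H" "card H \<le> 3" "H \<inter> u ` {..r} = {}"
    and g: "\<And>z. 0 \<le> g z" "\<And>z. g z \<le> 12" "\<And>z. z \<notin> H \<Longrightarrow> g z = 0"
    and gH: "\<And>z. z \<in> H \<Longrightarrow> 2 * g z \<le> app (test_vector u r g) z"
    and c: "25 \<le> app (test_vector u r g) (u r)"
    and ray: "\<And>x. inn x (app x) \<le> l * inn x x"
  shows "l \<ge> 2 + 1 / 192"
proof -
  define x where "x = test_vector u r g"
  note gH = gH[folded x_def] and c = c[folded x_def]
  have x: "x = (\<lambda>z. if z \<in> u ` {..r} then real (12 - (r - inv_into {..r} u z)) else g z)"
    unfolding x_def by (rule ext) (rule test_vector_def)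
  have inj: "inj_on u {..r}" and un: "\<And>i. i \<le> r \<Longrightarrow> u i < n" using h by (auto simp: hanging_path_def)
  have xu: "x (u i) = real (12 - (r - i))" if "i \<le> r" for i
    using that inj by (simp add: x)
  have x0: "x z \<ge> 0" for z using g(1) by (simp add: x)
  have x12: "x z \<le> 12" for z using g(2)[of z] by (auto simp: x)
  have sup: "app x z \<ge> 2 * x z" for z
  proof (cases "z \<in> u ` {..r}")
    case True
    then obtain i where i: "i \<le> r" "z = u i" by auto
    consider "i = r" | "i = 0" | "0 < i" "i < r" using i by force
    then show ?thesis
    proof cases
      case 1
      then show ?thesis using c xu[of r] i by simp
    next
      case 2
      have "app x z \<ge> 0" using app_ge[OF x0, of "{}" z] by simp
      then show ?thesis using 2 i xu[of 0] r by simp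
    next
      case 3
      have "nbrs z = {u (i - 1), u (Suc i)}" using 3 h i by (auto simp: hanging_path_def)
      then have "sum x {u (i - 1), u (Suc i)} \<le> app x z" by (intro app_ge x0) auto
      moreover have le: "i - 1 \<le> r" "Suc i \<le> r" using 3 by auto
      moreover have "u (i - 1) \<noteq> u (Suc i)" using inj_onD[OF inj, of "i - 1" "Suc i"] le by force
      ultimately have "x (u (i - 1)) + x (u (Suc i)) \<le> app x z" by simp
      moreover have "x (u (i - 1)) = real (12 - (r - (i - 1)))" "x (u (Suc i)) = real (12 - (r - Suc i))"
        using xu[OF le(1)] xu[OF le(2)] by blast+
      moreover have "2 * (12 - (r - i)) \<le> 12 - (r - (i - 1)) + (12 - (r - Suc i))" using 3 by auto
      then have "2 * real (12 - (r - i)) \<le> real (12 - (r - (i - 1))) + real (12 - (r - Suc i))"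
        by (metis of_nat_add of_nat_le_iff of_nat_mult of_nat_numeral)
      ultimately show ?thesis using xu[OF i(1)] i by simp
    qed
  next
    case False
    then have xz: "x z = g z" by (simp add: x)
    show ?thesis
    proof (cases "z \<in> H")
      case False
      then show ?thesis using app_ge[OF x0, of "{}" z] g xz by simp
    qed (use gH xz in auto)
  qed
  define S where "S = u ` {r - 11..r} \<union> H"
  have "card S \<le> card (u ` {r - 11..r}) + card H" unfolding S_def by (rule card_Un_le)
  also have "card (u ` {r - 11..r}) \<le> card {r - 11..r}" by (rule card_image_le) simp
  also have "\<dots> = 12" using r by simp
  finally have cS: "card S \<le> 15" using H(2) by simp
  have finS: "finite S" using H(1) by (simp add: S_def)
  have xS: "x z = 0" if "z \<notin> S" for z
  proof (cases "z \<in> u ` {..r}")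
    case True
    then obtain i where i: "i \<le> r" "z = u i" by auto
    then have "i < r - 11" using that by (auto simp: S_def not_le[symmetric])
    then show ?thesis using xu[OF i(1)] i by simp
  next
    case False
    then show ?thesis using that g(3)[of z] by (simp add: x S_def)
  qed
  have "inn x x = (\<Sum>z\<in>{..<n} \<inter> S. x z * x z)" unfolding inn_def
    using xS by (intro sum.mono_neutral_right) auto
  also have "\<dots> \<le> (\<Sum>z\<in>{..<n} \<inter> S. 144)"
  proof (rule sum_mono)
    fix z
    show "x z * x z \<le> 144" using mult_mono[OF x12[of z] x12[of z]] x0[of z] by simp
  qed
  also have "\<dots> \<le> 144 * real (card S)" using card_mono[OF finS, of "{..<n} \<inter> S"] by simp
  \<comment> \<open>At most 12 path vertices and 3 others count, each contributing at most 144; 2160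
    is rounded up to \<open>12 * 192\<close>, whence the 192.\<close>
  also have "\<dots> \<le> 2304" using cS by simp
  finally have inn: "inn x x \<le> 2304" .
  have xc: "x (u r) = 12" using xu[of r] by simp
  have "12 \<le> x (u r) * (app x (u r) - 2 * x (u r))" using c xc by simp
  also have "\<dots> \<le> (\<Sum>z<n. x z * (app x z - 2 * x z))"
    using sup x0 un[of r] by (intro member_le_sum) auto
  also have "\<dots> = inn x (app x) - 2 * inn x x"
    by (simp add: inn_def algebra_simps sum_subtractf sum_distrib_left)
  also have "\<dots> \<le> (l - 2) * inn x x" using ray[of x] by (simp add: algebra_simps)
  finally have *: "12 \<le> (l - 2) * inn x x" .
  have "l - 2 > 0" 
  proof (rule ccontr)
    assume "\<not> l - 2 > 0"
    then have "(l - 2) * inn x x \<le> 0" using inn_self_nonneg[of x] by (intro mult_nonpos_nonneg) auto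
    then show False using * by simp
  qed
  then have "(l - 2) * inn x x \<le> (l - 2) * 2304" using inn by (intro mult_left_mono) auto
  then show ?thesis using * by simp
qed

definition labels :: "nat pair_pre_digraph \<Rightarrow> (nat \<Rightarrow> nat) \<Rightarrow> bool" where
  "labels H f \<longleftrightarrow> bij_betw f {..<n} {..<n} \<and> (\<forall>i<n. \<forall>j<n. (f i, f j) \<in> E \<longleftrightarrow> (i, j) \<in> parcs H)"

lemma labelsI:
  assumes "\<And>i. i < n \<Longrightarrow> f i < n" "\<And>z. z < n \<Longrightarrow> z \<in> f ` {..<n}"
    and "\<And>i j. i < n \<Longrightarrow> j < n \<Longrightarrow> f j \<in> nbrs (f i) \<longleftrightarrow> (i, j) \<in> parcs H"
  shows "labels H f"
proof -
  have img: "f ` {..<n} = {..<n}"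
  proof
    show "f ` {..<n} \<subseteq> {..<n}" by (rule image_subsetI) (simp add: assms(1))
    show "{..<n} \<subseteq> f ` {..<n}" by (rule subsetI) (simp only: assms(2) lessThan_iff)
  qed
  have "inj_on f {..<n}" by (rule eq_card_imp_inj_on) (simp_all only: img finite_lessThan)
  then show ?thesis using assms(3) img unfolding labels_def bij_betw_def nbrs_def mem_Collect_eq by blast
qed

text \<open>Induction on the number of vertices off the path. Without another neighbour of
  \<open>u r\<close> the graph is of type A; a single one prolongs the path. At a branching, every
  configuration other than two leaves admits a test vector, and two leaves give type D.\<close>

theorem classification:
  assumes ray: "\<And>x. inn x (app x) \<le> l * inn x x" and "hanging_path u r" "r \<ge> 12"
  shows "l \<ge> 2 + 1 / 192 \<or> (\<exists>f. labels (dynkin_A n) f) \<or> (\<exists>f. labels (dynkin_D n) f)"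
  using assms(2,3)
proof (induction "n - r" arbitrary: u r rule: less_induct)
  case less
  note h = less.prems(1) and r = less.prems(2)
  have inj: "inj_on u {..r}" and un: "\<And>i. i \<le> r \<Longrightarrow> u i < n" and r0: "r > 0"
    using h by (auto simp: hanging_path_def)
  have rn: "r < n" using card_inj_on_le[OF inj, of "{..<n}"] un by force
  have pr: "u (r - 1) \<in> nbrs (u r)"
  proof -
    have "u r \<in> nbrs (u (r - 1))" using hanging_path_nbrs[OF h, of "r - 1"] r0 by auto
    then show ?thesis using nbrs_sym by simp
  qed
  define Oth where "Oth = nbrs (u r) - {u (r - 1)}"
  have Nc: "nbrs (u r) = insert (u (r - 1)) Oth" using pr by (auto simp: Oth_def)
  have Op: "z \<notin> u ` {..r}" if z: "z \<in> Oth" for z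
  proof
    assume "z \<in> u ` {..r}"
    then obtain i where i: "i \<le> r" "z = u i" by auto
    then have "Suc i = r" using hanging_path_end[OF h] z by (auto simp: Oth_def)
    then show False using z i by (auto simp: Oth_def)
  qed
  have cO: "u r \<in> nbrs z" "z < n" if "z \<in> Oth" for z
    using that nbrs_sym nbrs_less by (auto simp: Oth_def)
  have path_closed: "nbrs (u i) \<subseteq> u ` {..r}" if "i < r" for i
    using hanging_path_nbrs[OF h that] that by auto
  have arc_path: "u j \<in> nbrs (u i) \<longleftrightarrow> j = Suc i \<or> i = Suc j" if "i \<le> r" "j \<le> r" for i j
  proof -
    have *: "u j \<in> nbrs (u i) \<longleftrightarrow> j = Suc i \<or> i = Suc j" if "i < r" "j \<le> r" for i j
    proof
      note nb = hanging_path_nbrs[OF h that(1)]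
      assume "u j \<in> nbrs (u i)"
      then obtain j' where "u j = u j'" "j' = Suc i \<or> i = Suc j'" using nb by auto
      moreover from this have "j = j'" using inj_onD[OF inj, of j j'] that by auto
      ultimately show "j = Suc i \<or> i = Suc j" by simp
    next
      assume "j = Suc i \<or> i = Suc j"
      then show "u j \<in> nbrs (u i)" using hanging_path_nbrs[OF h that(1)] by auto
    qed
    have "i < r \<or> j < r \<or> i = r \<and> j = r" using that by linarith
    then consider "i < r" | "j < r" | "i = r" "j = r" by blast
    then show ?thesis
    proof cases
      case 2
      then show ?thesis using *[OF 2 that(1)] nbrs_sym by auto
    qed (use * that irrefl in \<open>auto simp: nbrs_def\<close>)
  qed
  let ?x = "test_vector u r"
  have xc: "?x g (u r) = 12" "?x g (u (r - 1)) = 11" for g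
    using inj r0 by (auto simp: test_vector_def inv_into_f_f)
  have xO: "?x g z = g z" if "z \<notin> u ` {..r}" for g z using that by (simp add: test_vector_def)
  note sup = hanging_path_sup[OF h r _ _ _ _ _ _ _ _ ray]
  have xnn: "?x g z \<ge> 0" if "\<And>z. g z \<ge> 0" for g z using that by (simp add: test_vector_def)
  consider "Oth = {}" | a where "Oth = {a}" | a b where "a \<in> Oth" "b \<in> Oth" "a \<noteq> b"
    by blast
  then show ?case
  proof cases
    case 1
    have all: "z \<in> u ` {..r}" if "z < n" for z
    proof (rule closed_all[OF un[of 0] _ _ that])
      fix i assume "i \<in> u ` {..r}"
      then obtain j where j: "j \<le> r" "i = u j" by auto
      show "nbrs i \<subseteq> u ` {..r}"
      proof (cases "j = r")
        case True
        then show ?thesis using Nc 1 j by auto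
      next
        case False
        then show ?thesis using path_closed[of j] j by auto
      qed
    qed auto
    then have "{..<n} = u ` {..r}" using un by auto
    then have "n = card (u ` {..r})" by (metis card_lessThan)
    then have n: "n = Suc r" using card_image[OF inj] by simp
    have "labels (dynkin_A n) u"
    proof (rule labelsI)
      fix i j assume "i < n" "j < n"
      then show "u j \<in> nbrs (u i) \<longleftrightarrow> (i, j) \<in> parcs (dynkin_A n)"
        using arc_path[of i j] n by (auto simp: dynkin_A_def edges_sym_def)
    qed (use un n all in \<open>auto simp: lessThan_Suc_atMost\<close>)
    then show ?thesis by blast
  next
    case (2 a)
    define u' where "u' = u(Suc r := a)"
    have a: "a \<notin> u ` {..r}" "a < n" using Op[of a] cO[of a] 2 by auto
    have "hanging_path u' (Suc r)"
      unfolding hanging_path_def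
    proof (intro conjI allI impI)
      have "inj_on u' {..r}" using inj by (rule inj_on_cong[THEN iffD2, rotated]) (auto simp: u'_def)
      then show "inj_on u' {..Suc r}" using a by (auto simp: atMost_Suc u'_def)
      fix i assume "0 < i \<and> i < Suc r"
      then show "nbrs (u' i) = {u' (i - 1), u' (Suc i)}"
        using h Nc 2 by (cases "i = r") (auto simp: u'_def hanging_path_def)
    qed (use h a r0 in \<open>auto simp: u'_def hanging_path_def le_Suc_eq\<close>)
    then show ?thesis by (rule less.hyps[rotated]) (use r rn in auto)
  next
    case (3 a b)
    have ap: "a \<notin> u ` {..r}" "b \<notin> u ` {..r}" using Op 3 by auto
    have ac: "u r \<in> nbrs a" "u r \<in> nbrs b" using cO 3 by auto
    have ur: "u r \<in> u ` {..r}" "u (r - 1) \<in> u ` {..r}" by auto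
    have ne: "a \<noteq> u r" "b \<noteq> u r" "a \<noteq> u (r - 1)" "b \<noteq> u (r - 1)" using ap ur by metis+
    have spider: "l \<ge> 2 + 1 / 192"
      if ab: "a \<in> Oth" "b \<in> Oth" "a \<noteq> b" "(a, b) \<notin> E" and a': "a' \<in> nbrs a" "a' \<noteq> u r" for a b a'
    proof -
      have ap: "a \<notin> u ` {..r}" "b \<notin> u ` {..r}" using Op ab by auto
      have ne: "a \<noteq> u r" "b \<noteq> u r" "a \<noteq> u (r - 1)" "b \<noteq> u (r - 1)" using ap ur by metis+
      have a'b: "a' \<noteq> b" "a' \<noteq> a" using a' ab irrefl by (auto simp: nbrs_def)
      have a'p: "a' \<notin> u ` {..r}"
      proof
        assume "a' \<in> u ` {..r}"
        then obtain i where i: "i \<le> r" "a' = u i" by auto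
        then have "i < r" using a' by (cases "i = r") auto
        then have "a \<in> u ` {..r}" using path_closed[of i] a' i nbrs_sym by auto
        then show False using ap by simp
      qed
      \<comment> \<open>Linear decrease from 12 to 0 along an arm with two vertices (8, 4) and along
        one with a single vertex (6); the sum at \<open>u r\<close> is
        \<open>11 + 8 + 6 = 25\<close>, exactly what is needed.\<close>
      define g where "g = (\<lambda>z. if z = a then 8 else if z = a' then 4 else if z = b then 6 else 0 :: real)"
      have g0: "\<And>z. g z \<ge> 0" by (simp add: g_def)
      have ge: "sum (?x g) Y \<le> app (?x g) z" if "Y \<subseteq> nbrs z" for Y z
        using xnn[OF g0] that by (rule app_ge)
      show ?thesis
      proof (rule sup[of "{a, b, a'}" g])
        show "25 \<le> app (?x g) (u r)"
          using ge[of "{u (r - 1), a, b}" "u r"] Nc ab ne xc(2)[of g] xO[OF ap(1), of g] xO[OF ap(2), of g]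
          by (simp add: g_def a'b[symmetric])
        fix z assume z: "z \<in> {a, b, a'}"
        have "a \<in> nbrs a'" using a' nbrs_sym by simp
        then show "2 * g z \<le> app (?x g) z"
          using z ge[of "{u r, a'}" a] ge[of "{u r}" b] ge[of "{a}" a'] cO(1)[OF ab(1)] cO(1)[OF ab(2)] a' xc(1)[of g]
            xO[OF ap(1), of g] xO[OF a'p, of g] ab(3) a'b by (auto simp: g_def)
      qed (use ap a'p ab(3) a'b in \<open>auto simp: g_def card_insert_if\<close>)
    qed
    show ?thesis
    proof (cases "Oth = {a, b}")
      case False
      then obtain d where d: "d \<in> Oth" "d \<noteq> a" "d \<noteq> b" using 3 by auto
      have dp: "d \<notin> u ` {..r}" using Op d by auto
      have dne: "d \<noteq> u r" "d \<noteq> u (r - 1)" using dp ur by metis+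
      \<comment> \<open>Three further neighbours, each given half of the entry at
        \<open>u r\<close>.\<close>
      define g where "g = (\<lambda>z. if z \<in> {a, b, d} then 6 else 0 :: real)"
      have g0: "\<And>z. g z \<ge> 0" by (simp add: g_def)
      have ge: "sum (?x g) Y \<le> app (?x g) z" if "Y \<subseteq> nbrs z" for Y z
        using xnn[OF g0] that by (rule app_ge)
      have "l \<ge> 2 + 1 / 192"
      proof (rule sup[of "{a, b, d}" g])
        show "25 \<le> app (?x g) (u r)"
          using ge[of "{u (r - 1), a, b, d}" "u r"] Nc 3 d ne dne xc(2)[of g]
            xO[OF ap(1), of g] xO[OF ap(2), of g] xO[OF dp, of g] by (simp add: g_def)
        fix z assume z: "z \<in> {a, b, d}"
        then have "u r \<in> nbrs z" using cO 3 d by auto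
        then show "2 * g z \<le> app (?x g) z"
          using z ge[of "{u r}" z] xc(1)[of g] by (auto simp: g_def)
      qed (use ap dp in \<open>auto simp: g_def card_insert_if\<close>)
      then show ?thesis by blast
    next
      case O: True
      show ?thesis
      proof (cases "(a, b) \<in> E")
        case True
        \<comment> \<open>A triangle carries the constant value 12, since each of its vertices has
          the other two as neighbours.\<close>
        define g where "g = (\<lambda>z. if z \<in> {a, b} then 12 else 0 :: real)"
        have g0: "\<And>z. g z \<ge> 0" by (simp add: g_def)
        have ge: "sum (?x g) Y \<le> app (?x g) z" if "Y \<subseteq> nbrs z" for Y z
        using xnn[OF g0] that by (rule app_ge)
        have adj: "b \<in> nbrs a" "a \<in> nbrs b" using True nbrs_sym by (auto simp: nbrs_def)
        have "l \<ge> 2 + 1 / 192"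
        proof (rule sup[of "{a, b}" g])
          show "25 \<le> app (?x g) (u r)"
            using ge[of "{u (r - 1), a, b}" "u r"] Nc 3 ne xc(2)[of g]
              xO[OF ap(1), of g] xO[OF ap(2), of g] by (simp add: g_def)
          fix z assume z: "z \<in> {a, b}"
          show "2 * g z \<le> app (?x g) z"
            using z ge[of "{u r, b}" a] ge[of "{u r, a}" b] xc(1)[of g] adj ac ne
              xO[OF ap(1), of g] xO[OF ap(2), of g] by (auto simp: g_def)
        qed (use ap in \<open>auto simp: g_def card_insert_if\<close>)
        then show ?thesis by blast
      next
        case nab: False
        then have nba: "(b, a) \<notin> E" using E_sym by (auto simp: sym_def)
        show ?thesis
        proof (cases "nbrs a = {u r} \<and> nbrs b = {u r}")
          case False
          then have "l \<ge> 2 + 1 / 192"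
            using spider[OF 3(1,2,3) nab] spider[OF 3(2,1) _ nba] 3(3) ac by blast
          then show ?thesis by blast
        next
          case leaf: True
          have all: "z \<in> insert a (insert b (u ` {..r}))" if "z < n" for z
          proof (rule closed_all[OF un[of 0] _ _ that])
            fix i assume "i \<in> insert a (insert b (u ` {..r}))"
            then consider "i = a \<or> i = b" | j where "j \<le> r" "i = u j" by auto
            then show "nbrs i \<subseteq> insert a (insert b (u ` {..r}))"
            proof cases
              case 1
              then show ?thesis using leaf by auto
            next
              case (2 j)
              then show ?thesis using path_closed[of j] Nc O by (cases "j = r") auto
            qed
          qed auto
          then have "{..<n} = insert a (insert b (u ` {..r}))" using un cO(2)[OF 3(1)] cO(2)[OF 3(2)] by auto
          then have "n = card (insert a (insert b (u ` {..r})))" by (metis card_lessThan)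
          then have n: "n = r + 3" using card_image[OF inj] ap 3(3) by simp
          \<comment> \<open>With \<open>n = r + 3\<close> the branch vertex \<open>n - 3\<close> of
            \<open>dynkin_D n\<close> is \<open>r\<close>, the path ends at
            \<open>a = f (n - 2)\<close>, and \<open>b = f (n - 1)\<close> is the additional
            leaf.\<close>
          define f where "f = (\<lambda>i. if i \<le> r then u i else if i = Suc r then a else b)"
          have "labels (dynkin_D n) f"
          proof (rule labelsI)
            fix i assume "i < n"
            then show "f i < n" using un cO(2)[OF 3(1)] cO(2)[OF 3(2)] by (auto simp: f_def)
          next
            fix z assume "z < n"
            then have "z \<in> insert a (insert b (u ` {..r}))" by (rule all)
            then consider "z = a" | "z = b" | i where "i \<le> r" "z = u i" by auto
            then show "z \<in> f ` {..<n}"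
            proof cases
              case 1
              then show ?thesis using n by (intro image_eqI[of _ _ "Suc r"]) (auto simp: f_def)
            next
              case 2
              then show ?thesis using n by (intro image_eqI[of _ _ "Suc (Suc r)"]) (auto simp: f_def)
            next
              case (3 i)
              then show ?thesis using n by (intro image_eqI[of _ _ i]) (auto simp: f_def)
            qed
          next
            fix i j assume ij: "i < n" "j < n"
            have uo: "u k \<noteq> a" "u k \<noteq> b" if "k \<le> r" for k using ap that by auto
            have Nr: "u k \<in> nbrs (u r) \<longleftrightarrow> Suc k = r" if "k \<le> r" for k
              using hanging_path_end[OF h that] pr that by (metis diff_Suc_1)
            have Na: "z \<in> nbrs (u k) \<longleftrightarrow> k = r" if "z \<in> {a, b}" "k \<le> r" for z k
              using that leaf nbrs_sym[of z "u k"] inj_onD[OF inj, of k r] by auto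
            have aa: "a \<notin> nbrs b" "b \<notin> nbrs a" "a \<notin> nbrs a" "b \<notin> nbrs b" using nab nba irrefl by (auto simp: nbrs_def)
            have Nu: "u k \<in> nbrs z \<longleftrightarrow> k = r" if "z \<in> {a, b}" "k \<le> r" for z k
              using Na[OF that] nbrs_sym by simp
            have D: "(i, j) \<in> parcs (dynkin_D n) \<longleftrightarrow>
               (j = Suc i \<and> j < r + 2) \<or> (i = Suc j \<and> i < r + 2) \<or> (i = r \<and> j = r + 2) \<or> (j = r \<and> i = r + 2)"
              using n by (auto simp: dynkin_D_def edges_sym_def)
            consider "i \<le> r" "j \<le> r" | "i \<le> r" "j = Suc r" | "i \<le> r" "j = r + 2" | "i = Suc r" "j \<le> r"
              | "i = r + 2" "j \<le> r" | "i > r" "j > r" using ij n by linarith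
            then show "f j \<in> nbrs (f i) \<longleftrightarrow> (i, j) \<in> parcs (dynkin_D n)"
            proof cases
              case 6
              then have "i = Suc r \<or> i = r + 2" "j = Suc r \<or> j = r + 2" using ij n by auto
              then show ?thesis unfolding D using aa by (auto simp: f_def)
            qed (unfold D, use arc_path[of i j] Na[of a i] Na[of b i] Nu[of a j] Nu[of b j] in \<open>auto simp: f_def\<close>)
          qed
          then show ?thesis by blast
        qed
      qed
    qed
  qed
qed

end

section \<open>Eigenvalues of the Dynkin diagrams\<close>

lemma sum_inverse_exists: "\<exists>t w :: complex. t * w = 1 \<and> \<mu> = t + w"
proof -
  define t where "t = (\<mu> + csqrt (\<mu>\<^sup>2 - 4)) / 2"
  have "(2 * t - \<mu>)\<^sup>2 = \<mu>\<^sup>2 - 4" by (simp add: t_def)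
  then have "4 * (t * (\<mu> - t)) = 4 * 1" by (simp add: power2_eq_square algebra_simps)
  then have "t * (\<mu> - t) = 1" by (simp only: mult_cancel_left) simp
  then show ?thesis by (intro exI[of _ t] exI[of _ "\<mu> - t"]) simp
qed

definition zeta_sum :: "complex \<Rightarrow> bool" where
  "zeta_sum \<mu> \<longleftrightarrow> (\<exists>\<zeta>. root_of_unity \<zeta> \<and> \<mu> = \<zeta> + inverse \<zeta>)"

lemma zeta_sumI:
  assumes "t * w = 1" "t ^ k = 1" "k > 0" shows "zeta_sum (t + w)"
proof -
  have "w = inverse t" using assms(1) by (simp add: inverse_unique)
  then show ?thesis using assms by (auto simp: zeta_sum_def root_of_unity_def)
qed

lemma zeta_sum_0: "zeta_sum 0"
  using zeta_sumI[of \<i> "- \<i>" 4] by (simp add: power4_eq_xxxx)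

text \<open>The factor \<open>t - w\<close> keeps the closed form valid when \<open>t = w\<close>,
  where its two solutions coincide.\<close>

lemma two_term_recursion:
  fixes u :: "nat \<Rightarrow> complex"
  assumes tw: "t * w = 1" and u1: "u 1 = (t + w) * u 0"
    and rec: "\<And>i. 0 < i \<Longrightarrow> i < N \<Longrightarrow> u (Suc i) = (t + w) * u i - u (i - 1)" and i: "i \<le> N" "N > 0"
  shows "u i * (t - w) = u 0 * (t ^ Suc i - w ^ Suc i)"
  using i(1)
proof (induction i rule: less_induct)
  case (less i)
  consider "i = 0" | "i = 1" | j where "i = Suc (Suc j)" by (metis One_nat_def not0_implies_Suc)
  then show ?case
  proof cases
    case 2
    then show ?thesis using u1 by (simp add: algebra_simps power2_eq_square)
  next
    case (3 j)
    have "u i = (t + w) * u (Suc j) - u j" using rec[of "Suc j"] 3 less.prems by simp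
    then have "u i * (t - w) = ((t + w) * u (Suc j) - u j) * (t - w)" by simp
    also have "\<dots> = (t + w) * (u (Suc j) * (t - w)) - u j * (t - w)"
      by (simp add: algebra_simps)
    also have "\<dots> = (t + w) * (u 0 * (t ^ Suc (Suc j) - w ^ Suc (Suc j))) - u 0 * (t ^ Suc j - w ^ Suc j)"
      using less.IH[of "Suc j"] less.IH[of j] 3 less.prems by simp
    also have "\<dots> = u 0 * (t ^ Suc i - w ^ Suc i) + u 0 * (t * w - 1) * (t ^ Suc j - w ^ Suc j)"
      unfolding 3 by (simp add: algebra_simps)
    finally show ?thesis using tw by simp
  qed simp
qed

text \<open>The equation at the last vertex turns the closed form into
  \<open>u 0 * (t ^ (n + 1) - w ^ (n + 1)) = 0\<close>. If \<open>u 0 = 0\<close>, a nonzero entry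
  forces \<open>t = w\<close>, so \<open>t\<close> squares to 1; otherwise \<open>t\<close> is a
  root of unity of order dividing \<open>2 * (n + 1)\<close>.\<close>

lemma dynkin_A_eigenvalues:
  fixes u :: "nat \<Rightarrow> complex"
  assumes n: "n \<ge> 2" and nz: "\<exists>i<n. u i \<noteq> 0"
    and eig: "\<And>i. i < n \<Longrightarrow> (\<Sum>j | j < n \<and> (i, j) \<in> parcs (dynkin_A n). u j) = \<mu> * u i"
  shows "zeta_sum \<mu>"
proof -
  obtain t w where tw: "t * w = 1" and \<mu>: "\<mu> = t + w" using sum_inverse_exists by blast
  have arc: "(i, j) \<in> parcs (dynkin_A n) \<longleftrightarrow> (j = Suc i \<or> i = Suc j) \<and> i < n \<and> j < n" for i j
    by (auto simp: dynkin_A_def edges_sym_def)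
  have "{j. j < n \<and> (0, j) \<in> parcs (dynkin_A n)} = {1}" using n by (auto simp: arc)
  then have u1: "u 1 = (t + w) * u 0" using eig[of 0] n \<mu> by simp
  have mid: "u (Suc i) = (t + w) * u i - u (i - 1)" if "0 < i" "i < n - 1" for i
  proof -
    have "{j. j < n \<and> (i, j) \<in> parcs (dynkin_A n)} = {i - 1, Suc i}" using that by (auto simp: arc)
    then show ?thesis using eig[of i] that \<mu> by (simp add: algebra_simps)
  qed
  have "{j. j < n \<and> (n - 1, j) \<in> parcs (dynkin_A n)} = {n - 2}" using n by (auto simp: arc)
  then have last: "u (n - 2) = (t + w) * u (n - 1)" using eig[of "n - 1"] n \<mu> by simp
  have ui: "u i * (t - w) = u 0 * (t ^ Suc i - w ^ Suc i)" if "i \<le> n - 1" for i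
    using two_term_recursion[OF tw u1 mid that] n by simp
  define m where "m = n - 2"
  have nm: "n - 1 = Suc m" "n - 2 = m" "n = Suc (Suc m)" using n by (auto simp: m_def)
  have "u m * (t - w) = (t + w) * (u (Suc m) * (t - w))" using last nm by simp
  then have "u 0 * (t ^ Suc m - w ^ Suc m) = (t + w) * (u 0 * (t ^ Suc (Suc m) - w ^ Suc (Suc m)))"
    using ui[of m] ui[of "Suc m"] nm by simp
  then have "u 0 * (t ^ Suc n - w ^ Suc n) + u 0 * (t * w - 1) * (t ^ Suc m - w ^ Suc m) = 0"
    unfolding nm by (simp add: algebra_simps)
  then have "u 0 * (t ^ Suc n - w ^ Suc n) = 0" using tw by simp
  then consider "u 0 = 0" | "t ^ Suc n = w ^ Suc n" by auto
  then show ?thesis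
  proof cases
    case 1
    obtain i where i: "i < n" "u i \<noteq> 0" using nz by blast
    then have "t = w" using ui[of i] 1 by auto
    then show ?thesis using zeta_sumI[OF tw, of 2] tw \<mu> by (simp add: power2_eq_square)
  next
    case 2
    have "t ^ (Suc n + Suc n) = t ^ Suc n * w ^ Suc n" unfolding power_add using 2 by simp
    also have "\<dots> = 1" using tw by (metis power_mult_distrib power_one)
    finally show ?thesis unfolding \<mu> by (rule zeta_sumI[OF tw]) simp
  qed
qed

text \<open>The boundary condition at the fork of type D, factored: both sides differ by a multiple
  of \<open>1 - t * w\<close>.\<close>

lemma fork_identity:
  fixes t w T W :: "'a :: comm_ring_1"
  assumes "t * w = 1"
  shows "2 * (t * T - w * W) - (t + w) * ((t + w) * (t * T - w * W) - (T - W)) =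
    - (t - w) * (t * t * T + w * w * W)"
proof -
  have "2 * (t * T - w * W) - (t + w) * ((t + w) * (t * T - w * W) - (T - W)) =
    - (t - w) * (t * t * T + w * w * W) + (1 - t * w) * (2 * (t * T - w * W) + (t + w) * (T - W))"
    by (simp add: algebra_simps)
  then show ?thesis using assms by simp
qed

lemma dynkin_D_eigenvalues:
  fixes u :: "nat \<Rightarrow> complex"
  assumes n: "n \<ge> 5" and nz: "\<exists>i<n. u i \<noteq> 0"
    and eig: "\<And>i. i < n \<Longrightarrow> (\<Sum>j | j < n \<and> (i, j) \<in> parcs (dynkin_D n). u j) = \<mu> * u i"
  shows "zeta_sum \<mu>"
proof -
  obtain t w where tw: "t * w = 1" and \<mu>: "\<mu> = t + w" using sum_inverse_exists by blast
  define r where "r = n - 4"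
  have nr: "n = r + 4" and r: "r > 0" using n by (auto simp: r_def)
  have arc: "(i, j) \<in> parcs (dynkin_D n) \<longleftrightarrow>
      (j = Suc i \<and> j < r + 3) \<or> (i = Suc j \<and> i < r + 3) \<or> (i = r + 1 \<and> j = r + 3) \<or> (j = r + 1 \<and> i = r + 3)" for i j
    by (auto simp: dynkin_D_def edges_sym_def nr)
  note arc = arc[unfolded nr]
  have "{j. j < n \<and> (0, j) \<in> parcs (dynkin_D n)} = {1}" using r by (auto simp: arc nr)
  then have u1: "u 1 = (t + w) * u 0" using eig[of 0] n \<mu> by simp
  have mid: "u (Suc i) = (t + w) * u i - u (i - 1)" if "0 < i" "i < r + 1" for i
  proof -
    have "{j. j < n \<and> (i, j) \<in> parcs (dynkin_D n)} = {i - 1, Suc i}" using that by (auto simp: arc nr)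
    then show ?thesis using eig[of i] that \<mu> nr by (simp add: algebra_simps)
  qed
  have "{j. j < n \<and> (r + 1, j) \<in> parcs (dynkin_D n)} = {r, r + 2, r + 3}" by (auto simp: arc nr)
  then have a: "u (r + 2) + u (r + 3) = (t + w) * u (r + 1) - u r" using eig[of "r + 1"] \<mu> nr by (simp add: algebra_simps)
  have "{j. j < n \<and> (r + 2, j) \<in> parcs (dynkin_D n)} = {r + 1}" by (auto simp: arc nr)
  then have b: "u (r + 1) = (t + w) * u (r + 2)" using eig[of "r + 2"] \<mu> nr by simp
  have "{j. j < n \<and> (r + 3, j) \<in> parcs (dynkin_D n)} = {r + 1}" by (auto simp: arc nr)
  then have c: "u (r + 1) = (t + w) * u (r + 3)" using eig[of "r + 3"] \<mu> nr by simp
  have ui: "u i * (t - w) = u 0 * (t ^ Suc i - w ^ Suc i)" if "i \<le> r + 1" for i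
    using two_term_recursion[OF tw u1 mid that] by simp
  define T W where "T = t ^ Suc r" and "W = w ^ Suc r"
  have ur: "u r * (t - w) = u 0 * (T - W)" "u (r + 1) * (t - w) = u 0 * (t * T - w * W)"
    using ui[of r] ui[of "r + 1"] by (simp_all add: T_def W_def)
  have "2 * u (r + 1) = (t + w) * ((t + w) * u (r + 1) - u r)" using a b c by (metis distrib_left mult_2)
  then have "2 * u (r + 1) * (t - w) = (t + w) * ((t + w) * u (r + 1) - u r) * (t - w)" by simp
  then have "2 * (u (r + 1) * (t - w)) = (t + w) * ((t + w) * (u (r + 1) * (t - w)) - u r * (t - w))"
    by (simp only: mult.assoc left_diff_distrib[of _ _ "t - w"])
  then have "u 0 * (2 * (t * T - w * W) - (t + w) * ((t + w) * (t * T - w * W) - (T - W))) = 0"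
    unfolding ur by (simp add: algebra_simps)
  then have "u 0 * (- (t - w) * (t * t * T + w * w * W)) = 0" unfolding fork_identity[OF tw] .
  then consider "t = w" | "u 0 = 0" "t \<noteq> w" | "t * t * T + w * w * W = 0" by auto
  then show ?thesis
  proof cases
    case 1
    then show ?thesis using zeta_sumI[OF tw, of 2] tw \<mu> by (simp add: power2_eq_square)
  next
    case 2
    have z: "u i = 0" if "i \<le> r + 1" for i using ui[OF that] 2 by simp
    \<comment> \<open>The vector vanishes on the path, so it lives on the two leaves only, which
      forces the eigenvalue 0.\<close>
    have "\<mu> = 0"
    proof (rule ccontr)
      assume "\<mu> \<noteq> 0"
      then have "u (r + 2) = 0" "u (r + 3) = 0" using b c z[of "r + 1"] \<mu> by auto
      then have "u i = 0" if "i < n" for i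
      proof -
        have "i \<le> r + 1 \<or> i = r + 2 \<or> i = r + 3" using that nr by linarith
        then show ?thesis using z[of i] \<open>u (r + 2) = 0\<close> \<open>u (r + 3) = 0\<close> by blast
      qed
      then show False using nz by blast
    qed
    then show ?thesis using zeta_sum_0 by simp
  next
    case 3
    define x y where "x = t ^ (r + 3)" and "y = w ^ (r + 3)"
    have "x = t * t * T" "y = w * w * W" unfolding x_def y_def T_def W_def
      by (simp_all add: power_add power3_eq_cube)
    then have "x = - y" using 3 by (simp only: add_eq_0_iff2)
    moreover have "x * y = 1" unfolding x_def y_def using tw by (metis power_mult_distrib power_one)
    ultimately have "(x * x) * (x * x) = 1" by (metis minus_mult_minus minus_minus mult_minus_left mult_1)
    then have "t ^ ((r + 3) + (r + 3) + ((r + 3) + (r + 3))) = 1"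
      unfolding x_def by (simp only: power_add)
    then show ?thesis unfolding \<mu> by (rule zeta_sumI[OF tw]) simp
  qed
qed

section \<open>The graphs with a tail\<close>

lemma graph_isoI:
  fixes G H :: "nat pair_pre_digraph"
  assumes G: "pair_graph G" and f: "bij_betw f (pverts H) (pverts G)"
    and arcs: "\<And>i j. i \<in> pverts H \<Longrightarrow> j \<in> pverts H \<Longrightarrow> (f i, f j) \<in> parcs G \<longleftrightarrow> (i, j) \<in> parcs H"
    and H: "parcs H \<subseteq> pverts H \<times> pverts H"
  shows "graph_iso G H"
proof -
  interpret G: pair_graph G by fact
  define g where "g = inv_into (pverts H) f"
  have gb: "bij_betw g (pverts G) (pverts H)" unfolding g_def using f by (rule bij_betw_inv_into)
  have fg: "f (g x) = x" if "x \<in> pverts G" for x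
    using f that by (simp add: g_def bij_betw_inv_into_right)
  have gf: "g (f x) = x" if "x \<in> pverts H" for x
    using f that by (simp add: g_def bij_betw_inv_into_left)
  have gv: "g x \<in> pverts H" if "x \<in> pverts G" for x using gb that by (auto simp: bij_betw_def)
  have fv: "f x \<in> pverts G" if "x \<in> pverts H" for x using f that by (auto simp: bij_betw_def)
  define hom where "hom = \<lparr>iso_verts = g, iso_arcs = map_prod g g, iso_head = snd, iso_tail = fst\<rparr>"
  have inG: "x \<in> pverts G \<and> y \<in> pverts G" if "(x, y) \<in> parcs G" for x y
    using G.in_arcsD1[OF that] G.in_arcsD2[OF that] by auto
  have inj: "inj_on g (pverts G)" using gb by (simp add: bij_betw_def)
  have wf: "wf_digraph (with_proj G)" by unfold_locales
  have "pre_digraph.digraph_isomorphism (with_proj G) hom"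
    unfolding pre_digraph.digraph_isomorphism_def
  proof (intro conjI wf)
    show "inj_on (iso_arcs hom) (arcs (with_proj G))"
    proof (rule inj_onI)
      fix e e' assume "e \<in> arcs (with_proj G)" "e' \<in> arcs (with_proj G)" "iso_arcs hom e = iso_arcs hom e'"
      then show "e = e'" using inG inj_onD[OF inj] by (cases e; cases e') (auto simp: hom_def)
    qed
  qed (use inj in \<open>auto simp: hom_def\<close>)
  moreover have "with_proj H = app_iso hom (with_proj G)"
  proof -
    have "pverts H = g ` pverts G" using gb by (simp add: bij_betw_def)
    moreover have "parcs H = map_prod g g ` parcs G"
    proof (intro equalityI subsetI)
      fix e assume e: "e \<in> parcs H"
      obtain i j where ij: "e = (i, j)" "i \<in> pverts H" "j \<in> pverts H" using H e by (cases e) auto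
      then have "(f i, f j) \<in> parcs G" using arcs e by simp
      then show "e \<in> map_prod g g ` parcs G" using ij gf by (intro image_eqI[of _ _ "(f i, f j)"]) auto
    next
      fix e assume "e \<in> map_prod g g ` parcs G"
      then obtain x y where xy: "(x, y) \<in> parcs G" "e = (g x, g y)" by auto
      then have v: "x \<in> pverts G" "y \<in> pverts G" using inG by auto
      show "e \<in> parcs H" using arcs[OF gv[OF v(1)] gv[OF v(2)]] fg v xy by simp
    qed
    ultimately show ?thesis by (simp add: app_iso_def hom_def with_proj_def)
  qed
  ultimately show ?thesis unfolding graph_iso_def digraph_iso_def by blast
qed

lemma eigenvalue_nat_mat:
  "eigenvalue (nat_mat n a) \<mu> \<longleftrightarrow>
    (\<exists>z. (\<exists>i<n. z i \<noteq> 0) \<and> (\<forall>i<n. (\<Sum>j<n. a i j * z j) = \<mu> * (z i :: complex)))"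
proof
  assume "eigenvalue (nat_mat n a) \<mu>"
  then obtain x where x: "x \<in> carrier_vec n" "x \<noteq> 0\<^sub>v n" "nat_mat n a *\<^sub>v x = \<mu> \<cdot>\<^sub>v x"
    by (auto simp: eigenvalue_def eigenvector_def nat_mat_def)
  have "\<exists>i<n. x $ i \<noteq> 0"
  proof (rule ccontr)
    assume "\<not> ?thesis"
    then have "x = 0\<^sub>v n" using x(1) by (intro eq_vecI) auto
    then show False using x(2) by simp
  qed
  moreover have "(\<Sum>j<n. a i j * x $ j) = \<mu> * x $ i" if "i < n" for i
  proof -
    have "(nat_mat n a *\<^sub>v x) $ i = (\<Sum>j<n. a i j * x $ j)"
      using that x(1) by (simp add: nat_mat_def scalar_prod_def atLeast0LessThan)
    then show ?thesis using x that by simp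
  qed
  ultimately show "\<exists>z. (\<exists>i<n. z i \<noteq> 0) \<and> (\<forall>i<n. (\<Sum>j<n. a i j * z j) = \<mu> * z i)"
    by (intro exI[of _ "\<lambda>i. x $ i"]) simp
next
  assume "\<exists>z. (\<exists>i<n. z i \<noteq> 0) \<and> (\<forall>i<n. (\<Sum>j<n. a i j * z j) = \<mu> * z i)"
  then obtain z i where z: "i < n" "z i \<noteq> 0" "\<forall>i<n. (\<Sum>j<n. a i j * z j) = \<mu> * z i" by blast
  have "eigenvector (nat_mat n a) (Matrix.vec n z) \<mu>"
    unfolding eigenvector_def
  proof (intro conjI)
    show "Matrix.vec n z \<noteq> 0\<^sub>v (dim_row (nat_mat n a))"
    proof
      assume "Matrix.vec n z = 0\<^sub>v (dim_row (nat_mat n a))"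
      then have "Matrix.vec n z $ i = 0\<^sub>v n $ i" by (simp add: nat_mat_def)
      then show False using z by simp
    qed
    show "nat_mat n a *\<^sub>v Matrix.vec n z = \<mu> \<cdot>\<^sub>v Matrix.vec n z"
      using z(3) by (intro eq_vecI) (simp_all add: nat_mat_def scalar_prod_def atLeast0LessThan)
  qed (simp add: nat_mat_def)
  then show "eigenvalue (nat_mat n a) \<mu>" by (auto simp: eigenvalue_def)
qed

locale tail_graph =
  fixes \<Gamma> :: "nat pair_pre_digraph" and v k :: nat
  assumes pg: "pair_graph \<Gamma>" and co: "Digraph_Component.connected (with_proj \<Gamma>)"
    and pv: "pverts \<Gamma> = {..<k}" and v: "v < k"
begin

lemma card_k: "card (pverts \<Gamma>) = k"
  by (simp add: pv)

text \<open>The graph with an infinite tail. All graphs of the family are its restrictions to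
  initial segments of the vertices, so their matrices are corners of the single matrix
  \<open>ent\<close> and \<open>char_poly_leaf\<close> relates consecutive ones.\<close>

definition arcs_inf :: "nat rel" where
  "arcs_inf = parcs \<Gamma> \<union> edges_sym {(v, k)} \<union> edges_sym {(w, Suc w) | w. k \<le> w}"

definition ent :: "nat \<Rightarrow> nat \<Rightarrow> int" where "ent i j = (if (i, j) \<in> arcs_inf then 1 else 0)"

definition P :: "nat \<Rightarrow> int poly" where "P m = char_poly (nat_mat (k + m) ent)"

lemma arc_\<Gamma>: "(i, j) \<in> parcs \<Gamma> \<Longrightarrow> i < k \<and> j < k \<and> i \<noteq> j \<and> (j, i) \<in> parcs \<Gamma>"
proof -
  interpret pair_graph \<Gamma> by (rule pg)
  assume ij: "(i, j) \<in> parcs \<Gamma>"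
  show ?thesis
    using in_arcsD1[OF ij] in_arcsD2[OF ij] pair_no_loops[OF ij] pv pair_sym_arcs ij
    by (auto simp: symmetric_def dest: symD)
qed

lemma parcs_add_path:
  "(i, j) \<in> parcs (add_path \<Gamma> v m) \<longleftrightarrow> i < k + m \<and> j < k + m \<and> (i, j) \<in> arcs_inf"
  using arc_\<Gamma>[of i j] v by (auto simp: add_path_def Let_def card_k arcs_inf_def edges_sym_def)

lemma pverts_add_path: "pverts (add_path \<Gamma> v m) = {..<k + m}"
  by (auto simp: add_path_def Let_def card_k pv)

lemma pair_graph_path: "pair_graph (add_path \<Gamma> v m)"
  using pair_graph_add_path[OF pg] pv v card_k by simp

lemma arcs_inf_sym: "(i, j) \<in> arcs_inf \<Longrightarrow> (j, i) \<in> arcs_inf"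
  using arc_\<Gamma> by (auto simp: arcs_inf_def edges_sym_def)

lemma arcs_inf_irrefl: "(i, i) \<notin> arcs_inf"
  using arc_\<Gamma>[of i i] v by (auto simp: arcs_inf_def edges_sym_def)

lemma adjacency_matrix_path: "adjacency_matrix (add_path \<Gamma> v m) = nat_mat (k + m) (\<lambda>i j. of_int (ent i j))"
  unfolding adjacency_matrix_def Let_def pverts_add_path nat_mat_def
  by (rule eq_matI) (auto simp: ent_def parcs_add_path)

lemma char_poly_path: "char_poly (adjacency_matrix (add_path \<Gamma> v m)) = map_poly of_int (P m)"
proof -
  have "nat_mat (k + m) (\<lambda>i j. of_int (ent i j)) = (map_mat of_int (nat_mat (k + m) ent) :: complex mat)"
    by (rule eq_matI) (auto simp: nat_mat_def)
  then show ?thesis unfolding adjacency_matrix_path P_def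
    using of_int_hom.char_poly_hom[of "nat_mat (k + m) ent" "k + m"] by simp
qed

lemma P_rec: "P (Suc (Suc m)) = [:0, 1:] * P (Suc m) - P m"
proof -
  have "ent (Suc (k + m)) j = (if j = k + m then 1 else 0)" "ent j (Suc (k + m)) = (if j = k + m then 1 else 0)"
    if "j \<le> Suc (k + m)" for j
    using that v arc_\<Gamma>[of "Suc (k + m)" j] arc_\<Gamma>[of j "Suc (k + m)"]
    by (auto simp: ent_def arcs_inf_def edges_sym_def)
  from char_poly_leaf[of "k + m" ent, OF this] show ?thesis by (simp add: P_def)
qed

lemma P_monic: "lead_coeff (P m) = 1" and P_degree: "degree (P m) = k + m"
  using degree_monic_char_poly[of "nat_mat (k + m) ent" "k + m"] by (auto simp: P_def)

lemma conn_path: "simple_conn_graph (k + m) (parcs (add_path \<Gamma> v m))"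
proof
  let ?E = "parcs (add_path \<Gamma> v m)"
  interpret G: pair_graph \<Gamma> by (rule pg)
  show "k + m > 0" using v by simp
  show "?E \<subseteq> {..<k + m} \<times> {..<k + m}" using parcs_add_path by auto
  show sym: "sym ?E" using arcs_inf_sym parcs_add_path by (auto simp: sym_def)
  show "(i, i) \<notin> ?E" for i using arcs_inf_irrefl parcs_add_path by auto
  have base: "(i, j) \<in> ?E\<^sup>*" if "i < k" "j < k" for i j
  proof -
    have "i \<rightarrow>\<^sup>*\<^bsub>mk_symmetric (with_proj \<Gamma>)\<^esub> j"
      using co that pv unfolding Digraph_Component.connected_def strongly_connected_def by simp
    then have "(i, j) \<in> (parcs (mk_symmetric (with_proj \<Gamma>)))\<^sup>*"
      unfolding reachable_def by (simp add: rtrancl_on_rtranclI)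
    moreover have "parcs (mk_symmetric (with_proj \<Gamma>)) \<subseteq> ?E"
    proof (rule subrelI)
      fix a b assume "(a, b) \<in> parcs (mk_symmetric (with_proj \<Gamma>))"
      then have "(a, b) \<in> parcs \<Gamma>" using arc_\<Gamma> by (auto simp: parcs_mk_symmetric)
      then show "(a, b) \<in> ?E" using arc_\<Gamma>[of a b] by (simp add: parcs_add_path arcs_inf_def)
    qed
    ultimately show ?thesis using rtrancl_mono by blast
  qed
  have tov: "(i, v) \<in> ?E\<^sup>*" if "i < k + m" for i
    using that
  proof (induction i rule: less_induct)
    case (less i)
    consider "i < k" | "i = k" | "i > k" by linarith
    then show ?case
    proof cases
      case 1
      then show ?thesis using base v by simp
    next
      case 2
      then have "(i, v) \<in> ?E" using less.prems v by (auto simp: parcs_add_path arcs_inf_def edges_sym_def)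
      then show ?thesis by blast
    next
      case 3
      then have "(i, i - 1) \<in> arcs_inf" unfolding arcs_inf_def edges_sym_def
        by (intro UnI2) (auto intro!: exI[of _ "i - 1"])
      then have "(i, i - 1) \<in> ?E" using less.prems by (auto simp: parcs_add_path)
      moreover have "(i - 1, v) \<in> ?E\<^sup>*" using less 3 by auto
      ultimately show ?thesis by (rule converse_rtrancl_into_rtrancl)
    qed
  qed
  show "(i, j) \<in> ?E\<^sup>*" if "i < k + m" "j < k + m" for i j
    using rtrancl_trans[OF tov[OF that(1)]] tov[OF that(2)] sym_rtrancl[OF sym] by (blast dest: symD)
qed

lemma dynkin_case:
  assumes lab: "simple_conn_graph.labels (k + m) (parcs (add_path \<Gamma> v m)) H f"
    and H: "parcs H \<subseteq> pverts H \<times> pverts H" "pverts H = {..<k + m}"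
    and spec: "\<And>u \<mu>. (\<exists>i<k + m. u i \<noteq> 0) \<Longrightarrow>
      (\<And>i. i < k + m \<Longrightarrow> (\<Sum>j | j < k + m \<and> (i, j) \<in> parcs H. u j) = \<mu> * u i) \<Longrightarrow> zeta_sum \<mu>"
  shows "graph_iso (add_path \<Gamma> v m) H" "eigenvalue (adjacency_matrix (add_path \<Gamma> v m)) \<mu> \<Longrightarrow> zeta_sum \<mu>"
proof -
  let ?n = "k + m"
  interpret simple_conn_graph ?n "parcs (add_path \<Gamma> v m)" by (rule conn_path)
  have f: "bij_betw f {..<?n} {..<?n}"
    and arcs: "\<And>i j. i < ?n \<Longrightarrow> j < ?n \<Longrightarrow> (f i, f j) \<in> parcs (add_path \<Gamma> v m) \<longleftrightarrow> (i, j) \<in> parcs H"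
    using lab by (auto simp: labels_def)
  show "graph_iso (add_path \<Gamma> v m) H"
    by (rule graph_isoI[OF pair_graph_path _ _ H(1), of f]) (use f arcs H(2) in \<open>simp_all add: pverts_add_path\<close>)
  assume "eigenvalue (adjacency_matrix (add_path \<Gamma> v m)) \<mu>"
  then obtain z i0 where z: "i0 < ?n" "z i0 \<noteq> 0"
    and eq: "\<And>i. i < ?n \<Longrightarrow> (\<Sum>j<?n. of_int (ent i j) * z j) = \<mu> * z i"
    unfolding adjacency_matrix_path eigenvalue_nat_mat by blast
  have fn: "f i < ?n" if "i < ?n" for i using f that by (auto simp: bij_betw_def)
  show "zeta_sum \<mu>"
  proof (rule spec[of "\<lambda>i. z (f i)"])
    obtain i where "i < ?n" "f i = i0" using f z by (metis bij_betw_imp_surj_on imageE lessThan_iff)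
    then show "\<exists>i<?n. z (f i) \<noteq> 0" using z by auto
    fix i assume i: "i < ?n"
    have "(\<Sum>j | j < ?n \<and> (i, j) \<in> parcs H. z (f j)) = (\<Sum>j\<in>{j\<in>{..<?n}. (i, j) \<in> parcs H}. z (f j))"
      by (rule sum.cong) auto
    also have "\<dots> = (\<Sum>j<?n. if (i, j) \<in> parcs H then z (f j) else 0)"
      by (rule sum.inter_filter) simp
    also have "\<dots> = (\<Sum>j<?n. of_int (ent (f i) (f j)) * z (f j))"
    proof (rule sum.cong[OF refl])
      fix j assume "j \<in> {..<?n}"
      then show "(if (i, j) \<in> parcs H then z (f j) else 0) = of_int (ent (f i) (f j)) * z (f j)"
        using arcs[of i j] i fn by (simp add: ent_def parcs_add_path)
    qed
    also have "\<dots> = (\<Sum>j<?n. of_int (ent (f i) j) * z j)"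
      by (rule sum.reindex_bij_betw[OF f])
    also have "\<dots> = \<mu> * z (f i)" using eq fn i by simp
    finally show "(\<Sum>j | j < ?n \<and> (i, j) \<in> parcs H. z (f j)) = \<mu> * z (f i)" .
  qed
qed

text \<open>The whole tail with \<open>v\<close> is a hanging path, long enough for
  \<open>classification\<close>. The last conjunct of the second case is there to make the invariant
  \<open>Y\<close> nonzero at \<open>l\<close>.\<close>

theorem graph_dichotomy:
  assumes m: "m \<ge> 12"
  shows "((\<forall>\<mu>. eigenvalue (adjacency_matrix (add_path \<Gamma> v m)) \<mu> \<longrightarrow> zeta_sum \<mu>) \<and>
      (graph_iso (add_path \<Gamma> v m) (dynkin_A (k + m)) \<or> graph_iso (add_path \<Gamma> v m) (dynkin_D (k + m)))) \<or>
    (\<exists>l :: real. l \<ge> 2 + 1 / 192 \<and> eigenvalue (adjacency_matrix (add_path \<Gamma> v m)) l \<and>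
      Polynomial.order (complex_of_real l) (char_poly (adjacency_matrix (add_path \<Gamma> v m))) = 1 \<and>
      poly (map_poly of_int (P (m - 1))) (complex_of_real l) \<noteq> 0)"
proof -
  let ?n = "k + m"
  let ?E = "parcs (add_path \<Gamma> v m)"
  interpret simple_conn_graph ?n ?E by (rule conn_path)
  have adj: "adj i j = of_int (ent i j)" if "i < ?n" "j < ?n" for i j
    using that by (simp add: adj_def ent_def parcs_add_path)
  obtain l w where w: "\<And>i. i < ?n \<Longrightarrow> w i > 0" "\<And>i. i < ?n \<Longrightarrow> app w i = l * w i"
    and ray: "\<And>x. inn x (app x) \<le> l * inn x x"
    by (rule perron_frobenius) blast
  \<comment> \<open>The tail read from its free end, ending at \<open>v\<close>.\<close>
  define u where "u = (\<lambda>i. if i < m then k + m - 1 - i else v)"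
  have nb: "nbrs i = {j. i < ?n \<and> j < ?n \<and> (i, j) \<in> arcs_inf}" for i
    by (auto simp: nbrs_def parcs_add_path)
  have hp: "hanging_path u m"
    unfolding hanging_path_def
  proof (intro conjI allI impI)
    show "m > 0" using m by simp
    show "inj_on u {..m}" using v by (auto simp: inj_on_def u_def)
    show "u i < ?n" if "i \<le> m" for i using that v by (auto simp: u_def)
    show "nbrs (u 0) = {u 1}"
    proof -
      have u01: "u 0 = Suc (k + m - 2)" "u 1 = k + m - 2" "k + m - 2 \<ge> k" using m by (auto simp: u_def)
      then show ?thesis using v m arc_\<Gamma>[of "u 0"] by (auto simp: nb arcs_inf_def edges_sym_def)
    qed
    fix i assume i: "0 < i \<and> i < m"
    show "nbrs (u i) = {u (i - 1), u (Suc i)}"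
    proof (cases "Suc i = m")
      case True
      then have "u i = k" "u (Suc i) = v" "u (i - 1) = Suc k" using i m by (auto simp: u_def)
      then show ?thesis using v m arc_\<Gamma>[of k] by (auto simp: nb arcs_inf_def edges_sym_def)
    next
      case False
      define q where "q = k + m - 2 - i"
      have "u i = Suc q" "u (Suc i) = q" "u (i - 1) = Suc (Suc q)" "k \<le> q" "Suc (Suc q) < k + m" using False i by (auto simp: u_def q_def)
      then show ?thesis using v m arc_\<Gamma>[of "Suc q"] by (auto simp: nb arcs_inf_def edges_sym_def)
    qed
  qed
  from classification[OF ray hp m]
  consider f where "labels (dynkin_A ?n) f" | f where "labels (dynkin_D ?n) f" | "l \<ge> 2 + 1 / 192" by blast
  then show ?thesis
  proof cases
    case (1 f)
    have "parcs (dynkin_A ?n) \<subseteq> pverts (dynkin_A ?n) \<times> pverts (dynkin_A ?n)" "pverts (dynkin_A ?n) = {..<?n}"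
      by (auto simp: dynkin_A_def edges_sym_def)
    from dynkin_case[OF 1 this] show ?thesis using dynkin_A_eigenvalues[of ?n] m by auto
  next
    case (2 f)
    have "parcs (dynkin_D ?n) \<subseteq> pverts (dynkin_D ?n) \<times> pverts (dynkin_D ?n)" "pverts (dynkin_D ?n) = {..<?n}"
      using m by (auto simp: dynkin_D_def edges_sym_def)
    from dynkin_case[OF 2 this] show ?thesis using dynkin_D_eigenvalues[of ?n] m by auto
  next
    case 3
    let ?w = "\<lambda>i. complex_of_real (w i)"
    have eqw: "(\<Sum>j<?n. of_int (ent i j) * ?w j) = complex_of_real l * ?w i" if i: "i < ?n" for i
    proof -
      have "(\<Sum>j<?n. of_int (ent i j) * ?w j) = complex_of_real (\<Sum>j<?n. adj i j * w j)"
        using adj i by (simp add: of_real_sum)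
      also have "(\<Sum>j<?n. adj i j * w j) = l * w i" using w(2)[OF i] by (simp add: app_def)
      finally show ?thesis by simp
    qed
    have zero: "z i = 0"
      if A: "A \<subseteq> {..<?n}" "\<And>i. i \<in> A \<Longrightarrow> (\<Sum>j\<in>A. of_int (ent i j) * z j) = complex_of_real l * z i"
        "i0 < ?n" "i0 \<in> A \<Longrightarrow> z i0 = 0" "i \<in> A" for A z i0 i
    proof -
      have "(\<Sum>j\<in>A. (if (i, j) \<in> ?E then 1 else 0) * z j) = complex_of_real l * z i" if i: "i \<in> A" for i
      proof -
        have "(\<Sum>j\<in>A. (if (i, j) \<in> ?E then 1 else 0) * z j) = (\<Sum>j\<in>A. of_int (ent i j) * z j)"
          using A(1) i by (intro sum.cong) (auto simp: ent_def parcs_add_path)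
        then show ?thesis using A(2)[OF i] by simp
      qed
      then show ?thesis
        using subgraph_eigenvector_zero[of w l A ?E z i0 i] w A by blast
    qed
    have ev: "eigenvalue (adjacency_matrix (add_path \<Gamma> v m)) l"
      unfolding adjacency_matrix_path eigenvalue_nat_mat
    proof (intro exI[of _ ?w] conjI)
      show "\<exists>i<?n. ?w i \<noteq> 0" using w(1)[of v] v by (intro exI[of _ v]) auto
    qed (use eqw in auto)
    define N where "N = ?n - 1"
    have N: "?n = Suc N" using v by (simp add: N_def)
    have "Polynomial.order (complex_of_real l) (char_poly (nat_mat ?n (\<lambda>i j. of_int (ent i j)))) = 1"
    proof (rule order_char_poly_simple[OF N, of _ ?w])
      show "complex_of_int (ent i j) = complex_of_int (ent j i)" for i j
        using arcs_inf_sym by (auto simp: ent_def)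
      have "w N > 0" using w(1) N by simp
      then show "?w N \<noteq> 0" by simp
      have "(\<Sum>i<?n. w i * w i) > 0" using w(1) v by (intro sum_pos2[of _ v]) (auto simp: less_imp_le)
      moreover have "(\<Sum>i<?n. ?w i * ?w i) = complex_of_real (\<Sum>i<?n. w i * w i)" by simp
      ultimately show "(\<Sum>i<?n. ?w i * ?w i) \<noteq> 0" by (metis less_irrefl of_real_eq_0_iff)
      show "z i = 0" if "\<And>i. i < ?n \<Longrightarrow> (\<Sum>j<?n. of_int (ent i j) * z j) = complex_of_real l * z i" "z N = 0" "i < ?n" for z i
        by (rule zero[of "{..<?n}" z N]) (use that N in auto)
    qed (use eqw in auto)
    then have ord: "Polynomial.order (complex_of_real l) (char_poly (adjacency_matrix (add_path \<Gamma> v m))) = 1"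
      by (simp add: adjacency_matrix_path)
    \<comment> \<open>Without its last vertex the graph is a proper subgraph: an eigenvector for
      \<open>l\<close> would give a supersolution that vanishes at the removed vertex.\<close>
    have "poly (map_poly of_int (P (m - 1))) (complex_of_real l) \<noteq> 0"
    proof
      assume "poly (map_poly of_int (P (m - 1))) (complex_of_real l) = 0"
      then have "poly (char_poly (adjacency_matrix (add_path \<Gamma> v (m - 1)))) (complex_of_real l) = 0"
        by (simp add: char_poly_path)
      then have "eigenvalue (adjacency_matrix (add_path \<Gamma> v (m - 1))) (complex_of_real l)"
        by (subst eigenvalue_root_char_poly[of _ "k + (m - 1)"]) (auto simp: adjacency_matrix_path)
      then obtain z i where z: "i < k + (m - 1)" "z i \<noteq> 0"
        "\<And>i. i < k + (m - 1) \<Longrightarrow> (\<Sum>j<k + (m - 1). of_int (ent i j) * z j) = complex_of_real l * z i"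
        unfolding adjacency_matrix_path eigenvalue_nat_mat by blast
      have "z i = 0"
        by (rule zero[of "{..<k + (m - 1)}" z "?n - 1"]) (use z m in auto)
      then show False using z by simp
    qed
    then show ?thesis using 3 ev ord by blast
  qed
qed

end

section \<open>The characteristic polynomials of the graphs with a tail\<close>

lemma poly_eqI_nonzero:
  fixes p q :: "complex poly"
  assumes "\<And>t. t \<noteq> 0 \<Longrightarrow> poly p t = poly q t"
  shows "p = q"
proof (rule ccontr)
  assume "p \<noteq> q"
  then have "finite {t. poly (p - q) t = 0}" by (intro poly_roots_finite) simp
  moreover have "UNIV - {0} \<subseteq> {t. poly (p - q) t = 0}" using assms by auto
  ultimately have "finite (UNIV - {0 :: complex})" by (metis finite_subset)
  then show False using infinite_UNIV_char_0[where 'a = complex] by simp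
qed

text \<open>The polynomial \<open>t ^ n * p(t + 1/t)\<close>, written with \<open>1 + t * t\<close>
  and \<open>t\<close> so that it makes sense over every commutative ring.\<close>

definition hat :: "nat \<Rightarrow> 'a :: comm_ring_1 poly \<Rightarrow> 'a poly" where
  "hat n p = (\<Sum>i\<le>n. smult (coeff p i) ([:1, 0, 1:] ^ i * [:0, 1:] ^ (n - i)))"

lemma poly_as_sum_le: "degree p \<le> n \<Longrightarrow> poly p x = (\<Sum>i\<le>n. coeff p i * x ^ i)"
  for p :: "'a :: comm_ring_1 poly"
proof -
  assume "degree p \<le> n"
  then show ?thesis unfolding poly_altdef by (intro sum.mono_neutral_left) (auto simp: coeff_eq_0)
qed

lemma poly_hat:
  fixes t w :: "'a :: comm_ring_1"
  assumes tw: "t * w = 1" and d: "degree p \<le> n"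
  shows "poly (hat n p) t = t ^ n * poly p (t + w)"
proof -
  have "(1 + t * t) ^ i * t ^ (n - i) = t ^ n * (t + w) ^ i" if "i \<le> n" for i
  proof -
    have "1 + t * t = t * (t + w)" using tw by (simp add: algebra_simps)
    then have "(1 + t * t) ^ i * t ^ (n - i) = (t ^ i * t ^ (n - i)) * (t + w) ^ i"
      by (simp add: power_mult_distrib mult_ac)
    then show ?thesis using that by (simp add: power_add[symmetric])
  qed
  then show ?thesis
    unfolding poly_as_sum_le[OF d] sum_distrib_left hat_def poly_sum
    by (intro sum.cong) (auto simp: mult_ac)
qed

lemma coeff_hat_0: "coeff (hat n p) 0 = coeff p n"
proof -
  have "poly (hat n p) 0 = (\<Sum>i\<le>n. if i = n then coeff p n else 0)"
    unfolding hat_def poly_sum by (intro sum.cong) (auto simp: power_0_left)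
  then show ?thesis by (simp add: poly_0_coeff_0)
qed

lemma degree_hat_term: "degree ([:1, 0, 1:] ^ i * [:0, 1 :: int:] ^ j) = 2 * i + j"
  and lead_coeff_hat_term: "lead_coeff ([:1, 0, 1:] ^ i * [:0, 1 :: int:] ^ j) = 1"
proof -
  show "degree ([:1, 0, 1:] ^ i * [:0, 1 :: int:] ^ j) = 2 * i + j"
    by (simp add: degree_mult_eq degree_power_eq)
  have "lead_coeff ([:1, 0, 1:] ^ i * [:0, 1 :: int:] ^ j) = lead_coeff [:1, 0, 1:] ^ i * lead_coeff [:0, 1 :: int:] ^ j"
    by (simp only: lead_coeff_mult lead_coeff_power)
  then show "lead_coeff ([:1, 0, 1:] ^ i * [:0, 1 :: int:] ^ j) = 1" by simp
qed

lemma degree_hat: "degree (hat n p) \<le> 2 * n" for p :: "int poly"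
  unfolding hat_def
proof (rule degree_sum_le)
  fix i assume "i \<in> {..n}"
  then have "degree ([:1, 0, 1:] ^ i * [:0, 1 :: int:] ^ (n - i)) \<le> 2 * n" unfolding degree_hat_term by simp
  then show "degree (smult (coeff p i) ([:1, 0, 1:] ^ i * [:0, 1:] ^ (n - i))) \<le> 2 * n"
    using degree_smult_le order_trans by blast
qed simp

lemma coeff_hat_top: "coeff (hat n p) (2 * n) = coeff p n" for p :: "int poly"
proof -
  have "coeff (hat n p) (2 * n) = (\<Sum>i\<le>n. coeff p i * coeff ([:1, 0, 1:] ^ i * [:0, 1:] ^ (n - i)) (2 * n))"
    by (simp add: hat_def coeff_sum)
  also have "\<dots> = (\<Sum>i\<le>n. if i = n then coeff p n else 0)"
  proof (intro sum.cong refl)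
    fix i assume i: "i \<in> {..n}"
    show "coeff p i * coeff ([:1, 0, 1:] ^ i * [:0, 1:] ^ (n - i)) (2 * n) = (if i = n then coeff p n else 0)"
    proof (cases "i = n")
      case True
      then show ?thesis using lead_coeff_hat_term[of n 0] degree_hat_term[of n 0] by simp
    next
      case False
      then have "coeff ([:1, 0, 1:] ^ i * [:0, 1 :: int:] ^ (n - i)) (2 * n) = 0"
        using i by (intro coeff_eq_0) (unfold degree_hat_term, simp)
      then show ?thesis using False by simp
    qed
  qed
  finally show ?thesis by simp
qed

lemma map_poly_hat: "map_poly of_int (hat n p) = (hat n (map_poly of_int p) :: complex poly)"
  unfolding hat_def by (simp add: hom_distribs coeff_map_poly)

section \<open>The sum of the absolute values of the coefficients\<close>

definition l1 :: "int poly \<Rightarrow> int" where "l1 p = (\<Sum>i\<le>degree p. \<bar>coeff p i\<bar>)"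

lemma l1_ge: "degree p \<le> n \<Longrightarrow> l1 p = (\<Sum>i\<le>n. \<bar>coeff p i\<bar>)"
  unfolding l1_def by (rule sum.mono_neutral_left) (auto simp: coeff_eq_0)

lemma l1_nonneg: "l1 p \<ge> 0" by (simp add: l1_def sum_nonneg)

lemma coeff_le_l1: "\<bar>coeff p i\<bar> \<le> l1 p"
proof -
  have "l1 p = (\<Sum>j\<le>max i (degree p). \<bar>coeff p j\<bar>)" by (rule l1_ge) simp
  moreover have "\<bar>coeff p i\<bar> \<le> (\<Sum>j\<le>max i (degree p). \<bar>coeff p j\<bar>)"
    by (rule member_le_sum) auto
  ultimately show ?thesis by simp
qed

lemma l1_add: "l1 (p + q) \<le> l1 p + l1 q"
proof -
  let ?n = "max (degree p) (degree q)"
  have "l1 (p + q) = (\<Sum>i\<le>?n. \<bar>coeff p i + coeff q i\<bar>)" using l1_ge[OF degree_add_le_max] by simp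
  also have "\<dots> \<le> (\<Sum>i\<le>?n. \<bar>coeff p i\<bar> + \<bar>coeff q i\<bar>)" by (intro sum_mono) auto
  also have "\<dots> = l1 p + l1 q" by (simp add: sum.distrib l1_ge[of p ?n] l1_ge[of q ?n])
  finally show ?thesis .
qed

lemma l1_minus [simp]: "l1 (- p) = l1 p" by (simp add: l1_def)

lemma l1_diff: "l1 (p - q) \<le> l1 p + l1 q"
  using l1_add[of p "- q"] by simp

lemma l1_sum: "l1 (sum f A) \<le> (\<Sum>i\<in>A. l1 (f i))"
  by (induction A rule: infinite_finite_induct) (auto simp: l1_def[of 0] intro: order_trans[OF l1_add])

lemma l1_pCons: "l1 (pCons a p) = \<bar>a\<bar> + l1 p"
proof -
  have "l1 (pCons a p) = (\<Sum>i\<le>Suc (degree p). \<bar>coeff (pCons a p) i\<bar>)" by (rule l1_ge) (rule degree_pCons_le)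
  also have "\<dots> = \<bar>a\<bar> + (\<Sum>i\<le>degree p. \<bar>coeff p i\<bar>)" by (subst sum.atMost_Suc_shift) simp
  finally show ?thesis by (simp add: l1_def)
qed

lemma l1_0 [simp]: "l1 0 = 0" and l1_1 [simp]: "l1 1 = 1"
  by (simp_all add: l1_def)

lemma l1_smult: "l1 (smult c p) = \<bar>c\<bar> * l1 p"
  by (induction p) (auto simp: l1_pCons distrib_left abs_mult)

lemma l1_mult: "l1 (p * q) \<le> l1 p * l1 q"
proof (induction p)
  case (pCons a p)
  have "l1 (pCons a p * q) \<le> l1 (smult a q) + l1 (pCons 0 (p * q))" unfolding mult_pCons_left by (rule l1_add)
  also have "\<dots> \<le> \<bar>a\<bar> * l1 q + l1 p * l1 q" using pCons.IH by (simp add: l1_smult l1_pCons)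
  finally show ?case by (simp add: l1_pCons distrib_right)
qed simp

lemma l1_power: "l1 (p ^ n) \<le> l1 p ^ n"
proof (induction n)
  case (Suc n)
  have "l1 (p ^ Suc n) \<le> l1 p * l1 (p ^ n)" by (simp add: l1_mult)
  also have "\<dots> \<le> l1 p * l1 p ^ n" by (intro mult_left_mono Suc l1_nonneg)
  finally show ?case by simp
qed simp

lemma l1_prod_le_1: "(\<And>i. i \<in> A \<Longrightarrow> l1 (f i) \<le> 1) \<Longrightarrow> l1 (prod f A) \<le> 1"
proof (induction A rule: infinite_finite_induct)
  case (insert a A)
  have "l1 (f a * prod f A) \<le> l1 (f a) * l1 (prod f A)" by (rule l1_mult)
  also have "\<dots> \<le> 1 * 1" using insert by (intro mult_mono) (auto simp: l1_nonneg)
  finally show ?case using insert by simp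
qed auto

lemma l1_X_mult [simp]: "l1 ([:0, 1:] * p) = l1 p"
  by (simp add: l1_pCons)

lemma l1_hat: "degree p \<le> n \<Longrightarrow> l1 (hat n p) \<le> 2 ^ n * l1 p"
proof -
  assume d: "degree p \<le> n"
  have "l1 (hat n p) \<le> (\<Sum>i\<le>n. l1 (smult (coeff p i) ([:1, 0, 1:] ^ i * [:0, 1:] ^ (n - i))))"
    unfolding hat_def by (rule l1_sum)
  also have "\<dots> \<le> (\<Sum>i\<le>n. \<bar>coeff p i\<bar> * 2 ^ n)"
  proof (rule sum_mono)
    fix i assume i: "i \<in> {..n}"
    have "l1 ([:1, 0, 1:] ^ i * [:0, 1:] ^ (n - i)) \<le> l1 ([:1, 0, 1:] ^ i) * l1 ([:0, 1:] ^ (n - i))" by (rule l1_mult)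
    also have "\<dots> \<le> 2 ^ i * 1"
      using l1_power[of "[:1, 0, 1:]" i] l1_power[of "[:0, 1:]" "n - i"]
      by (intro mult_mono) (auto simp: l1_pCons l1_nonneg)
    also have "\<dots> \<le> 2 ^ n" using i by simp
    finally show "l1 (smult (coeff p i) ([:1, 0, 1:] ^ i * [:0, 1:] ^ (n - i))) \<le> \<bar>coeff p i\<bar> * 2 ^ n"
      unfolding l1_smult by (rule mult_left_mono) simp
  qed
  also have "\<dots> = 2 ^ n * l1 p" using d by (simp add: l1_ge sum_distrib_right[symmetric])
  finally show ?thesis .
qed

lemma l1_pderiv: "degree p \<le> n \<Longrightarrow> l1 (pderiv p) \<le> int n * l1 p"
proof -
  assume d: "degree p \<le> n"
  have "l1 (pderiv p) = (\<Sum>i\<le>n. \<bar>coeff (pderiv p) i\<bar>)" using d degree_pderiv_le[of p] by (intro l1_ge) simp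
  also have "\<dots> \<le> (\<Sum>i\<le>n. int n * \<bar>coeff p (Suc i)\<bar>)"
  proof (rule sum_mono)
    fix i assume "i \<in> {..n}"
    show "\<bar>coeff (pderiv p) i\<bar> \<le> int n * \<bar>coeff p (Suc i)\<bar>"
    proof (cases "Suc i \<le> n")
      case True
      then show ?thesis by (simp only: coeff_pderiv abs_mult abs_of_nat) (intro mult_right_mono, auto)
    next
      case False
      then have "coeff p (Suc i) = 0" using d by (intro coeff_eq_0) simp
      then show ?thesis by (simp add: coeff_pderiv)
    qed
  qed
  also have "\<dots> = int n * (\<Sum>i\<le>n. \<bar>coeff p (Suc i)\<bar>)" by (simp add: sum_distrib_left)
  also have "(\<Sum>i\<le>n. \<bar>coeff p (Suc i)\<bar>) \<le> (\<Sum>i\<le>Suc n. \<bar>coeff p i\<bar>)"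
    using sum.atMost_Suc_shift[of "\<lambda>i. \<bar>coeff p i\<bar>" n] by simp
  also have "(\<Sum>i\<le>Suc n. \<bar>coeff p i\<bar>) = l1 p" using d by (simp add: l1_ge[of p "Suc n"])
  finally show ?thesis by (simp add: mult_left_mono)
qed

lemma cmod_poly_le_l1:
  fixes r :: real
  assumes "degree p \<le> n" "1 \<le> r" "cmod x \<le> r"
  shows "cmod (poly (map_poly of_int p) x) \<le> l1 p * r ^ n"
proof -
  have "poly (map_poly of_int p) x = (\<Sum>i\<le>n. of_int (coeff p i) * x ^ i)"
    using assms(1) by (subst poly_as_sum_le[of _ n]) (auto simp: coeff_map_poly)
  also have "cmod \<dots> \<le> (\<Sum>i\<le>n. cmod (of_int (coeff p i) * x ^ i))" by (rule norm_sum)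
  also have "\<dots> \<le> (\<Sum>i\<le>n. real_of_int \<bar>coeff p i\<bar> * r ^ n)"
  proof (rule sum_mono)
    fix i assume i: "i \<in> {..n}"
    have "cmod x ^ i \<le> r ^ i" using assms by (intro power_mono) auto
    also have "\<dots> \<le> r ^ n" using i assms by (intro power_increasing) auto
    finally show "cmod (of_int (coeff p i) * x ^ i) \<le> real_of_int \<bar>coeff p i\<bar> * r ^ n"
      by (simp add: norm_mult norm_power mult_left_mono)
  qed
  also have "\<dots> = l1 p * r ^ n" using assms(1) by (simp add: l1_ge sum_distrib_right)
  finally show ?thesis by simp
qed

text \<open>Leibniz formula: each of the \<open>fact n\<close> products has factors of norm at most
  1. The zero diagonal matters, since a diagonal entry is then just \<open>X\<close>.\<close>

lemma l1_char_poly: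
  assumes "\<And>i j. i < n \<Longrightarrow> j < n \<Longrightarrow> \<bar>a i j\<bar> \<le> 1" "\<And>i. i < n \<Longrightarrow> a i i = 0"
  shows "l1 (char_poly (nat_mat n a)) \<le> fact n"
proof -
  let ?N = "char_poly_matrix (nat_mat n a)"
  have N: "?N \<in> carrier_mat n n" by simp
  have "l1 (char_poly (nat_mat n a)) \<le> (\<Sum>p | p permutes {0..<n}. l1 (signof p * (\<Prod>i = 0..<n. ?N $$ (i, p i))))"
    unfolding char_poly_def det_def'[OF N] by (rule l1_sum)
  also have "\<dots> \<le> (\<Sum>p | p permutes {0..<n}. 1)"
  proof (rule sum_mono)
    fix p assume "p \<in> {p. p permutes {0..<n}}"
    then have p: "p i < n" if "i < n" for i using that permutes_in_image[of p "{0..<n}" i] by simp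
    have "l1 (?N $$ (i, p i)) \<le> 1" if "i \<in> {0..<n}" for i
      using that p[of i] assms(1)[of i "p i"] assms(2)[of i]
      by (auto simp: char_poly_matrix_nat_mat l1_pCons)
    then have 1: "l1 (\<Prod>i = 0..<n. ?N $$ (i, p i)) \<le> 1" by (rule l1_prod_le_1)
    show "l1 (signof p * (\<Prod>i = 0..<n. ?N $$ (i, p i))) \<le> 1"
      using 1 by (cases "evenperm p") (auto simp: sign_def)
  qed
  also have "\<dots> = fact n" using card_permutations[of "{0..<n}" n] by simp
  finally show ?thesis .
qed

lemma factor_X_power:
  fixes p :: "int poly"
  assumes "p \<noteq> 0" obtains j q where "p = [:0, 1:] ^ j * q" "coeff q 0 \<noteq> 0"
proof -
  have "\<exists>j q. p = [:0, 1:] ^ j * q \<and> coeff q 0 \<noteq> 0" using assms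
  proof (induction p)
    case (pCons a p)
    show ?case
    proof (cases "a = 0")
      case True
      then have "p \<noteq> 0" using pCons by auto
      then obtain j q where jq: "p = [:0, 1:] ^ j * q" "coeff q 0 \<noteq> 0" using pCons by blast
      have "pCons a p = [:0, 1:] ^ Suc j * q" using True jq(1) by simp
      then show ?thesis using jq(2) by blast
    next
      case False
      then show ?thesis by (intro exI[of _ 0] exI[of _ "pCons a p"]) simp
    qed
  qed simp
  then show ?thesis using that by blast
qed

text \<open>\<open>Z = A - A(0) B\<close> has zero Wronskian with \<open>B\<close> as well and no
  constant term. Were it nonzero with lowest term of degree \<open>r > 0\<close>, the lowest
  coefficient of the Wronskian would be \<open>r\<close> times that term's coefficient.\<close>

lemma wronskian_0:
  fixes A B :: "int poly"
  assumes W: "pderiv A * B - A * pderiv B = 0" and B: "coeff B 0 = 1"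
  shows "A = smult (coeff A 0) B"
proof (rule ccontr)
  define Z where "Z = A - smult (coeff A 0) B"
  assume "A \<noteq> smult (coeff A 0) B"
  then have "Z \<noteq> 0" by (simp add: Z_def)
  then obtain r q where q: "Z = [:0, 1:] ^ r * q" "coeff q 0 \<noteq> 0" by (rule factor_X_power) blast
  have Z0: "coeff Z 0 = 0" using B by (simp add: Z_def)
  have "r \<noteq> 0" using q Z0 by (intro notI) simp
  then obtain r' where r: "r = Suc r'" by (cases r) auto
  have ZW: "pderiv Z * B - Z * pderiv B = 0"
    using W by (simp add: Z_def pderiv_diff pderiv_smult algebra_simps)
  have "pderiv Z = [:0, 1:] ^ r' * (smult (int r) q + [:0, 1:] * pderiv q)"
    unfolding q(1) r pderiv_mult pderiv_power_Suc by (simp add: pderiv_pCons algebra_simps)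
  then have "[:0, 1:] ^ r' * ((smult (int r) q + [:0, 1:] * pderiv q) * B - [:0, 1:] * q * pderiv B) = 0"
    using ZW unfolding q(1) r by (simp add: algebra_simps)
  then have "(smult (int r) q + [:0, 1:] * pderiv q) * B - [:0, 1:] * q * pderiv B = 0" by simp
  then have "poly ((smult (int r) q + [:0, 1:] * pderiv q) * B - [:0, 1:] * q * pderiv B) 0 = 0" by simp
  then have "int r * poly q 0 * poly B 0 = 0" by simp
  then have "int r * coeff q 0 * coeff B 0 = 0" by (simp only: poly_0_coeff_0)
  then show False using q B r by simp
qed

abbreviation ipoly :: "int poly \<Rightarrow> complex \<Rightarrow> complex" where
  "ipoly p x \<equiv> poly (map_poly of_int p) x"

section \<open>The three-term recursion, its invariant and the Wronskian\<close>

locale poly_rec =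
  fixes P :: "nat \<Rightarrow> int poly" and k :: nat
  assumes P_rec: "P (Suc (Suc m)) = [:0, 1:] * P (Suc m) - P m"
    and P_monic: "lead_coeff (P m) = 1" and P_degree: "degree (P m) = k + m"
    and P_l1: "l1 (P 0) \<le> fact k" "l1 (P 1) \<le> fact (Suc k)"
begin

text \<open>
  For \<open>x = t + 1/t\<close> one has \<open>FF m = (t\<^sup>2 - 1) t\<^sup>k\<^sup>+\<^sup>m P m x\<close>.  \<open>W m\<close> is the combination of \<open>FF m\<close> and its
  derivative in which the powers of \<open>t\<close> that depend on \<open>m\<close> cancel.
\<close>

definition Q where "Q = [:0, 1:] * P 0 - P 1"
definition A where "A = [:0, 1:] * hat k (P 0) - hat k Q"
definition B where "B = hat k (P 0) - [:0, 1:] * hat k Q"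
definition FF where "FF m = [:0, 1:] ^ (2 * m + 1) * A - B"
definition Y where "Y = P 1 * P 1 - [:0, 1:] * P 1 * P 0 + P 0 * P 0"
definition W where "W m = smult (int (2 * m + 1)) (A * B) + [:0, 1:] * (pderiv A * B - A * pderiv B)"
text \<open>Bounds the norms of \<open>P 0\<close>, \<open>P 1\<close> and \<open>Q\<close>; for
  \<open>Q\<close> because \<open>fact k + fact (k + 1) = (k + 2) * fact k\<close>.\<close>

definition c0 :: nat where "c0 = fact (k + 2)"
definition h1 :: nat where "h1 = 2 ^ (k + 1) * c0"
text \<open>The first summand bounds the norm of the Wronskian in \<open>W_not_0_mod\<close>, so
  that its coefficients survive modulo a larger prime. The 8 guarantees \<open>p \<ge> 8\<close> in
  \<open>degree_le\<close>.\<close>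

definition h2 :: nat where "h2 = 2 * (2 * k + 1) * h1 ^ 2 + 8"

lemma P_coeff_top: "coeff (P m) (k + m) = 1"
  using P_monic[of m] P_degree[of m] by simp

lemma degree_P0: "degree (P 0) \<le> k"
  using P_degree[of 0] by simp

text \<open>\<open>Q\<close> is the recursion run one step backwards, \<open>P (-1)\<close>: the
  leading terms of \<open>X * P 0\<close> and \<open>P 1\<close>, both monic, cancel.\<close>

lemma degree_Q: "degree Q \<le> k"
proof (rule degree_le, intro allI impI)
  fix i assume i: "k < i"
  show "coeff Q i = 0"
  proof (cases "i = Suc k")
    case True
    then show ?thesis using P_coeff_top[of 0] P_coeff_top[of 1] by (simp add: Q_def)
  next
    case False
    then have "coeff (P 0) (i - 1) = 0" "coeff (P 1) i = 0"
      using i P_degree[of 0] P_degree[of 1] by (auto intro!: coeff_eq_0)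
    then show ?thesis using i by (cases i) (simp_all add: Q_def)
  qed
qed

lemma l1_bounds: "l1 (P 0) \<le> c0" "l1 (P 1) \<le> c0" "l1 Q \<le> c0"
proof -
  have f: "fact (k + 2) = (k + 2) * ((k + 1) * fact k)" "fact (Suc k) = (k + 1) * fact k"
    by (simp_all add: numeral_2_eq_2)
  have "(1::nat) * fact k \<le> ((k + 2) * (k + 1)) * fact k" by (intro mult_right_mono) auto
  then have 0: "fact k \<le> c0" by (simp add: c0_def f mult.assoc)
  have "1 * ((k + 1) * fact k) \<le> (k + 2) * ((k + 1) * fact k)" by (intro mult_right_mono) auto
  then have 1: "fact (Suc k) \<le> c0" by (simp add: c0_def f)
  have "(k + 2) * fact k \<le> (k + 2) * ((k + 1) * fact k)" by (intro mult_left_mono) auto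
  then have 2: "fact k + fact (Suc k) \<le> c0" by (simp add: c0_def f algebra_simps)
  have i: "int (fact n) = fact n" for n by simp
  show "l1 (P 0) \<le> c0" using P_l1(1) 0 by (metis i of_nat_mono order_trans)
  show "l1 (P 1) \<le> c0" using P_l1(2) 1 by (metis i of_nat_mono order_trans)
  have "l1 Q \<le> l1 (P 0) + l1 (P 1)" unfolding Q_def using l1_diff[of "[:0, 1:] * P 0" "P 1"] unfolding l1_X_mult .
  also have "\<dots> \<le> int (fact k) + int (fact (Suc k))" using P_l1 by (simp only: i)
  also have "\<dots> \<le> c0" using 2 by (simp only: of_nat_add[symmetric] of_nat_le_iff)
  finally show "l1 Q \<le> c0" .
qed

lemma l1_AB: "l1 A \<le> h1" "l1 B \<le> h1"
proof -
  have "l1 (hat k (P 0)) \<le> 2 ^ k * int c0"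
    using order_trans[OF l1_hat[OF degree_P0] mult_left_mono[OF l1_bounds(1)]] by simp
  moreover have "l1 (hat k Q) \<le> 2 ^ k * int c0"
    using order_trans[OF l1_hat[OF degree_Q] mult_left_mono[OF l1_bounds(3)]] by simp
  ultimately have *: "l1 (hat k (P 0)) + l1 (hat k Q) \<le> h1" by (simp add: h1_def)
  have "l1 A \<le> l1 (hat k (P 0)) + l1 (hat k Q)"
    unfolding A_def using l1_diff[of "[:0, 1:] * hat k (P 0)" "hat k Q"] unfolding l1_X_mult .
  then show "l1 A \<le> h1" using * by linarith
  have "l1 B \<le> l1 (hat k (P 0)) + l1 (hat k Q)"
    unfolding B_def using l1_diff[of "hat k (P 0)" "[:0, 1:] * hat k Q"] unfolding l1_X_mult .
  then show "l1 B \<le> h1" using * by linarith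
qed

lemma degree_AB: "degree A \<le> 2 * k + 1" "degree B \<le> 2 * k + 1"
proof -
  have "degree ([:0, 1:] * hat k p) \<le> 2 * k + 1" for p :: "int poly"
    using degree_hat[of k p] degree_mult_le[of "[:0, 1:]" "hat k p"] by simp
  moreover have "degree (hat k p) \<le> 2 * k + 1" for p :: "int poly" using degree_hat[of k p] by simp
  ultimately show "degree A \<le> 2 * k + 1" "degree B \<le> 2 * k + 1"
    unfolding A_def B_def by (auto intro!: degree_diff_le)
qed

lemma A_nz: "A \<noteq> 0"
proof -
  have "coeff A (Suc (2 * k)) = 1"
    using coeff_hat_top[of k "P 0"] P_coeff_top[of 0] degree_hat[of k Q]
    by (simp add: A_def coeff_eq_0)
  then show ?thesis by auto
qed

lemma B_0: "coeff B 0 = 1"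
  using P_coeff_top[of 0] by (simp add: B_def coeff_hat_0)

lemma ipoly_simps:
  "ipoly (p + q) x = ipoly p x + ipoly q x" "ipoly (p - q) x = ipoly p x - ipoly q x"
  "ipoly (p * q) x = ipoly p x * ipoly q x" "ipoly [:0, 1:] x = x" "ipoly (p ^ n) x = ipoly p x ^ n"
  by (simp_all add: hom_distribs map_poly_pCons)

lemma P1_value: "ipoly (P (Suc 0)) x = x * ipoly (P 0) x - ipoly Q x"
proof -
  have "ipoly Q x = x * ipoly (P 0) x - ipoly (P 1) x" unfolding Q_def ipoly_simps by (rule refl)
  then show ?thesis by simp
qed

context
  fixes t w :: complex
  assumes tw: "t * w = 1"
begin

lemma ipoly_hat: "degree p \<le> n \<Longrightarrow> ipoly (hat n p) t = t ^ n * ipoly p (t + w)"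
  unfolding map_poly_hat using tw by (intro poly_hat) auto

lemma ipoly_AB:
  "ipoly A t = t ^ k * (t * ipoly (P 0) (t + w) - ipoly Q (t + w))"
  "ipoly B t = t ^ k * (ipoly (P 0) (t + w) - t * ipoly Q (t + w))"
  unfolding A_def B_def ipoly_simps ipoly_hat[OF degree_P0] ipoly_hat[OF degree_Q]
  by (simp_all add: algebra_simps)

lemma P_closed_form:
  "ipoly (P m) (t + w) * (t - w) =
    t ^ m * (t * ipoly (P 0) (t + w) - ipoly Q (t + w)) - w ^ m * (w * ipoly (P 0) (t + w) - ipoly Q (t + w))"
proof (induction m rule: less_induct)
  case (less m)
  let ?p = "ipoly (P 0) (t + w)" and ?q = "ipoly Q (t + w)"
  consider "m = 0" | "m = Suc 0" | j where "m = Suc (Suc j)" by (metis not0_implies_Suc)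
  then show ?case
  proof cases
    case 1
    then show ?thesis by (simp add: algebra_simps)
  next
    case 2
    show ?thesis unfolding 2 P1_value by (simp add: algebra_simps)
  next
    case (3 j)
    define a where "a = t ^ j * (t * ?p - ?q)"
    define b where "b = w ^ j * (w * ?p - ?q)"
    have j: "ipoly (P j) (t + w) * (t - w) = a - b" using less[of j] 3 by (simp add: a_def b_def)
    have sj: "ipoly (P (Suc j)) (t + w) * (t - w) = t * a - w * b"
      using less[of "Suc j"] 3 by (simp add: a_def b_def mult.assoc)
    have "ipoly (P m) (t + w) * (t - w) = (t + w) * (ipoly (P (Suc j)) (t + w) * (t - w)) - ipoly (P j) (t + w) * (t - w)"
      unfolding 3 P_rec ipoly_simps by (simp add: left_diff_distrib mult.assoc)
    also have "\<dots> = t * t * a - w * w * b + (t * w - 1) * (a - b)"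
      unfolding j sj by (simp add: algebra_simps)
    also have "\<dots> = t * t * a - w * w * b" using tw by simp
    finally show ?thesis unfolding a_def b_def 3 by (simp add: mult.assoc)
  qed
qed

lemma FF_value: "ipoly (FF m) t = (t\<^sup>2 - 1) * (t ^ (k + m) * ipoly (P m) (t + w))"
proof -
  let ?p = "ipoly (P 0) (t + w)" and ?q = "ipoly Q (t + w)"
  have t2: "t ^ (2 * m + 1) = t ^ m * t ^ m * t" by (simp add: power_add mult_2)
  have tn: "t ^ m * w ^ m = 1" using tw by (metis power_mult_distrib power_one)
  have "(t\<^sup>2 - 1) * (t ^ (k + m) * ipoly (P m) (t + w)) = t ^ (k + m) * t * (ipoly (P m) (t + w) * (t - w)) + t ^ (k + m) * ipoly (P m) (t + w) * (t * w - 1)"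
    by (simp add: algebra_simps power2_eq_square)
  also have "\<dots> = t ^ (k + m) * t * (t ^ m * (t * ?p - ?q) - w ^ m * (w * ?p - ?q))"
    unfolding P_closed_form using tw by simp
  also have "\<dots> = (t ^ m * t ^ m * t) * (t ^ k * (t * ?p - ?q)) - t ^ k * (t ^ m * w ^ m) * (t * w * ?p - t * ?q)"
    by (simp add: algebra_simps power_add)
  also have "\<dots> = ipoly (FF m) t"
    unfolding FF_def ipoly_simps ipoly_AB tn tw t2 by (simp add: algebra_simps)
  finally show ?thesis by simp
qed

end

lemma FF_hat: "map_poly of_int (FF m) = ([:-1, 0, 1:] * hat (k + m) (map_poly of_int (P m)) :: complex poly)"
proof (rule poly_eqI_nonzero)
  fix t :: complex assume "t \<noteq> 0"
  then have tw: "t * inverse t = 1" by simp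
  have "poly (hat (k + m) (map_poly of_int (P m))) t = t ^ (k + m) * ipoly (P m) (t + inverse t)"
    using tw P_degree[of m] by (intro poly_hat) auto
  then show "ipoly (FF m) t = poly ([:-1, 0, 1:] * hat (k + m) (map_poly of_int (P m))) t"
    unfolding FF_value[OF tw] poly_mult by (simp add: power2_eq_square)
qed

lemma FF_nz: "FF m \<noteq> 0"
proof -
  have "coeff (FF m) 0 = - 1" by (simp add: FF_def B_0 coeff_mult_0)
  then show ?thesis by auto
qed

lemma l1_FF: "l1 (FF m) \<le> 2 * int h1"
proof -
  have "l1 ([:0, 1:] ^ n * p) = l1 p" for n and p :: "int poly"
    by (induction n) (simp_all only: power_Suc mult.assoc l1_X_mult power_0 mult_1)
  then show ?thesis using l1_diff[of "[:0, 1:] ^ (2 * m + 1) * A" B] l1_AB by (simp only: FF_def)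
qed

text \<open>The quadratic form is preserved when the pair \<open>(P (m + 1), P m)\<close> is
  replaced by \<open>(x P (m + 1) - P m, P (m + 1))\<close>. At a root of \<open>P m\<close> it is
  the square of the neighbouring value.\<close>

lemma Y_invariant: "ipoly Y x = ipoly (P (Suc m)) x ^ 2 - x * ipoly (P (Suc m)) x * ipoly (P m) x + ipoly (P m) x ^ 2"
proof (induction m)
  case 0
  then show ?case by (simp add: Y_def ipoly_simps power2_eq_square mult.assoc del: mult_pCons_left)
next
  case (Suc m)
  have e: "ipoly (P (Suc (Suc m))) x = x * ipoly (P (Suc m)) x - ipoly (P m) x"
    unfolding P_rec ipoly_simps ..
  show ?case unfolding Suc e by (simp add: algebra_simps power2_eq_square)
qed

lemma Y_pq: "ipoly Y x = ipoly (P 0) x ^ 2 - x * ipoly (P 0) x * ipoly Q x + ipoly Q x ^ 2"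
  unfolding Y_invariant[of x 0] P1_value by (simp add: algebra_simps power2_eq_square)

lemma degree_Y: "degree Y \<le> 2 * k + 2" and l1_Y: "l1 Y \<le> 3 * int c0 ^ 2"
proof -
  have d: "degree (P 0) = k" "degree (P 1) = Suc k" using P_degree[of 0] P_degree[of 1] by auto
  have "degree (P 1 * P 1) \<le> 2 * k + 2" using degree_mult_le[of "P 1" "P 1"] d by simp
  moreover have "degree ([:0, 1:] * P 1 * P 0) \<le> 2 * k + 2"
    using degree_mult_le[of "[:0, 1:] * P 1" "P 0"] degree_mult_le[of "[:0, 1:]" "P 1"] d by simp
  moreover have "degree (P 0 * P 0) \<le> 2 * k + 2" using degree_mult_le[of "P 0" "P 0"] d by simp
  ultimately show "degree Y \<le> 2 * k + 2" unfolding Y_def by (intro degree_add_le degree_diff_le)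
  have m: "l1 (p * q) \<le> int c0 * int c0" if "l1 p \<le> c0" "l1 q \<le> c0" for p q
    using order_trans[OF l1_mult mult_mono[OF that]] by (simp add: l1_nonneg)
  have "l1 ([:0, 1:] * P 1 * P 0) \<le> int c0 * int c0" using l1_bounds m[of "[:0, 1:] * P 1" "P 0"] by (simp only: l1_X_mult)
  moreover have "l1 Y \<le> l1 (P 1 * P 1) + l1 ([:0, 1:] * P 1 * P 0) + l1 (P 0 * P 0)"
    unfolding Y_def using l1_add[of "P 1 * P 1 - [:0, 1:] * P 1 * P 0" "P 0 * P 0"] l1_diff[of "P 1 * P 1" "[:0, 1:] * P 1 * P 0"] by linarith
  ultimately show "l1 Y \<le> 3 * int c0 ^ 2" using m[OF l1_bounds(2,2)] m[OF l1_bounds(1,1)] by (simp add: power2_eq_square)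
qed

text \<open>The powers cancel because \<open>X d/dX\<close> multiplies \<open>X ^ (2 m + 1)\<close>
  by \<open>2 m + 1\<close>. This is the form that \<open>everywhere_ramified\<close> expects, with
  integral multipliers.\<close>

lemma W_eq: "W m = ([:0, 1:] * A) * pderiv (FF m) - FF m * (smult (int (2 * m + 1)) A + [:0, 1:] * pderiv A)"
proof -
  let ?X = "[:0, 1:] :: int poly" and ?M = "int (2 * m + 1)"
  have dX: "?X * pderiv (?X ^ (2 * m + 1)) = smult ?M (?X ^ (2 * m + 1))"
    unfolding Suc_eq_plus1[symmetric] pderiv_power_Suc by (simp add: pderiv_pCons)
  have "?X * pderiv (FF m) = smult ?M (?X ^ (2 * m + 1)) * A + ?X * (?X ^ (2 * m + 1) * pderiv A) - ?X * pderiv B"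
    unfolding FF_def pderiv_diff pderiv_mult dX[symmetric] by (simp only: algebra_simps)
  then have "(?X * A) * pderiv (FF m) = A * (smult ?M (?X ^ (2 * m + 1)) * A + ?X * (?X ^ (2 * m + 1) * pderiv A) - ?X * pderiv B)"
    by (simp only: mult_ac)
  moreover have "smult ?M p = [:?M:] * p" for p by simp
  ultimately show ?thesis unfolding W_def FF_def by (simp only: algebra_simps)
qed

lemma degree_W: "degree (W m) \<le> 4 * k + 3"
proof -
  have "degree (A * B) \<le> 4 * k + 2" using degree_mult_le[of A B] degree_AB by simp
  then have 1: "degree (smult (int (2 * m + 1)) (A * B)) \<le> 4 * k + 3" using degree_smult_le[of "int (2 * m + 1)" "A * B"] by linarith
  have "degree (pderiv A * B) \<le> 4 * k + 2"
    using degree_mult_le[of "pderiv A" B] degree_AB degree_pderiv_le[of A] by simp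
  moreover have "degree (A * pderiv B) \<le> 4 * k + 2"
    using degree_mult_le[of A "pderiv B"] degree_AB degree_pderiv_le[of B] by simp
  ultimately have "degree (pderiv A * B - A * pderiv B) \<le> 4 * k + 2" by (rule degree_diff_le)
  then have "degree ([:0, 1:] * (pderiv A * B - A * pderiv B)) \<le> 4 * k + 3"
    using degree_mult_le[of "[:0, 1:]" "pderiv A * B - A * pderiv B"] by simp
  then show ?thesis unfolding W_def using 1 by (intro degree_add_le)
qed

context
  fixes m :: nat and l t :: real
  assumes m: "m > 0" and t: "t > 1" and l: "l = t + 1 / t"
    and root: "ipoly (P m) (complex_of_real l) = 0" and nonroot: "ipoly (P (m - 1)) (complex_of_real l) \<noteq> 0"
begin

lemma Y_root_nz: "ipoly Y (complex_of_real l) \<noteq> 0"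
  using Y_invariant[of "complex_of_real l" "m - 1"] m root nonroot by simp

lemma tw_real: "complex_of_real t * complex_of_real (1 / t) = 1" "complex_of_real t + complex_of_real (1 / t) = complex_of_real l"
  using t by (simp_all add: l)

text \<open>In terms of \<open>t\<close> and \<open>w = 1 / t\<close>, \<open>Y(l)\<close> factors
  as \<open>a * b\<close> with \<open>a = t P0 - Q\<close> and \<open>b = w P0 - Q\<close>. At a
  root of \<open>P m\<close> the closed form gives \<open>t ^ (2 m) * a = b\<close>, so
  \<open>Y(l) * t ^ (2 m) = b * b\<close>, where the bound for \<open>b\<close> does not involve
  \<open>m\<close>.\<close>

lemma Y_root_small: "cmod (ipoly Y (complex_of_real l)) * t ^ (2 * m) \<le>
    (cmod (ipoly (P 0) (complex_of_real l)) + cmod (ipoly Q (complex_of_real l)))\<^sup>2"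
proof -
  let ?l = "complex_of_real l" and ?t = "complex_of_real t" and ?w = "complex_of_real (1 / t)"
  let ?p = "ipoly (P 0) ?l" and ?q = "ipoly Q ?l"
  define a where "a = ?t * ?p - ?q"
  define b where "b = ?w * ?p - ?q"
  have "?t ^ m * a = ?w ^ m * b"
    using P_closed_form[OF tw_real(1), of m] root unfolding tw_real(2) a_def b_def by simp
  then have "?t ^ m * (?t ^ m * a) = (?t * ?w) ^ m * b" by (simp only: power_mult_distrib mult.assoc)
  then have ab: "?t ^ (2 * m) * a = b" unfolding tw_real(1) by (simp add: mult_2 power_add mult.assoc)
  have "ipoly Y ?l = ?p ^ 2 * (?t * ?w) - (?t + ?w) * ?p * ?q + ?q ^ 2"
    unfolding Y_pq tw_real by simp
  also have "\<dots> = a * b" unfolding a_def b_def by (simp only: power2_eq_square algebra_simps)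
  finally have "ipoly Y ?l * ?t ^ (2 * m) = b * b" using ab by (simp add: mult_ac)
  then have "cmod (ipoly Y ?l * ?t ^ (2 * m)) = cmod (b * b)" by simp
  moreover have "cmod ?t = t" using t by simp
  ultimately have "cmod (ipoly Y ?l) * t ^ (2 * m) = cmod b * cmod b"
    by (simp only: norm_mult norm_power)
  moreover have "cmod b \<le> cmod ?p + cmod ?q"
  proof -
    have "cmod b \<le> cmod (?w * ?p) + cmod ?q" unfolding b_def by (rule norm_triangle_ineq4)
    also have "cmod (?w * ?p) \<le> 1 * cmod ?p" unfolding norm_mult using t
      by (intro mult_right_mono) (auto simp: norm_divide)
    finally show ?thesis by simp
  qed
  ultimately show ?thesis using mult_mono[of "cmod b" "cmod ?p + cmod ?q" "cmod b" "cmod ?p + cmod ?q"]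
    by (simp add: power2_eq_square)
qed

text \<open>With \<open>A = X ^ j * A0\<close> and \<open>A0(0)\<close> nonzero,
  \<open>W m = (2 m + 1 + j) A B + X ^ (j + 1) D\<close>, where \<open>D\<close> is the Wronskian of
  \<open>A0\<close> and \<open>B\<close>. If \<open>p\<close> divides \<open>2 m + 1 + j\<close>, a
  coefficient of \<open>D\<close> remains, too small to be divisible by \<open>p\<close>; otherwise
  coefficient \<open>j\<close> is \<open>(2 m + 1 + j) A0(0)\<close>. So the bound on
  \<open>p\<close> does not depend on \<open>m\<close>.\<close>

lemma W_not_0_mod:
  assumes p: "prime p" and ph: "p > h2"
  shows "\<exists>i. \<not> int p dvd coeff (W m) i"
proof -
  obtain j A0 where A0: "A = [:0, 1:] ^ j * A0" "coeff A0 0 \<noteq> 0" by (rule factor_X_power[OF A_nz])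
  define D where "D = pderiv A0 * B - A0 * pderiv B"
  define a where "a = coeff A0 0"
  have l1X: "l1 ([:0, 1:] ^ n * p) = l1 p" for n and p :: "int poly"
    by (induction n) (simp_all only: power_Suc mult.assoc l1_X_mult power_0 mult_1)
  have l1A0: "l1 A0 \<le> h1" using l1_AB(1) l1X[of j A0] A0(1) by simp
  have A0nz: "A0 \<noteq> 0" using A0(2) by auto
  have dA0: "degree A0 \<le> 2 * k + 1"
  proof -
    have "degree A = j + degree A0" unfolding A0(1) using A0nz by (simp add: degree_mult_eq degree_power_eq)
    then show ?thesis using degree_AB(1) by simp
  qed
  have pd: "l1 (pderiv q) \<le> int (2 * k + 1) * int h1" if "degree q \<le> 2 * k + 1" "l1 q \<le> h1" for q
    using order_trans[OF l1_pderiv[OF that(1)] mult_left_mono[OF that(2)]] by simp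
  have "l1 D \<le> l1 (pderiv A0 * B) + l1 (A0 * pderiv B)" unfolding D_def by (rule l1_diff)
  also have "l1 (pderiv A0 * B) \<le> (int (2 * k + 1) * int h1) * int h1"
    using order_trans[OF l1_mult mult_mono[OF pd[OF dA0 l1A0] l1_AB(2)]] by (simp add: l1_nonneg)
  also have "l1 (A0 * pderiv B) \<le> int h1 * (int (2 * k + 1) * int h1)"
    using order_trans[OF l1_mult mult_mono[OF l1A0 pd[OF degree_AB(2) l1_AB(2)]]] by (simp add: l1_nonneg)
  finally have "l1 D \<le> (int (2 * k + 1) * int h1) * int h1 + int h1 * (int (2 * k + 1) * int h1)" by simp
  also have "\<dots> \<le> int h2" by (simp add: h2_def power2_eq_square algebra_simps)
  finally have l1D: "l1 D < int p" using ph by simp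
  have h12: "h1 \<le> h2"
  proof -
    have "0 < h1" unfolding h1_def c0_def by (intro mult_pos_pos zero_less_power fact_gt_zero) simp
    then have "h1 * 1 \<le> h1 * h1" by (intro mult_left_mono) auto
    also have "\<dots> \<le> 2 * (2 * k + 1) * (h1 * h1)" by simp
    finally show ?thesis by (simp add: h2_def power2_eq_square)
  qed
  have "\<bar>a\<bar> \<le> h1" using coeff_le_l1[of A0 0] l1A0 by (simp add: a_def)
  then have "\<bar>a\<bar> < int p" using h12 ph by linarith
  then have pa: "\<not> int p dvd a" using A0(2) zdvd_not_zless[of "\<bar>a\<bar>" "int p"] by (auto simp: a_def)
  \<comment> \<open>Otherwise \<open>A0 = a B\<close> and \<open>FF m\<close> is \<open>B\<close>
    times \<open>a X ^ (2 m + 1 + j) - 1\<close>. The second factor has no root \<open>t > 1\<close>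
    for an integer \<open>a\<close>, so \<open>B\<close>, and with it \<open>A\<close>, vanishes at
    \<open>t\<close>; this forces \<open>P 0\<close>, \<open>Q\<close> and finally \<open>Y\<close>
    to vanish at \<open>l\<close>.\<close>
  have Dnz: "D \<noteq> 0"
  proof
    assume "D = 0"
    then have AB: "A0 = smult a B" unfolding D_def a_def by (rule wronskian_0[OF _ B_0])
    let ?t = "complex_of_real t" and ?w = "complex_of_real (1 / t)"
    have "ipoly (FF m) ?t = 0" unfolding FF_value[OF tw_real(1)] tw_real(2) root by simp
    then have "(?t ^ (2 * m + 1) * ?t ^ j * of_int a - 1) * ipoly B ?t = 0"
      unfolding FF_def A0(1) AB by (simp add: ipoly_simps hom_distribs algebra_simps del: mult_pCons_left)
    moreover have "?t ^ (2 * m + 1) * ?t ^ j * of_int a \<noteq> 1"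
    proof
      assume "?t ^ (2 * m + 1) * ?t ^ j * of_int a = 1"
      then have "complex_of_real (t ^ (2 * m + 1 + j) * real_of_int a) = complex_of_real 1"
        by (simp add: power_add mult_ac)
      then have 1: "t ^ (2 * m + 1 + j) * real_of_int a = 1" by (simp only: of_real_eq_iff)
      have t1: "t ^ (2 * m + 1 + j) > 1" using t by (intro one_less_power) auto
      have "a > 0"
      proof (rule ccontr)
        assume "\<not> a > 0"
        then have "t ^ (2 * m + 1 + j) * real_of_int a \<le> 0" using t1 by (intro mult_nonneg_nonpos) auto
        then show False using 1 by simp
      qed
      then have "t ^ (2 * m + 1 + j) * 1 \<le> t ^ (2 * m + 1 + j) * real_of_int a" using t1 by (intro mult_left_mono) auto
      then show False using 1 t1 by simp
    qed
    ultimately have B0: "ipoly B ?t = 0" by auto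
    have A00: "ipoly A ?t = 0" unfolding A0(1) AB using B0 by (simp add: ipoly_simps hom_distribs del: mult_pCons_left)
    have tn: "?t ^ k \<noteq> 0" "t \<noteq> 0" using t by auto
    have e1: "?t * ipoly (P 0) l = ipoly Q l" using A00 tn unfolding ipoly_AB[OF tw_real(1)] tw_real(2) by simp
    have e2: "ipoly (P 0) l = ?t * ipoly Q l" using B0 tn unfolding ipoly_AB[OF tw_real(1)] tw_real(2) by simp
    have "(?t * ?t - 1) * ipoly Q l = 0" using e1 e2 by (simp add: algebra_simps)
    moreover have "?t * ?t \<noteq> 1"
    proof
      assume "?t * ?t = 1"
      then have "t * t = 1" by (metis of_real_1 of_real_eq_iff of_real_mult)
      then show False using t mult_strict_mono[of 1 t 1 t] by simp
    qed
    ultimately have "ipoly Q l = 0" by auto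
    then have "ipoly Y l = 0" using e2 unfolding Y_pq by simp
    then show False using Y_root_nz by simp
  qed
  define Xv :: "int poly" where "Xv = [:0, 1:]"
  have sm: "smult c q = [:c:] * q" for c and q :: "int poly" by simp
  have dX: "Xv * pderiv (Xv ^ j) = [:int j:] * Xv ^ j"
  proof (cases j)
    case (Suc n)
    show ?thesis unfolding Suc Xv_def pderiv_power_Suc by (simp add: pderiv_pCons)
  qed (simp add: pderiv_1)
  have AX: "A = Xv ^ j * A0" using A0(1) by (simp add: Xv_def)
  have "Xv * pderiv A = Xv * (Xv ^ j * pderiv A0) + (Xv * pderiv (Xv ^ j)) * A0"
    unfolding AX pderiv_mult by (simp only: distrib_left mult_ac)
  then have XA: "Xv * pderiv A = Xv * (Xv ^ j * pderiv A0) + [:int j:] * Xv ^ j * A0" unfolding dX .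
  have "Xv * (pderiv A * B - A * pderiv B) = (Xv * pderiv A) * B - Xv * (A * pderiv B)"
    by (simp only: right_diff_distrib mult.assoc)
  also have "\<dots> = [:int j:] * (A * B) + Xv * Xv ^ j * D"
  proof -
    have "(a * (b * c) + d * b * e) * f - a * (b * e * g) = d * (b * e * f) + a * b * (c * f - e * g)"
      for a b c d e f g :: "int poly" by (simp only: algebra_simps)
    from this[of Xv "Xv ^ j" "pderiv A0" "[:int j:]" A0 B "pderiv B", folded AX]
    show ?thesis unfolding XA D_def .
  qed
  finally have "Xv * (pderiv A * B - A * pderiv B) = [:int j:] * (A * B) + Xv * Xv ^ j * D" .
  then have WD: "W m = smult (int (2 * m + 1 + j)) (A * B) + [:0, 1:] ^ Suc j * D"
    unfolding W_def Xv_def[symmetric] of_nat_add smult_add_left by (simp only: sm power_Suc add.assoc)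
  show ?thesis
  proof (cases "int p dvd int (2 * m + 1 + j)")
    case True
    obtain i where i: "coeff D i \<noteq> 0" using Dnz by (metis leading_coeff_0_iff)
    have "\<bar>coeff D i\<bar> < int p" using coeff_le_l1[of D i] l1D by simp
    then have nd: "\<not> int p dvd coeff D i" using i zdvd_not_zless[of "\<bar>coeff D i\<bar>" "int p"] by auto
    have "coeff (W m) (i + Suc j) = int (2 * m + 1 + j) * coeff (A * B) (i + Suc j) + coeff D i"
      unfolding WD by (simp only: coeff_add coeff_smult x_as_monom monom_power) (simp add: coeff_monom_mult)
    moreover have "int p dvd int (2 * m + 1 + j) * coeff (A * B) (i + Suc j)" using True by (rule dvd_mult2)
    ultimately have "\<not> int p dvd coeff (W m) (i + Suc j)" using nd by (simp only: dvd_add_right_iff not_False_eq_True)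
    then show ?thesis by blast
  next
    case False
    have "coeff ([:0, 1:] ^ Suc j * D) j = 0"
      by (simp only: x_as_monom monom_power) (simp add: coeff_monom_mult)
    moreover have "coeff (A * B) j = a"
    proof -
      have "coeff (A * B) j = coeff (A0 * B) 0" unfolding A0(1) mult.assoc
        by (simp only: x_as_monom monom_power) (simp add: coeff_monom_mult)
      also have "\<dots> = a" by (simp add: coeff_mult_0 B_0 a_def)
      finally show ?thesis .
    qed
    ultimately have "coeff (W m) j = int (2 * m + 1 + j) * a" unfolding WD by (simp only: coeff_add coeff_smult)
    moreover have "prime (int p)" using p by simp
    ultimately have "\<not> int p dvd coeff (W m) j" using False pa prime_dvd_mult_iff by metis
    then show ?thesis by blast
  qed
qed

end

end

section \<open>Degree bounds for the field of the largest eigenvalue\<close>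

lemma even_odd_parts:
  fixes r :: "rat poly"
  shows "\<exists>E O'. \<forall>x. rpoly r x = rpoly E (x\<^sup>2) + x * rpoly O' (x\<^sup>2)"
proof (induction r)
  case 0
  show ?case by (intro exI[of _ 0]) simp
next
  case (pCons c r)
  then obtain E O' where "\<And>x. rpoly r x = rpoly E (x\<^sup>2) + x * rpoly O' (x\<^sup>2)" by blast
  then show ?case
    by (intro exI[of _ "pCons c O'"] exI[of _ E]) (simp add: algebra_simps power2_eq_square)
qed

lemma rpoly_pcompose: "rpoly (pcompose r s) x = rpoly r (rpoly s x)"
  by (simp add: of_rat_hom.map_poly_pcompose poly_pcompose)

text \<open>An even polynomial in \<open>x\<close> is a polynomial in \<open>x\<^sup>2\<close>,
  hence in \<open>x\<^sup>2 - 2\<close>. At \<open>x = l\<close> this is the relative norm over the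
  field of the square, when \<open>l\<close> lies outside it.\<close>

lemma norm_form:
  fixes r :: "rat poly"
  shows "\<exists>q. \<forall>x. rpoly q (x\<^sup>2 - 2) = rpoly r x * rpoly r (- x)"
proof -
  obtain E O' where EO: "\<And>x. rpoly r x = rpoly E (x\<^sup>2) + x * rpoly O' (x\<^sup>2)"
    using even_odd_parts by blast
  let ?q = "pcompose (E * E - [:0, 1:] * O' * O') [:2, 1:]"
  have "rpoly ?q (x\<^sup>2 - 2) = rpoly r x * rpoly r (- x)" for x
    unfolding rpoly_pcompose EO[of x] EO[of "- x"] by (simp add: algebra_simps power2_eq_square)
  then show ?thesis by blast
qed

lemma rat_poly_eqI:
  fixes p q :: "rat poly"
  assumes "\<And>x. rpoly p x = rpoly q x" shows "p = q"
proof -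
  have "map_poly of_rat p = (map_poly of_rat q :: complex poly)"
    using assms by (intro poly_eqI_nonzero) simp
  then show ?thesis by simp
qed

text \<open>The Chebyshev polynomials of the first kind in the scaling \<open>2 T_n(x / 2)\<close>,
  which has integer coefficients; \<open>cheb p\<close> is the \<open>T\<close> of the Frobenius
  argument.\<close>

fun cheb :: "nat \<Rightarrow> int poly" where
  "cheb 0 = [:2:]"
| "cheb (Suc 0) = [:0, 1:]"
| "cheb (Suc (Suc n)) = [:0, 1:] * cheb (Suc n) - cheb n"

lemma cheb_value: "s * w = 1 \<Longrightarrow> ipoly (cheb n) (s + w) = s ^ n + w ^ n"
proof (induction n rule: cheb.induct)
  case (3 n)
  have "ipoly (cheb (Suc (Suc n))) (s + w) = (s + w) * (s ^ Suc n + w ^ Suc n) - (s ^ n + w ^ n)"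
    unfolding cheb.simps using 3 by (simp add: hom_distribs map_poly_pCons)
  also have "\<dots> = s ^ Suc (Suc n) + w ^ Suc (Suc n) + (s * w - 1) * (s ^ n + w ^ n)"
    by (simp add: algebra_simps)
  finally show ?case using 3(3) by simp
qed (simp_all add: map_poly_pCons)

text \<open>\<open>s\<close> is a root of \<open>hat\<close> of a monic polynomial for
  \<open>s + w\<close>, which is again monic.\<close>

lemma algebraic_int_unit:
  fixes s w :: complex
  assumes sw: "s * w = 1" and a: "algebraic_int (s + w)" shows "algebraic_int s"
proof -
  obtain g where g: "ipoly g (s + w) = 0" "lead_coeff g = 1"
    using a by (auto simp: algebraic_int_altdef_ipoly)
  let ?h = "hat (degree g) g"
  have "coeff ?h (2 * degree g) = 1" using coeff_hat_top[of "degree g" g] g(2) by simp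
  then have "lead_coeff ?h = 1" using degree_hat[of "degree g" g] le_degree[of ?h "2 * degree g"] by force
  moreover have "ipoly ?h s = 0"
  proof -
    have "poly (hat (degree g) (map_poly of_int g)) s = s ^ degree g * ipoly g (s + w)"
      using sw by (intro poly_hat) auto
    then show ?thesis using g(1) by (simp add: map_poly_hat)
  qed
  ultimately show ?thesis by (auto simp: algebraic_int_altdef_ipoly)
qed

lemma large_unit_exists:
  fixes a :: complex
  shows "\<exists>s w. s * w = 1 \<and> a = s + w \<and> cmod s \<ge> 1 \<and> cmod w \<le> 1"
proof -
  obtain t w where tw: "t * w = 1" "a = t + w" using sum_inverse_exists by blast
  have n: "cmod t * cmod w = 1" using tw(1) by (metis norm_mult norm_one)
  show ?thesis
  proof (cases "cmod t \<ge> 1")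
    case True
    have "cmod w \<le> 1"
    proof (rule ccontr)
      assume "\<not> cmod w \<le> 1"
      then have "1 * 1 < cmod t * cmod w" using True by (intro mult_le_less_imp_less) auto
      then show False using n by simp
    qed
    then show ?thesis using tw True by blast
  next
    case False
    have "cmod w \<ge> 1"
    proof (rule ccontr)
      assume "\<not> cmod w \<ge> 1"
      then have "cmod t * cmod w < 1 * 1" using False by (intro mult_strict_mono) auto
      then show False using n by simp
    qed
    then show ?thesis using tw False
      by (intro exI[of _ w] exI[of _ t]) (simp add: mult.commute add.commute)
  qed
qed

section \<open>Mahler measure and the product of the large roots\<close>

lemma mahler_ge_coeff_0: "cmod (poly p 0) \<le> mahler_measure_poly p"
proof -
  have "poly p 0 = lead_coeff p * poly (\<Prod>a\<leftarrow>complex_roots_complex p. [:- a, 1:]) 0"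
    by (subst complex_roots(1)[of p, symmetric]) simp
  also have "poly (\<Prod>a\<leftarrow>xs. [:- a, 1:]) 0 = (\<Prod>a\<leftarrow>xs. - a)" for xs :: "complex list"
    by (induction xs) auto
  finally have 1: "cmod (poly p 0) = cmod (lead_coeff p) * (\<Prod>a\<leftarrow>complex_roots_complex p. cmod a)"
    by (simp add: norm_mult)
  have 2: "(\<Prod>a\<leftarrow>xs. cmod a) \<le> (\<Prod>a\<leftarrow>xs. max 1 (cmod a)) \<and> 0 \<le> (\<Prod>a\<leftarrow>xs. cmod a)" for xs
    by (induction xs) (auto intro!: mult_mono)
  show ?thesis unfolding 1 mahler_measure_poly_def using 2 by (intro mult_left_mono) auto
qed

lemma mahler_ge_lead_coeff: "cmod (lead_coeff p) \<le> mahler_measure_poly p"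
proof -
  have "1 \<le> (\<Prod>a\<leftarrow>xs. max 1 (cmod a))" for xs
  proof (induction xs)
    case (Cons x xs)
    have "1 * 1 \<le> max 1 (cmod x) * (\<Prod>a\<leftarrow>xs. max 1 (cmod a))" using Cons by (intro mult_mono) auto
    then show ?case by simp
  qed simp
  then have "cmod (lead_coeff p) * 1 \<le> cmod (lead_coeff p) * (\<Prod>a\<leftarrow>complex_roots_complex p. max 1 (cmod a))"
    by (intro mult_left_mono) auto
  then show ?thesis by (simp add: mahler_measure_poly_def)
qed

text \<open>Landau's inequality, together with the fact that a sum of squares is at most the square
  of the sum of absolute values.\<close>

lemma mahler_le_l1: "mahler_measure_poly (map_poly of_int f) \<le> l1 f"
proof -
  have "(\<Sum>a\<leftarrow>coeffs f. a * a) = (\<Sum>i\<le>degree f. coeff f i * coeff f i)"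
  proof (cases "f = 0")
    case False
    then have "coeffs f = map (coeff f) [0..<Suc (degree f)]" by (simp add: coeffs_def)
    then show ?thesis by (simp add: sum_list_sum_nth o_def atLeast0LessThan lessThan_Suc_atMost
        interv_sum_list_conv_sum_set_nat del: upt_Suc)
  qed simp
  also have "\<dots> \<le> (\<Sum>i\<le>degree f. \<bar>coeff f i\<bar> * l1 f)"
  proof (rule sum_mono)
    fix i
    have "coeff f i * coeff f i = \<bar>coeff f i\<bar> * \<bar>coeff f i\<bar>" by simp
    also have "\<dots> \<le> \<bar>coeff f i\<bar> * l1 f" using coeff_le_l1[of f i] by (intro mult_left_mono) auto
    finally show "coeff f i * coeff f i \<le> \<bar>coeff f i\<bar> * l1 f" .
  qed
  also have "\<dots> = l1 f * l1 f" by (simp add: l1_def sum_distrib_right[symmetric])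
  finally have "real_of_int (\<Sum>a\<leftarrow>coeffs f. a * a) \<le> real_of_int (l1 f * l1 f)" by (simp only: of_int_le_iff)
  then have "sqrt (real_of_int (\<Sum>a\<leftarrow>coeffs f. a * a)) \<le> sqrt (real_of_int (l1 f * l1 f))" by (rule real_sqrt_le_mono)
  also have "\<dots> = l1 f" using l1_nonneg[of f] by (simp add: real_sqrt_mult_self)
  finally show ?thesis using Landau_inequality_mahler_measure[of f] by (simp add: mahler_measure_def)
qed

text \<open>Each quadratic splits as \<open>(X ^ e - s) (X ^ e - w)\<close>. The factors with
  \<open>s\<close> form a monic \<open>U\<close> whose constant term is the wanted product up to
  sign, so the product is at most the measure of \<open>U\<close>. The cofactor has the leading
  coefficient of \<open>f\<close>, a nonzero integer, hence measure at least 1, and the measure is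
  multiplicative.\<close>

lemma prod_large_roots_le_l1:
  fixes s w :: "complex \<Rightarrow> complex"
  assumes fin: "finite R" and e: "e > 0" and f: "f \<noteq> 0"
    and fac: "map_poly of_int f = (\<Prod>a\<in>R. quad e a) * S"
    and sw: "\<And>a. a \<in> R \<Longrightarrow> s a * w a = 1 \<and> a = s a + w a"
  shows "(\<Prod>a\<in>R. cmod (s a)) \<le> l1 f"
proof -
  let ?l = "\<lambda>c. Polynomial.monom 1 e - [:c:]"
  define U where "U = (\<Prod>a\<in>R. ?l (s a))"
  define V where "V = (\<Prod>a\<in>R. ?l (w a)) * S"
  have q: "quad e a = ?l (s a) * ?l (w a)" if a: "a \<in> R" for a
  proof (rule poly_eqI_nonzero)
    fix x
    have "(x ^ e - s a) * (x ^ e - w a) = (x ^ e)\<^sup>2 - (s a + w a) * x ^ e + s a * w a"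
      by (simp add: power2_eq_square algebra_simps)
    then show "poly (quad e a) x = poly (?l (s a) * ?l (w a)) x"
      using sw[OF a] by (simp add: poly_quad poly_monom)
  qed
  have UV: "map_poly of_int f = U * V"
    unfolding fac U_def V_def mult.assoc[symmetric] prod.distrib[symmetric] using q by simp
  have "lead_coeff (?l c) = 1" for c :: complex
  proof -
    have "degree (?l c) = e"
      using e by (intro antisym degree_le le_degree) (auto simp: coeff_pCons split: nat.split)
    then show ?thesis using e by (simp add: coeff_pCons split: nat.split)
  qed
  then have "lead_coeff U = 1" unfolding U_def lead_coeff_prod by simp
  then have "lead_coeff V = lead_coeff (U * V)" by (simp add: lead_coeff_mult)
  also have "\<dots> = of_int (lead_coeff f)" unfolding UV[symmetric] by simp
  finally have "cmod (lead_coeff V) = \<bar>real_of_int (lead_coeff f)\<bar>" by simp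
  moreover have "\<bar>lead_coeff f\<bar> \<ge> 1" using f leading_coeff_0_iff[of f] by linarith
  then have "\<bar>real_of_int (lead_coeff f)\<bar> \<ge> 1" by linarith
  ultimately have V1: "1 \<le> mahler_measure_poly V" using mahler_ge_lead_coeff[of V] by linarith
  have "poly U 0 = (\<Prod>a\<in>R. - s a)" unfolding U_def poly_prod using e by (simp add: poly_monom power_0_left)
  then have "cmod (poly U 0) = (\<Prod>a\<in>R. cmod (s a))" by (simp add: prod_norm[symmetric])
  then have U0: "(\<Prod>a\<in>R. cmod (s a)) \<le> mahler_measure_poly U" using mahler_ge_coeff_0[of U] by simp
  have "(\<Prod>a\<in>R. cmod (s a)) * 1 \<le> mahler_measure_poly U * mahler_measure_poly V"
    using U0 V1 order_trans[OF prod_nonneg U0] by (intro mult_mono) (auto intro: prod_nonneg)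
  also have "\<dots> = mahler_measure_poly (map_poly of_int f)" unfolding UV by (rule measure_eq_prod[symmetric])
  also have "\<dots> \<le> l1 f" by (rule mahler_le_l1)
  finally show ?thesis by simp
qed

text \<open>Euclid's argument; the explicit upper bound keeps \<open>Db\<close> computable.\<close>

lemma prime_between: "\<exists>p. prime p \<and> n < p \<and> p \<le> fact n + (1 :: nat)"
proof -
  have "(fact n :: nat) + 1 \<noteq> 1" by simp
  then have "\<exists>p::nat. prime p \<and> p dvd fact n + 1" by (rule prime_factor_nat)
  then obtain p :: nat where p: "prime p" "p dvd fact n + 1" by blast
  have "n < p"
  proof (rule ccontr)
    assume "\<not> n < p"
    then have "p dvd fact n" using prime_gt_0_nat[OF p(1)] by (intro dvd_fact) auto
    then have "p dvd 1" using p(2) by (metis dvd_add_right_iff)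
    then show False using prime_gt_1_nat[OF p(1)] by simp
  qed
  then show ?thesis using p dvd_imp_le[OF p(2)] by auto
qed

text \<open>
  A generator \<open>\<alpha>\<close> of \<open>\<rat>(l\<^sup>2)\<close>, namely \<open>l\<close> itself (\<open>e = 1\<close>) if \<open>l\<close> lies in this field and \<open>l\<^sup>2 - 2\<close>
  (\<open>e = 2\<close>) otherwise; \<open>l\<close> and \<open>\<epsilon> * l\<close> are the conjugates of \<open>l\<close> over the field.
\<close>

locale trace_data = rat_ext f \<alpha> for f \<alpha> +
  fixes e :: nat and \<psi> :: "rat poly" and \<epsilon> l :: complex
  assumes e: "e > 0" and degree_\<psi>: "degree \<psi> = e"
    and \<psi>_unit: "s * w = 1 \<Longrightarrow> rpoly \<psi> (s + w) = s ^ e + w ^ e"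
    and \<psi>_l: "rpoly \<psi> l = \<alpha>"
    and \<psi>_surj: "\<exists>b. rpoly \<psi> b = a"
    and \<epsilon>: "\<epsilon> = 1 \<or> \<epsilon> = - 1"
    and norm_poly: "\<exists>q. \<forall>x. rpoly q (rpoly \<psi> x) = rpoly r x * rpoly r (\<epsilon> * x)"
    and \<epsilon>_root: "rpoly r (\<epsilon> * l) = 0 \<Longrightarrow> rpoly r l = 0"
    and root_dvd: "rpoly r l = 0 \<Longrightarrow> pcompose f \<psi> dvd r"
    and \<psi>_growth: "1 \<le> cmod s \<Longrightarrow> cmod (rpoly \<psi> x) \<le> cmod s + 1 \<Longrightarrow> cmod x \<le> 2 * cmod s"

lemma trace_data_degree_1:
  assumes "rat_ext f l" shows "trace_data f l 1 [:0, 1:] 1 l"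
proof -
  interpret rat_ext f l by fact
  show ?thesis
  proof
    fix r :: "rat poly"
    show "\<exists>q. \<forall>x. rpoly q (rpoly [:0, 1:] x) = rpoly r x * rpoly r (1 * x)"
      by (intro exI[of _ "r * r"]) simp
    show "pcompose f [:0, 1:] dvd r" if "rpoly r l = 0"
      unfolding pcompose_idR using dvd_iff[OF \<alpha>_R, of r] that by simp
  qed auto
qed

text \<open>If \<open>l\<close> is not in the field of its square, its minimal polynomial is
  \<open>f(x\<^sup>2 - 2)\<close>. The shift by 2 is dictated by
  \<open>(s + w)\<^sup>2 - 2 = s\<^sup>2 + w\<^sup>2\<close>.\<close>

lemma trace_data_degree_2:
  assumes "rat_ext f (l\<^sup>2 - 2)" "l \<notin> rat_values (l\<^sup>2 - 2)"
  shows "trace_data f (l\<^sup>2 - 2) 2 [:-2, 0, 1:] (- 1) l"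
proof -
  interpret rat_ext f "l\<^sup>2 - 2" by fact
  let ?\<psi> = "[:-2, 0, 1:] :: rat poly"
  have \<psi>: "rpoly ?\<psi> x = x\<^sup>2 - 2" for x by (simp add: power2_eq_square of_rat_minus)
  have root: "pcompose f ?\<psi> dvd r" if r: "rpoly r l = 0" for r
  proof -
    obtain E O' where EO: "\<And>x. rpoly r x = rpoly E (x\<^sup>2) + x * rpoly O' (x\<^sup>2)"
      using even_odd_parts by blast
    let ?s = "\<lambda>p. pcompose p [:2, 1:] :: rat poly"
    have s: "rpoly (?s p) (x\<^sup>2 - 2) = rpoly p (x\<^sup>2)" for p x unfolding rpoly_pcompose by simp
    \<comment> \<open>Otherwise \<open>l\<close> would be the quotient of two elements of the field
      generated by its square.\<close>
    have "rpoly O' (l\<^sup>2) = 0"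
    proof (rule ccontr)
      assume nz: "rpoly O' (l\<^sup>2) \<noteq> 0"
      have "inverse (rpoly (?s O') (l\<^sup>2 - 2)) \<in> rat_values (l\<^sup>2 - 2)"
        using nz by (intro rat_values_inverse rat_valuesI) (simp only: s not_False_eq_True)
      then have "- (rpoly (?s E) (l\<^sup>2 - 2)) * inverse (rpoly (?s O') (l\<^sup>2 - 2)) \<in> rat_values (l\<^sup>2 - 2)"
        by (intro rat_values_mult rat_values_minus rat_valuesI)
      moreover have "l * rpoly O' (l\<^sup>2) = - rpoly E (l\<^sup>2)" using EO[of l] r by (simp add: eq_neg_iff_add_eq_0 add.commute)
      then have "- rpoly E (l\<^sup>2) * inverse (rpoly O' (l\<^sup>2)) = l" using nz by (simp add: field_simps)
      ultimately show False using assms(2) unfolding s by simp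
    qed
    moreover from this have "rpoly E (l\<^sup>2) = 0" using EO[of l] r by simp
    ultimately have "f dvd ?s E" "f dvd ?s O'"
      using dvd_iff[OF \<alpha>_R, of "?s E"] dvd_iff[OF \<alpha>_R, of "?s O'"] unfolding s by simp_all
    then obtain g h where gh: "?s E = f * g" "?s O' = f * h" by (auto elim!: dvdE)
    have "r = pcompose f ?\<psi> * (pcompose g ?\<psi> + [:0, 1:] * pcompose h ?\<psi>)"
    proof (rule rat_poly_eqI)
      fix x
      have g: "rpoly E (x\<^sup>2) = rpoly f (x\<^sup>2 - 2) * rpoly g (x\<^sup>2 - 2)" using s[of E x] unfolding gh by simp
      have h: "rpoly O' (x\<^sup>2) = rpoly f (x\<^sup>2 - 2) * rpoly h (x\<^sup>2 - 2)" using s[of O' x] unfolding gh by simp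
      show "rpoly r x = rpoly (pcompose f ?\<psi> * (pcompose g ?\<psi> + [:0, 1:] * pcompose h ?\<psi>)) x"
        unfolding EO[of x] g h rpoly_simps(1,4) rpoly_pcompose \<psi> by (simp add: algebra_simps)
    qed
    then show ?thesis by simp
  qed
  show ?thesis
  proof
    show "rpoly ?\<psi> (s + w) = s\<^sup>2 + w\<^sup>2" if "s * w = 1" for s w
      unfolding \<psi> using that by (simp add: power2_sum)
    show "rpoly ?\<psi> l = l\<^sup>2 - 2" by (rule \<psi>)
    show "\<exists>b. rpoly ?\<psi> b = a" for a by (intro exI[of _ "csqrt (a + 2)"]) (simp only: \<psi> power2_csqrt add_diff_cancel)
    show "\<exists>q. \<forall>x. rpoly q (rpoly ?\<psi> x) = rpoly r x * rpoly r (- 1 * x)" for r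
      using norm_form[of r] unfolding \<psi> by simp
    show "pcompose f ?\<psi> dvd r" if "rpoly r l = 0" for r using root[OF that] .
    \<comment> \<open>\<open>r(-x)\<close> vanishes at \<open>l\<close>, so it is divisible by the
      even polynomial \<open>f(x\<^sup>2 - 2)\<close> and vanishes at \<open>- l\<close>
      too.\<close>
    show "rpoly r l = 0" if r: "rpoly r (- 1 * l) = 0" for r
    proof -
      have "rpoly (pcompose r [:0, -1:]) l = 0" unfolding rpoly_pcompose using r by (simp add: of_rat_minus)
      then obtain g where g: "pcompose r [:0, -1:] = pcompose f ?\<psi> * g" using root by (metis dvdE)
      have "rpoly (pcompose r [:0, -1:]) (- l) = rpoly f ((- l)\<^sup>2 - 2) * rpoly g (- l)"
        unfolding g rpoly_simps(4) rpoly_pcompose \<psi> by (rule refl)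
      moreover have "rpoly f (l\<^sup>2 - 2) = 0" using \<alpha>_R by (simp add: R_def)
      ultimately show ?thesis unfolding rpoly_pcompose by (simp add: of_rat_minus)
    qed
    show "cmod x \<le> 2 * cmod s" if s: "1 \<le> cmod s" and x: "cmod (rpoly ?\<psi> x) \<le> cmod s + 1" for s x
    proof (rule power2_le_imp_le)
      have "cmod (x\<^sup>2) \<le> cmod (x\<^sup>2 - 2) + cmod 2" using norm_triangle_ineq[of "x\<^sup>2 - 2" 2] by simp
      then have "(cmod x)\<^sup>2 \<le> 4 * cmod s" using x s unfolding \<psi> by (simp add: norm_power)
      also have "\<dots> \<le> 4 * (cmod s * cmod s)" using mult_right_mono[OF s, of "cmod s"] by simp
      finally show "(cmod x)\<^sup>2 \<le> (2 * cmod s)\<^sup>2" by (simp add: power2_eq_square)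
    qed auto
  qed auto
qed

lemma rat_values_shift: "rat_values (x - 2) = rat_values x"
proof
  have "of_rat 2 \<in> rat_values y" for y by (rule rat_values_rat)
  then have 2: "2 \<in> rat_values y" for y by simp
  show "rat_values (x - 2) \<subseteq> rat_values x" by (intro rat_values_mono rat_values_diff rat_values_self 2)
  have "(x - 2) + 2 \<in> rat_values (x - 2)" by (intro rat_values_add rat_values_self 2)
  then have "x \<in> rat_values (x - 2)" by simp
  then show "rat_values x \<subseteq> rat_values (x - 2)" by (rule rat_values_mono)
qed

lemma trace_data_exists:
  assumes l: "algebraic_int l"
  shows "\<exists>f \<alpha> e \<psi> \<epsilon>. trace_data f \<alpha> e \<psi> \<epsilon> l \<and> rat_values \<alpha> = rat_adjoin (l\<^sup>2)"
proof -
  have l2: "algebraic_int (l\<^sup>2)" using l by (rule algebraic_int_power)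
  obtain g where "irreducible g" "lead_coeff g = 1" "rpoly g (l\<^sup>2) = 0" by (rule minimal_rpoly_exists[OF l2])
  then interpret S: rat_ext g "l\<^sup>2" by unfold_locales
  show ?thesis
  proof (cases "l \<in> rat_values (l\<^sup>2)")
    case True
    have "rat_values (l\<^sup>2) \<subseteq> rat_values l"
      unfolding power2_eq_square by (intro rat_values_mono rat_values_mult rat_values_self)
    then have eq: "rat_values l = rat_adjoin (l\<^sup>2)" using rat_values_mono[OF True] S.rat_adjoin_eq by auto
    obtain f where "irreducible f" "lead_coeff f = 1" "rpoly f l = 0" by (rule minimal_rpoly_exists[OF l])
    then have "rat_ext f l" by unfold_locales
    then show ?thesis using eq trace_data_degree_1 by blast
  next
    case False
    have "algebraic_int (l\<^sup>2 - 2)" using l2 by (intro algebraic_int_diff) auto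
    then obtain f where "irreducible f" "lead_coeff f = 1" "rpoly f (l\<^sup>2 - 2) = 0" by (rule minimal_rpoly_exists)
    then have "rat_ext f (l\<^sup>2 - 2)" by unfold_locales
    then show ?thesis using trace_data_degree_2 rat_values_shift[of "l\<^sup>2"] S.rat_adjoin_eq False by metis
  qed
qed

lemma real_unit_exists:
  fixes x :: real
  assumes "x > 2" shows "\<exists>u>1. x = u + 1 / u"
proof -
  define u where "u = (x + sqrt (x\<^sup>2 - 4)) / 2"
  have x4: "x\<^sup>2 - 4 > 0" using assms power_strict_mono[of 2 x 2] by simp
  then have "sqrt (x\<^sup>2 - 4) > 0" by simp
  then have "x + sqrt (x\<^sup>2 - 4) > 2" using assms by linarith
  then have u1: "u > 1" by (simp add: u_def)
  have "sqrt (x\<^sup>2 - 4) = 2 * u - x" by (simp add: u_def)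
  moreover have "(sqrt (x\<^sup>2 - 4))\<^sup>2 = x\<^sup>2 - 4" using x4 by simp
  ultimately have "(2 * u - x)\<^sup>2 = x\<^sup>2 - 4" by simp
  then have "u * u + 1 = x * u" by (simp add: power2_eq_square algebra_simps)
  then have "(u * u + 1) / u = x" using u1 by simp
  then have "x = u + 1 / u" using u1 by (simp add: add_divide_distrib)
  then show ?thesis using u1 by blast
qed

lemma unit_sum_gt_2: "2 < u + 1 / u" if u: "u > 1" for u :: real
proof -
  have "0 < (u - 1) * (1 - 1 / u)" using u by simp
  also have "\<dots> = u + 1 / u - 1 - u * (1 / u)" by (simp only: algebra_simps)
  also have "u * (1 / u) = 1" using u by simp
  finally show ?thesis by simp
qed

lemma unit_power_growth:
  fixes u :: real
  assumes u: "u > 1" and n: "n > 1" shows "u + 1 / u < u ^ n + (1 / u) ^ n"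
proof -
  define w where "w = 1 / u"
  have uw: "u * w = 1" and w: "0 < w" "w < 1" using u by (simp_all add: w_def)
  have un: "u < u ^ n" using power_strict_increasing[OF n u] by simp
  have uwn: "u ^ n * w ^ n = 1" using uw by (simp add: power_mult_distrib[symmetric])
  have "w ^ n \<le> 1" using w by (simp add: power_le_one)
  then have "w * w ^ n < 1" using w mult_left_mono[of "w ^ n" 1 w] by linarith
  then have "0 < (u ^ n - u) * (1 - w * w ^ n)" using un by simp
  also have "\<dots> = u ^ n - u - w * (u ^ n * w ^ n) + (u * w) * w ^ n" by (simp only: algebra_simps)
  also have "\<dots> = u ^ n + w ^ n - (u + w)" unfolding uw uwn by simp
  finally show ?thesis by (simp add: w_def)
qed

lemma not_stable_under_power:
  fixes R' :: "real set"
  assumes fin: "finite R'" and x: "x \<in> R'" "x > 2" and n: "n > 1"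
  shows "\<exists>u>1. u + 1 / u \<in> R' \<and> u ^ n + (1 / u) ^ n \<notin> R'"
proof -
  define y where "y = Max R'"
  have y: "y \<in> R'" "\<And>z. z \<in> R' \<Longrightarrow> z \<le> y" using fin x unfolding y_def by (auto intro: Max_in)
  then have "y > 2" using x by force
  then obtain u where u: "u > 1" "y = u + 1 / u" using real_unit_exists by blast
  have "y < u ^ n + (1 / u) ^ n" unfolding u(2) by (rule unit_power_growth[OF u(1) n])
  then have "u ^ n + (1 / u) ^ n \<notin> R'" using y(2) by force
  then show ?thesis using u y(1) by blast
qed

section \<open>Two opposite bounds for the degree\<close>

context poly_rec begin

text \<open>
  \<open>Lb\<close> bounds the Mahler measure of \<open>FF m\<close>, \<open>Cb\<close> governs the size of the conjugates of \<open>Y\<close>, \<open>Db\<close> bounds the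
  degree of an abelian field \<open>\<rat>(l\<^sup>2)\<close>, and from \<open>m = mb\<close> on the degree exceeds \<open>Db\<close>.
\<close>

definition Lb :: nat where "Lb = 2 * h1"
definition Cb :: nat where "Cb = 3 * c0\<^sup>2 * 2 ^ (2 * k + 2)"
definition Db :: nat where "Db = 4 * k + 3 + Lb * (fact h2 + 2)"
definition mb :: nat where "mb = 14 * (Cb * Db + Lb * (2 * k + 2) + 1)"

end

locale tail_root = poly_rec P k + trace_data f \<alpha> e \<psi> \<epsilon> "complex_of_real l"
  for P k f \<alpha> e \<psi> \<epsilon> l +
  fixes m :: nat and t :: real
  assumes m: "m > 0" and t: "t > 1" and l: "l = t + 1 / t"
    and l_root: "ipoly (P m) (complex_of_real l) = 0"
    and l_nonroot: "ipoly (P (m - 1)) (complex_of_real l) \<noteq> 0"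
begin

lemma algebraic_int_l: "algebraic_int (complex_of_real l)"
  using l_root P_monic[of m] by (auto simp: algebraic_int_altdef_ipoly)

lemma \<alpha>_real: "\<alpha> = complex_of_real (t ^ e + (1 / t) ^ e)"
  using \<psi>_unit[of "complex_of_real t" "complex_of_real (1 / t)"] \<psi>_l t by (simp add: l)

lemma algebraic_int_\<alpha>: "algebraic_int \<alpha>"
proof -
  have tw: "complex_of_real t * complex_of_real (1 / t) = 1" "complex_of_real (1 / t) * complex_of_real t = 1"
    using t by simp_all
  have "algebraic_int (complex_of_real t + complex_of_real (1 / t))" using algebraic_int_l by (simp add: l)
  then have "algebraic_int (complex_of_real t)" by (rule algebraic_int_unit[OF tw(1)])
  moreover have "algebraic_int (complex_of_real (1 / t) + complex_of_real t)" using algebraic_int_l by (simp add: l add.commute)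
  then have "algebraic_int (complex_of_real (1 / t))" by (rule algebraic_int_unit[OF tw(2)])
  ultimately have "algebraic_int (complex_of_real t ^ e + complex_of_real (1 / t) ^ e)"
    by (intro algebraic_int_add_mult(1) algebraic_int_power)
  then show ?thesis unfolding \<alpha>_real of_real_add of_real_power .
qed

lemma \<alpha>_gt_2: "t ^ e + (1 / t) ^ e > 2"
proof -
  have "1 < t ^ e" using t e by (rule one_less_power)
  then have "2 < t ^ e + 1 / t ^ e" by (rule unit_sum_gt_2)
  then show ?thesis by (simp only: power_one_over)
qed

text \<open>\<open>f(\<psi>(x))\<close> divides \<open>P m\<close>, and at
  \<open>x = t + 1/t\<close> it becomes the product of \<open>t ^ e + 1 / t ^ e - a\<close> over the
  conjugates; clearing denominators gives the quadratics. The cofactor is integral because their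
  product is monic and integral.\<close>

lemma FF_factor: "\<exists>S. map_poly of_int (FF m) = (\<Prod>a\<in>R. quad e a) * S \<and> alg_poly S"
proof -
  have "rpoly (map_poly of_int (P m)) (complex_of_real l) = 0" using l_root by (simp add: int_poly_rpoly)
  then have "pcompose f \<psi> dvd map_poly of_int (P m)" by (rule root_dvd)
  then obtain g where g: "map_poly of_int (P m) = pcompose f \<psi> * g" by (rule dvdE)
  have "P m \<noteq> 0" using P_monic[of m] by auto
  then have "map_poly of_int (P m) \<noteq> (0 :: rat poly)" by simp
  then have nz: "pcompose f \<psi> \<noteq> 0 \<and> g \<noteq> 0" unfolding g by simp
  have "degree (map_poly of_int (P m) :: rat poly) = k + m" using P_degree[of m] by simp
  then have "degree (pcompose f \<psi> * g) = k + m" unfolding g .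
  moreover have "degree (pcompose f \<psi> * g) = degree (pcompose f \<psi>) + degree g"
    using nz by (simp add: degree_mult_eq)
  moreover have "degree (pcompose f \<psi>) = card R * e" unfolding degree_pcompose degree_\<psi> card_R by (rule refl)
  ultimately have d: "k + m = e * card R + degree g" by (simp only: mult.commute)
  define g' :: "complex poly" where "g' = map_poly of_rat g"
  define S where "S = [:-1, 0, 1:] * hat (degree g) g'"
  have "map_poly of_int (FF m) = (\<Prod>a\<in>R. quad e a) * S"
  proof (rule poly_eqI_nonzero)
    fix x :: complex assume "x \<noteq> 0"
    then have xw: "x * inverse x = 1" by simp
    define w where "w = inverse x"
    have xw: "x * w = 1" using xw by (simp add: w_def)
    have "rpoly f (rpoly \<psi> (x + w)) = (\<Prod>a\<in>R. x ^ e + w ^ e - a)"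
      unfolding \<psi>_unit[OF xw] F_def[symmetric] by (subst F_prod) (simp add: poly_prod)
    moreover have "ipoly (P m) (x + w) = rpoly f (rpoly \<psi> (x + w)) * poly g' (x + w)"
      unfolding int_poly_rpoly g rpoly_simps(4) rpoly_pcompose g'_def by (rule refl)
    ultimately have v: "ipoly (P m) (x + w) = (\<Prod>a\<in>R. x ^ e + w ^ e - a) * poly g' (x + w)" by (simp only:)
    have q: "poly (quad e a) x = x ^ e * (x ^ e + w ^ e - a)" for a
    proof -
      have "x ^ e * w ^ e = 1" using xw by (simp add: power_mult_distrib[symmetric])
      then show ?thesis by (simp add: poly_quad algebra_simps power2_eq_square)
    qed
    have L: "poly (hat (k + m) (map_poly of_int (P m))) x = x ^ (k + m) * ipoly (P m) (x + w)"
      using xw P_degree[of m] by (intro poly_hat) auto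
    have H: "poly (hat (degree g) g') x = x ^ degree g * poly g' (x + w)"
      using xw by (intro poly_hat) (auto simp: g'_def)
    have "x ^ (k + m) * ipoly (P m) (x + w) = (\<Prod>a\<in>R. x ^ e * (x ^ e + w ^ e - a)) * (x ^ degree g * poly g' (x + w))"
      unfolding v d by (simp add: prod.distrib power_add power_mult)
    then show "ipoly (FF m) x = poly ((\<Prod>a\<in>R. quad e a) * S) x"
      unfolding FF_hat S_def poly_mult L H poly_prod q by (simp only: mult_ac)
  qed
  note fac = this
  have "alg_poly (\<Prod>a\<in>R. quad e a)"
  proof (intro alg_poly_prod alg_poly_quad)
    fix a assume a: "a \<in> R"
    have "algebraic_int (\<sigma> a \<alpha>)" using algebraic_int_\<alpha> by (intro \<sigma>_algebraic_int[OF a rat_values_self])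
    then show "algebraic_int a" using \<sigma>_\<alpha>[OF a] by simp
  qed
  moreover have "alg_poly ((\<Prod>a\<in>R. quad e a) * S)" unfolding fac[symmetric] by (rule alg_poly_of_int)
  ultimately have "alg_poly S" by (rule alg_poly_monic_factor[OF _ monic_prod_quad(1)[OF e]])
  then show ?thesis using fac by (intro exI[of _ S] conjI)
qed

lemma large_units:
  "\<exists>s w. (\<forall>a. s a * w a = 1 \<and> s a + w a = a \<and> 1 \<le> cmod (s a) \<and> cmod (w a) \<le> 1) \<and> (\<Prod>a\<in>R. cmod (s a)) \<le> real Lb"
proof -
  have "\<forall>a. \<exists>s w. s * w = 1 \<and> a = s + w \<and> cmod s \<ge> 1 \<and> cmod w \<le> 1" using large_unit_exists by (intro allI)
  then obtain s where "\<forall>a. \<exists>w. s a * w = 1 \<and> a = s a + w \<and> cmod (s a) \<ge> 1 \<and> cmod w \<le> 1" by (rule choice[THEN exE])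
  then obtain w where sw: "\<forall>a. s a * w a = 1 \<and> a = s a + w a \<and> cmod (s a) \<ge> 1 \<and> cmod (w a) \<le> 1" by (rule choice[THEN exE])
  have sw1: "s a * w a = 1 \<and> a = s a + w a" for a using spec[OF sw, of a] by (elim conjE) (intro conjI, assumption+)
  obtain S where S: "map_poly of_int (FF m) = (\<Prod>a\<in>R. quad e a) * S" using FF_factor by blast
  have "(\<Prod>a\<in>R. cmod (s a)) \<le> real_of_int (l1 (FF m))"
    by (rule prod_large_roots_le_l1[OF fin_R e FF_nz S sw1])
  also have "\<dots> \<le> real_of_int (2 * int h1)" using l1_FF[of m] by (rule of_int_le_iff[THEN iffD2])
  also have "\<dots> = real Lb" by (simp add: Lb_def)
  finally have le: "(\<Prod>a\<in>R. cmod (s a)) \<le> real Lb" .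
  have "\<forall>a. s a * w a = 1 \<and> s a + w a = a \<and> 1 \<le> cmod (s a) \<and> cmod (w a) \<le> 1"
  proof
    fix a show "s a * w a = 1 \<and> s a + w a = a \<and> 1 \<le> cmod (s a) \<and> cmod (w a) \<le> 1"
      using spec[OF sw, of a] by (elim conjE) (intro conjI, assumption, rule sym, assumption+)
  qed
  then show ?thesis using le by blast
qed

text \<open>\<open>(t - 1)\<^sup>2 = t * (l - 2)\<close> is at least \<open>1/192\<close>, hence
  above the square of \<open>1/14\<close>, and Bernoulli's inequality gives
  \<open>t ^ 14 \<ge> 2\<close>. This is where the 14 in \<open>mb\<close> comes from.\<close>

lemma two_le_power: "2 ^ n \<le> t ^ (14 * n)" if l2: "l \<ge> 2 + 1 / 192"
proof -
  have "t * l = t * t + 1" using t unfolding l distrib_left by simp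
  then have "(t - 1)\<^sup>2 = t * (l - 2)" unfolding power2_eq_square left_diff_distrib right_diff_distrib by simp
  also have "\<dots> \<ge> 1 * (1 / 192)" using t l2 by (intro mult_mono) auto
  finally have "(1 / 14)\<^sup>2 \<le> (t - 1)\<^sup>2" by (simp add: power2_eq_square)
  then have "1 / 14 \<le> t - 1" using t by (intro power2_le_imp_le[of "1 / 14"]) auto
  then have "2 \<le> 1 + real 14 * (t - 1)" by simp
  also have "\<dots> \<le> (1 + (t - 1)) ^ 14" using t by (intro Bernoulli_inequality) auto
  finally have "2 \<le> t ^ 14" by simp
  then have "2 ^ n \<le> (t ^ 14) ^ n" by (intro power_mono) auto
  then show ?thesis by (simp add: power_mult)
qed

text \<open>The norm of the nonzero algebraic integer \<open>q(\<alpha>)\<close> is at least 1.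
  Every conjugate is at most \<open>H a * H a\<close>, and the one at \<open>\<alpha>\<close> is
  smaller by \<open>t ^ (2 * m)\<close>; so \<open>t ^ m\<close> is at most the product of the
  \<open>H a\<close>, that is \<open>Cb ^ card R\<close> times a power of the bounded product of the
  units. A small degree is then incompatible with large \<open>m\<close>.\<close>

lemma degree_gt:
  assumes ab: "abelian_ext f \<alpha>" and l2: "l \<ge> 2 + 1 / 192" and mm: "m \<ge> mb"
  shows "card R > Db"
proof (rule ccontr)
  assume "\<not> card R > Db"
  then have dD: "card R \<le> Db" by simp
  interpret A: abelian_ext f \<alpha> by fact
  obtain s w where sw: "\<forall>a. s a * w a = 1 \<and> s a + w a = a \<and> 1 \<le> cmod (s a) \<and> cmod (w a) \<le> 1"
    and Pi: "(\<Prod>a\<in>R. cmod (s a)) \<le> real Lb" using large_units by blast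
  have s1: "1 \<le> cmod (s a)" for a using sw by blast
  let ?E = "2 * k + 2" and ?l = "complex_of_real l"
  define H where "H a = real Cb * cmod (s a) ^ ?E" for a
  have root_le: "cmod b \<le> 2 * cmod (s (rpoly \<psi> b))" for b
  proof (rule \<psi>_growth[OF s1])
    let ?a = "rpoly \<psi> b"
    have "s ?a + w ?a = ?a" using sw by blast
    then have "cmod ?a \<le> cmod (s ?a) + cmod (w ?a)" by (metis norm_triangle_ineq)
    also have "\<dots> \<le> cmod (s ?a) + 1" using sw by simp
    finally show "cmod ?a \<le> cmod (s ?a) + 1" .
  qed
  have c0': "real_of_int (l1 Y) \<le> 3 * real c0 ^ 2"
  proof -
    have "real_of_int (l1 Y) \<le> real_of_int (3 * int c0 ^ 2)" using l1_Y by (rule of_int_le_iff[THEN iffD2])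
    then show ?thesis by simp
  qed
  have Y_le: "cmod (ipoly Y x) \<le> H a" if x: "cmod x \<le> 2 * cmod (s a)" for x a
  proof -
    have "cmod (ipoly Y x) \<le> l1 Y * (2 * cmod (s a)) ^ ?E"
      using s1[of a] x by (intro cmod_poly_le_l1[OF degree_Y]) auto
    also have "\<dots> \<le> (3 * real c0 ^ 2) * (2 * cmod (s a)) ^ ?E" using c0' by (intro mult_right_mono) auto
    also have "\<dots> = H a" by (simp add: H_def Cb_def power_mult_distrib)
    finally show ?thesis .
  qed
  \<comment> \<open>For \<open>\<epsilon> = -1\<close> this is the relative norm of
    \<open>Y(l)\<close>, for \<open>\<epsilon> = 1\<close> its square; either way there are two
    factors of equal bound.\<close>
  obtain q where q: "\<And>x. rpoly q (rpoly \<psi> x) = ipoly Y x * ipoly Y (\<epsilon> * x)"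
    using norm_poly[of "map_poly of_int Y"] unfolding int_poly_rpoly[symmetric] by blast
  have eps: "cmod (\<epsilon> * x) = cmod x" for x using \<epsilon> by (auto simp: norm_mult)
  have H0: "0 \<le> H a" for a by (simp add: H_def)
  have q_le: "cmod (rpoly q a) \<le> H a * H a" for a
  proof -
    obtain b where b: "rpoly \<psi> b = a" using \<psi>_surj by blast
    have "cmod b \<le> 2 * cmod (s a)" using root_le[of b] unfolding b .
    then have "cmod (ipoly Y b) * cmod (ipoly Y (\<epsilon> * b)) \<le> H a * H a"
      using H0 by (intro mult_mono Y_le) (auto simp: eps)
    then show ?thesis using q[of b] unfolding b by (simp add: norm_mult)
  qed
  have q_\<alpha>: "cmod (rpoly q \<alpha>) * t ^ (2 * m) \<le> H \<alpha> * H \<alpha>"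
  proof -
    let ?S = "cmod (s \<alpha>)"
    have l_le: "cmod ?l \<le> 2 * ?S" using root_le[of ?l] unfolding \<psi>_l .
    have small: "cmod (ipoly p ?l) \<le> real c0 * (2 * ?S) ^ k" if p: "degree p \<le> k" "l1 p \<le> c0" for p
    proof -
      have "cmod (ipoly p ?l) \<le> l1 p * (2 * ?S) ^ k"
        using s1[of \<alpha>] l_le by (intro cmod_poly_le_l1[OF p(1)]) auto
      also have "\<dots> \<le> real c0 * (2 * ?S) ^ k"
      proof (rule mult_right_mono)
        show "real_of_int (l1 p) \<le> real c0" using p(2) by linarith
      qed auto
      finally show ?thesis .
    qed
    have "cmod (ipoly Y ?l) * t ^ (2 * m) \<le> (cmod (ipoly (P 0) ?l) + cmod (ipoly Q ?l))\<^sup>2"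
      by (rule Y_root_small[OF m t l l_root l_nonroot])
    also have "\<dots> \<le> (real c0 * (2 * ?S) ^ k + real c0 * (2 * ?S) ^ k)\<^sup>2"
      by (intro power_mono add_mono small degree_P0 degree_Q l1_bounds) auto
    also have "\<dots> = real c0 ^ 2 * (2 * ?S) ^ (2 * k) * 4"
    proof -
      have "(c * y + c * y)\<^sup>2 = c\<^sup>2 * y\<^sup>2 * 4" for c y :: real by (simp add: power2_eq_square)
      then show ?thesis unfolding power_even_eq[of "2 * ?S" k] .
    qed
    \<comment> \<open>The surplus factor \<open>3 * (?S * ?S)\<close>, at least 1, gives the bound
      the shape \<open>H \<alpha>\<close> used for all conjugates.\<close>
    also have "\<dots> \<le> real c0 ^ 2 * (2 * ?S) ^ (2 * k) * (12 * (?S * ?S))"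
    proof (rule mult_left_mono)
      have "1 * 1 \<le> ?S * ?S" using s1[of \<alpha>] by (intro mult_mono) auto
      then show "4 \<le> 12 * (?S * ?S)" by simp
      show "0 \<le> real c0 ^ 2 * (2 * ?S) ^ (2 * k)" by (intro mult_nonneg_nonneg zero_le_power) auto
    qed
    also have "\<dots> = H \<alpha>"
    proof -
      have "c\<^sup>2 * (2 * y) ^ (2 * k) * (12 * (y * y)) = 3 * c\<^sup>2 * 2 ^ (2 * k + 2) * y ^ (2 * k + 2)" for c y :: real
        by (simp add: power_mult_distrib power_add power2_eq_square)
      then show ?thesis by (simp add: H_def Cb_def)
    qed
    finally have "cmod (ipoly Y ?l) * t ^ (2 * m) * cmod (ipoly Y (\<epsilon> * ?l)) \<le> H \<alpha> * H \<alpha>"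
      using H0 l_le by (intro mult_mono Y_le) (auto simp: eps)
    then show ?thesis using q[of ?l] unfolding \<psi>_l by (simp add: norm_mult mult_ac)
  qed
  have "1 \<le> (\<Prod>a\<in>R. cmod (\<sigma> a (rpoly q \<alpha>)))"
  proof (rule A.norm_ge_1[OF rat_valuesI])
    have eq: "rpoly q \<alpha> = ipoly Y ?l * ipoly Y (\<epsilon> * ?l)" using q[of ?l] unfolding \<psi>_l .
    have "ipoly Y ?l \<noteq> 0" by (rule Y_root_nz[OF m t l l_root l_nonroot])
    moreover from this have "ipoly Y (\<epsilon> * ?l) \<noteq> 0" using \<epsilon>_root[of "map_poly of_int Y"] unfolding int_poly_rpoly by blast
    ultimately show "rpoly q \<alpha> \<noteq> 0" unfolding eq by simp
    have "algebraic_int \<epsilon>" using \<epsilon> by auto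
    then show "algebraic_int (rpoly q \<alpha>)" unfolding eq
      using algebraic_int_l by (intro algebraic_int_intros alg_poly_poly alg_poly_of_int)
  qed
  also have "\<dots> = (\<Prod>a\<in>R. cmod (rpoly q a))" by (intro prod.cong refl) (simp add: \<sigma>_rpoly)
  finally have norm1: "1 \<le> (\<Prod>a\<in>R. cmod (rpoly q a))" .
  let ?q' = "\<Prod>a\<in>R - {\<alpha>}. cmod (rpoly q a)" and ?H' = "\<Prod>a\<in>R - {\<alpha>}. H a * H a"
  have le': "?q' \<le> ?H'" by (intro prod_mono conjI q_le) auto
  have nn: "0 \<le> ?q'" "0 \<le> H \<alpha> * H \<alpha>" using H0 by (auto intro: prod_nonneg)
  have split_q: "(\<Prod>a\<in>R. cmod (rpoly q a)) = cmod (rpoly q \<alpha>) * ?q'" by (rule prod.remove[OF fin_R \<alpha>_R])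
  have split_H: "(\<Prod>a\<in>R. H a * H a) = H \<alpha> * H \<alpha> * ?H'" by (rule prod.remove[OF fin_R \<alpha>_R])
  have "(t ^ m)\<^sup>2 = t ^ (2 * m) * 1" by (simp add: power_mult[symmetric] mult.commute)
  then have "(t ^ m)\<^sup>2 \<le> t ^ (2 * m) * (cmod (rpoly q \<alpha>) * ?q')"
    using mult_left_mono[OF norm1, of "t ^ (2 * m)"] t unfolding split_q by simp
  then have "(t ^ m)\<^sup>2 \<le> (cmod (rpoly q \<alpha>) * t ^ (2 * m)) * ?q'" by (simp only: mult_ac)
  then have "(t ^ m)\<^sup>2 \<le> (H \<alpha> * H \<alpha>) * ?H'" using mult_mono[OF q_\<alpha> le' nn(2) nn(1)] by (rule order_trans)
  moreover have "(\<Prod>a\<in>R. H a * H a) = (\<Prod>a\<in>R. H a)\<^sup>2" unfolding prod.distrib power2_eq_square by (rule refl)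
  ultimately have "(t ^ m)\<^sup>2 \<le> (\<Prod>a\<in>R. H a)\<^sup>2" unfolding split_H by simp
  then have "t ^ m \<le> (\<Prod>a\<in>R. H a)" by (rule power2_le_imp_le) (intro prod_nonneg ballI H0)
  moreover have "(\<Prod>a\<in>R. H a) = real Cb ^ card R * (\<Prod>a\<in>R. cmod (s a)) ^ ?E"
    unfolding H_def prod.distrib prod_power_distrib[symmetric] prod_constant by (rule refl)
  \<comment> \<open>Through \<open>n \<le> 2 ^ n\<close> all constants become powers of 2, so
    \<open>mb\<close> needs no logarithms.\<close>
  moreover have "real Cb ^ card R * (\<Prod>a\<in>R. cmod (s a)) ^ ?E \<le> (2 ^ Cb) ^ card R * (2 ^ Lb) ^ ?E"
  proof (intro mult_mono power_mono)
    have b: "real n \<le> 2 ^ n" for n using less_exp[of n] by (metis of_nat_less_numeral_power_cancel_iff less_imp_le)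
    show "real Cb \<le> 2 ^ Cb" by (rule b)
    show "(\<Prod>a\<in>R. cmod (s a)) \<le> 2 ^ Lb" using Pi b[of Lb] by linarith
  qed (simp_all add: prod_nonneg del: power_Suc power_add add_2_eq_Suc')
  moreover have "(2 ^ Cb) ^ card R * (2 ^ Lb) ^ ?E = (2 :: real) ^ (Cb * card R + Lb * ?E)"
    unfolding power_add power_mult by (rule refl)
  moreover have "(2 :: real) ^ (Cb * card R + Lb * ?E) < 2 ^ (Cb * Db + Lb * ?E + 1)"
    using mult_le_mono2[OF dD, of Cb] by (intro power_strict_increasing) (simp_all add: le_imp_less_Suc)
  moreover have "(2 :: real) ^ (Cb * Db + Lb * ?E + 1) \<le> t ^ mb" unfolding mb_def by (rule two_le_power[OF l2])
  moreover have "t ^ mb \<le> t ^ m" using mm t by (intro power_increasing) auto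
  ultimately show False by linarith
qed

text \<open>A degree above \<open>4 * k + 3\<close> exceeds that of \<open>W m\<close>, so
  \<open>abelian_frobenius\<close> applies to a prime between \<open>h2\<close> and
  \<open>fact h2 + 1\<close>. The other summand of \<open>Db\<close> results from comparing
  \<open>p ^ card R\<close> with the size of the norm.\<close>

lemma degree_le:
  assumes ab: "abelian_number_field (rat_values \<alpha>)"
  shows "card R \<le> Db"
proof (rule ccontr)
  assume "\<not> card R \<le> Db"
  then have dD: "card R > Db" by simp
  interpret A: abelian_ext f \<alpha> by (rule abelian_extI[OF ab])
  obtain s w where sw: "\<forall>a. s a * w a = 1 \<and> s a + w a = a \<and> 1 \<le> cmod (s a) \<and> cmod (w a) \<le> 1"
    and Pi: "(\<Prod>a\<in>R. cmod (s a)) \<le> real Lb" using large_units by blast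
  have s1: "1 \<le> cmod (s a)" for a using sw by blast
  have w1: "cmod (w a) \<le> 1" for a using sw by blast
  have u: "s a * w a = 1" "w a * s a = 1" for a using sw mult.commute by metis+
  have sum: "s a + w a = a" "w a + s a = a" for a using sw add.commute by metis+
  obtain p where p: "prime p" "h2 < p" "p \<le> fact h2 + 1" using prime_between by blast
  have p8: "8 \<le> p" using p(2) by (simp add: h2_def)
  obtain I where I: "prime_ideal_over I p" using ex_prime_ideal_over[OF p(1)] by blast
  interpret I: prime_ideal_over I p by (rule I)
  obtain S where S: "map_poly of_int (FF m) = (\<Prod>a\<in>R. quad e a) * S" "alg_poly S" using FF_factor by blast
  let ?c = "map_poly of_int :: int poly \<Rightarrow> complex poly"
  have alg: "algebraic_int a" if "a \<in> R" for a using A.R_algebraic_int[OF algebraic_int_\<alpha> that] .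
  have T_value: "ipoly (cheb p) a = s a ^ p + w a ^ p" for a
    using cheb_value[OF u(1)[of a], of p] unfolding sum(1) .
  \<comment> \<open>\<open>s a\<close> and \<open>w a\<close> are algebraic integers, possibly
    outside the field, so \<open>freshman\<close> for their sum gives the congruence.\<close>
  have T: "ipoly (cheb p) a - a ^ p \<in> I" if a: "a \<in> R" for a
  proof -
    have "algebraic_int (s a)" by (rule algebraic_int_unit[OF u(1)]) (simp only: sum alg[OF a])
    moreover have "algebraic_int (w a)" by (rule algebraic_int_unit[OF u(2)]) (simp only: sum alg[OF a])
    ultimately have "- ((s a + w a) ^ p - (s a ^ p + w a ^ p)) \<in> I" by (intro I.I_neg I.freshman)
    then show ?thesis unfolding T_value sum(1) minus_diff_eq .
  qed
  obtain i where i: "\<not> int p dvd coeff (W m) i" using W_not_0_mod[OF m t l l_root l_nonroot p(1,2)] by blast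
  have Wi: "coeff (?c (W m)) i \<notin> I" using i by (simp add: coeff_map_poly I.of_int_in_iff)
  have W: "?c (W m) = ?c ([:0, 1:] * A) * pderiv (?c (FF m)) - ?c (FF m) * ?c (smult (int (2 * m + 1)) A + [:0, 1:] * pderiv A)"
    unfolding of_int_hom.map_poly_pderiv[symmetric] of_int_poly_hom.hom_mult[symmetric] of_int_poly_hom.hom_minus[symmetric] W_eq by (rule refl)
  have "degree (?c (W m)) \<le> 4 * k + 3" using degree_W[of m] by simp
  also have "\<dots> < card R" using dD by (simp add: Db_def)
  also have "\<dots> \<le> e * card R" using e by simp
  finally have deg: "degree (?c (W m)) < e * card R" .
  have "(\<forall>a\<in>R. ipoly (cheb p) a \<in> R) \<or>
    (\<exists>\<pi>. bij_betw \<pi> R R \<and> real p ^ card R \<le> (\<Prod>a\<in>R. cmod (\<pi> a - ipoly (cheb p) a)))"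
    by (rule abelian_frobenius[OF ab rat_ext_axioms algebraic_int_\<alpha> I refl e T S W alg_poly_of_int alg_poly_of_int deg Wi])
  then show False
  proof
    assume stable: "\<forall>a\<in>R. ipoly (cheb p) a \<in> R"
    let ?R' = "{x :: real. complex_of_real x \<in> R}"
    have "finite ?R'"
    proof (rule finite_imageD)
      show "finite (complex_of_real ` ?R')" by (rule finite_subset[OF _ fin_R]) auto
      show "inj_on complex_of_real ?R'" by (auto intro: inj_onI)
    qed
    moreover have "t ^ e + (1 / t) ^ e \<in> ?R'" using \<alpha>_R unfolding \<alpha>_real by simp
    moreover have "1 < p" using p8 by simp
    ultimately obtain u where u: "u > 1" "u + 1 / u \<in> ?R'" "u ^ p + (1 / u) ^ p \<notin> ?R'"
      using not_stable_under_power[OF _ _ \<alpha>_gt_2] by blast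
    have "complex_of_real u * complex_of_real (1 / u) = 1" using u(1) by simp
    then have "ipoly (cheb p) (complex_of_real u + complex_of_real (1 / u)) = complex_of_real u ^ p + complex_of_real (1 / u) ^ p"
      by (rule cheb_value)
    then have "ipoly (cheb p) (complex_of_real (u + 1 / u)) = complex_of_real (u ^ p + (1 / u) ^ p)"
      by (simp only: of_real_add of_real_power)
    then show False using stable u(2,3) by auto
  next
    assume "\<exists>\<pi>. bij_betw \<pi> R R \<and> real p ^ card R \<le> (\<Prod>a\<in>R. cmod (\<pi> a - ipoly (cheb p) a))"
    then obtain \<pi> where bij: "bij_betw \<pi> R R"
      and le: "real p ^ card R \<le> (\<Prod>a\<in>R. cmod (\<pi> a - ipoly (cheb p) a))" by blast
    let ?n = "\<lambda>a. cmod (s a)"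
    \<comment> \<open>Both numbers are at most twice their large-unit parts, and for reals at least
      1 a sum is at most twice the product.\<close>
    have term_le: "cmod (\<pi> a - ipoly (cheb p) a) \<le> 4 * (?n (\<pi> a) * ?n a ^ p)" for a
    proof -
      have "cmod (\<pi> a) \<le> ?n (\<pi> a) + cmod (w (\<pi> a))" using norm_triangle_ineq[of "s (\<pi> a)" "w (\<pi> a)"] unfolding sum .
      then have 1: "cmod (\<pi> a) \<le> 2 * ?n (\<pi> a)" using s1[of "\<pi> a"] w1[of "\<pi> a"] by linarith
      have sp: "1 \<le> ?n a ^ p" using s1[of a] by (rule one_le_power)
      have "cmod (w a) ^ p \<le> 1" using w1[of a] by (intro power_le_one) auto
      moreover have "cmod (ipoly (cheb p) a) \<le> ?n a ^ p + cmod (w a) ^ p"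
        unfolding T_value norm_power[symmetric] by (rule norm_triangle_ineq)
      ultimately have 2: "cmod (ipoly (cheb p) a) \<le> 2 * ?n a ^ p" using sp by linarith
      have 3: "x + y \<le> 2 * (x * y)" if "1 \<le> x" "1 \<le> y" for x y :: real
      proof -
        have "0 \<le> (x - 1) * (y - 1)" "0 \<le> x * (y - 1)" "0 \<le> (x - 1) * y" using that by auto
        then show ?thesis unfolding left_diff_distrib right_diff_distrib using that by linarith
      qed
      have "cmod (\<pi> a - ipoly (cheb p) a) \<le> cmod (\<pi> a) + cmod (ipoly (cheb p) a)" by (rule norm_triangle_ineq4)
      then show ?thesis using 1 2 3[OF s1[of "\<pi> a"] sp] by linarith
    qed
    let ?P = "\<Prod>a\<in>R. ?n a"
    have P0: "0 \<le> ?P" by (simp add: prod_nonneg)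
    \<comment> \<open>\<open>p \<ge> 8\<close> leaves a factor \<open>2 ^ card R\<close> after
      \<open>4 ^ card R\<close> is cancelled; what it is compared with, a power of the product of
      the units, is bounded independently of the degree.\<close>
    have "4 ^ card R * 2 ^ card R = (8 :: real) ^ card R" by (simp add: power_mult_distrib[symmetric])
    also have "\<dots> \<le> real p ^ card R" using p8 by (intro power_mono) auto
    also have "\<dots> \<le> (\<Prod>a\<in>R. 4 * (?n (\<pi> a) * ?n a ^ p))"
      by (rule order_trans[OF le]) (intro prod_mono conjI norm_ge_zero term_le)
    also have "\<dots> = 4 ^ card R * ((\<Prod>a\<in>R. ?n (\<pi> a)) * ?P ^ p)"
      unfolding prod.distrib prod_power_distrib[symmetric] prod_constant by (rule refl)
    also have "\<dots> = 4 ^ card R * ?P ^ Suc p"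
      unfolding prod.reindex_bij_betw[OF bij, of ?n] power_Suc by (rule refl)
    finally have "2 ^ card R \<le> ?P ^ Suc p" by simp
    also have "\<dots> \<le> (2 ^ Lb) ^ Suc p"
    proof (rule power_mono[OF _ P0])
      have "real Lb < 2 ^ Lb" using less_exp[of Lb] by (metis of_nat_less_numeral_power_cancel_iff)
      then show "?P \<le> 2 ^ Lb" using Pi by linarith
    qed
    also have "\<dots> = 2 ^ (Lb * Suc p)" by (simp only: power_mult)
    finally have "(2 :: real) ^ card R \<le> 2 ^ (Lb * Suc p)" .
    then have "card R \<le> Lb * Suc p" by (rule power_le_imp_le_exp[rotated]) simp
    also have "\<dots> \<le> Lb * (fact h2 + 2)" using p(3) by (intro mult_le_mono2) simp
    also have "\<dots> \<le> Db" by (simp add: Db_def)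
    finally show False using dD by simp
  qed
qed

end

theorem (in poly_rec) not_abelian:
  assumes m: "m > 0" "m \<ge> mb" and l: "l \<ge> 2 + 1 / 192"
    and root: "ipoly (P m) (complex_of_real l) = 0" and nonroot: "ipoly (P (m - 1)) (complex_of_real l) \<noteq> 0"
  shows "\<not> abelian_number_field (rat_adjoin ((complex_of_real l)\<^sup>2))"
proof
  assume ab: "abelian_number_field (rat_adjoin ((complex_of_real l)\<^sup>2))"
  have "algebraic_int (complex_of_real l)" using root P_monic[of m] by (auto simp: algebraic_int_altdef_ipoly)
  then obtain f \<alpha> e \<psi> \<epsilon> where D: "trace_data f \<alpha> e \<psi> \<epsilon> (complex_of_real l)"
    and eq: "rat_values \<alpha> = rat_adjoin ((complex_of_real l)\<^sup>2)" using trace_data_exists by blast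
  have "l > 2" using l by simp
  then obtain t where t: "t > 1" "l = t + 1 / t" using real_unit_exists by blast
  interpret D: trace_data f \<alpha> e \<psi> \<epsilon> "complex_of_real l" by (rule D)
  interpret tail_root P k f \<alpha> e \<psi> \<epsilon> l m t using assms t by unfold_locales
  have "abelian_number_field (rat_values \<alpha>)" using ab unfolding eq .
  then have "abelian_ext f \<alpha>" "card D.R \<le> Db" using D.abelian_extI degree_le by blast+
  then show False using degree_gt assms(2,3) by fastforce
qed

section \<open>Computability of the bound\<close>

definition computable :: "nat \<Rightarrow> (nat list \<Rightarrow> nat) \<Rightarrow> bool" where
  "computable n g \<longleftrightarrow> (\<exists>prog. \<forall>xs. length xs = n \<longrightarrow> rec_eval prog xs (g xs))"

lemma computable_nth: "i < n \<Longrightarrow> computable n (\<lambda>xs. xs ! i)"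
  unfolding computable_def by (intro exI[of _ "Proj i"]) (auto intro: rec_eval.proj)

lemma computable_Suc: "computable n g \<Longrightarrow> computable n (\<lambda>xs. Suc (g xs))"
proof -
  assume "computable n g"
  then obtain p where p: "\<And>xs. length xs = n \<Longrightarrow> rec_eval p xs (g xs)" unfolding computable_def by blast
  have "rec_eval (Comp Succ [p]) xs (Suc (g xs))" if "length xs = n" for xs
    by (rule rec_eval.comp[of _ _ "[g xs]"]) (auto intro: p[OF that] rec_eval.succ)
  then show ?thesis unfolding computable_def by blast
qed

lemma computable_const: "computable n (\<lambda>_. c)"
proof (induction c)
  case 0
  show ?case unfolding computable_def by (intro exI[of _ Zero]) (auto intro: rec_eval.zero)
qed (rule computable_Suc)

lemma computable_comp:
  assumes h: "computable 2 (\<lambda>xs. h (xs ! 0) (xs ! 1))" and g: "computable n g" "computable n g'"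
  shows "computable n (\<lambda>xs. h (g xs) (g' xs))"
proof -
  obtain p q r where p: "\<And>xs. length xs = 2 \<Longrightarrow> rec_eval p xs (h (xs ! 0) (xs ! 1))"
    and q: "\<And>xs. length xs = n \<Longrightarrow> rec_eval q xs (g xs)" and r: "\<And>xs. length xs = n \<Longrightarrow> rec_eval r xs (g' xs)"
    using h g unfolding computable_def by blast
  have "rec_eval (Comp p [q, r]) xs (h (g xs) (g' xs))" if "length xs = n" for xs
  proof (rule rec_eval.comp[of _ _ "[g xs, g' xs]"])
    show "rec_eval p [g xs, g' xs] (h (g xs) (g' xs))" using p[of "[g xs, g' xs]"] by simp
  qed (auto intro: q[OF that] r[OF that])
  then show ?thesis unfolding computable_def by blast
qed

lemma computable_primrec:
  assumes h0: "\<And>y. h 0 y = a y" and hS: "\<And>n y. h (Suc n) y = b n (h n y) y"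
    and a: "computable 1 (\<lambda>xs. a (xs ! 0))" and b: "computable 3 (\<lambda>xs. b (xs ! 0) (xs ! 1) (xs ! 2))"
  shows "computable 2 (\<lambda>xs. h (xs ! 0) (xs ! 1))"
proof -
  obtain p q where p: "\<And>xs. length xs = 1 \<Longrightarrow> rec_eval p xs (a (xs ! 0))"
    and q: "\<And>xs. length xs = 3 \<Longrightarrow> rec_eval q xs (b (xs ! 0) (xs ! 1) (xs ! 2))"
    using a b unfolding computable_def by blast
  have *: "rec_eval (PrimRec p q) [n, y] (h n y)" for n y
  proof (induction n)
    case 0
    show ?case using p[of "[y]"] by (auto intro: rec_eval.primrec_0 simp: h0)
  next
    case (Suc n)
    then show ?case using q[of "[n, h n y, y]"] by (auto intro: rec_eval.primrec_Suc simp: hS)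
  qed
  have "rec_eval (PrimRec p q) xs (h (xs ! 0) (xs ! 1))" if "length xs = 2" for xs
    using that * by (auto simp: numeral_2_eq_2 length_Suc_conv)
  then show ?thesis unfolding computable_def by blast
qed

lemma computable_add:
  assumes "computable n g" "computable n g'" shows "computable n (\<lambda>xs. g xs + g' xs)"
proof -
  have "computable 2 (\<lambda>xs. xs ! 0 + xs ! 1)"
    by (rule computable_primrec[of "\<lambda>x y. x + y" "\<lambda>y. y" "\<lambda>_ z _. Suc z"])
      (simp, simp, (intro computable_Suc computable_nth; simp)+)
  then show ?thesis using assms by (rule computable_comp)
qed

lemma computable_mult:
  assumes "computable n g" "computable n g'" shows "computable n (\<lambda>xs. g xs * g' xs)"
proof -
  have "computable 2 (\<lambda>xs. xs ! 0 * xs ! 1)"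
    by (rule computable_primrec[of "\<lambda>x y. x * y" "\<lambda>y. 0" "\<lambda>_ z y. z + y"])
      (simp, simp, (intro computable_add computable_nth computable_const; simp)+)
  then show ?thesis using assms by (rule computable_comp)
qed

lemma computable_power:
  assumes "computable n g" "computable n g'" shows "computable n (\<lambda>xs. g xs ^ g' xs)"
proof -
  have "computable 2 (\<lambda>xs. xs ! 1 ^ xs ! 0)"
    by (rule computable_primrec[of "\<lambda>x y. y ^ x" "\<lambda>y. 1" "\<lambda>_ z y. z * y"])
      (simp, simp, (intro computable_mult computable_nth computable_const; simp)+)
  then show ?thesis using assms(2,1) by (rule computable_comp)
qed

text \<open>\<open>computable_primrec\<close> yields binary functions, so the factorial carries a
  dummy second argument.\<close>

lemma computable_fact:
  assumes "computable n g" shows "computable n (\<lambda>xs. fact (g xs))"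
proof -
  have "computable 2 (\<lambda>xs. (\<lambda>x _. fact x) (xs ! 0) (xs ! 1))"
    by (rule computable_primrec[of "\<lambda>x _. fact x" "\<lambda>y. 1" "\<lambda>x z y. z * Suc x"])
      (simp, simp add: algebra_simps, (intro computable_mult computable_Suc computable_nth computable_const; simp)+)
  then show ?thesis using assms assms by (rule computable_comp)
qed

text \<open>The value \<open>k + 12 + mb\<close> unfolded into an expression in the number
  \<open>k\<close> of vertices alone; 12 is the tail length that \<open>graph_dichotomy\<close> asks
  for.\<close>

definition threshold :: "nat \<Rightarrow> nat" where
  "threshold k = (let c = fact (k + 2); h = 2 ^ (k + 1) * c; L = 2 * h;
     D = 4 * k + 3 + L * (fact (2 * (2 * k + 1) * h ^ 2 + 8) + 2)
   in k + 12 + 14 * (3 * c ^ 2 * 2 ^ (2 * k + 2) * D + L * (2 * k + 2) + 1))"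

lemma computable_threshold: "computable 3 (\<lambda>xs. threshold (xs ! 0))"
  unfolding threshold_def Let_def
  by (intro computable_add computable_mult computable_power computable_fact computable_const computable_nth) auto

lemma (in poly_rec) threshold_eq: "threshold k = k + 12 + mb"
  by (simp add: threshold_def Let_def mb_def Cb_def Db_def Lb_def h1_def h2_def c0_def)

lemma (in tail_graph) poly_rec: "poly_rec P k"
proof (unfold_locales, rule P_rec, rule P_monic, rule P_degree)
  have "l1 (P m) \<le> fact (k + m)" for m
    unfolding P_def using arcs_inf_irrefl by (intro l1_char_poly) (auto simp: ent_def)
  from this[of 0] this[of 1] show "l1 (P 0) \<le> fact k" "l1 (P 1) \<le> fact (Suc k)" by simp_all
qed

theorem theorem10p0p1:
  shows "\<exists>prog :: recf. \<forall>(\<Gamma> :: nat pair_pre_digraph) (v :: nat).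
    pair_graph \<Gamma> \<and> Digraph_Component.connected (with_proj \<Gamma>) \<and>
    pverts \<Gamma> = {..<card (pverts \<Gamma>)} \<and> v \<in> pverts \<Gamma> \<longrightarrow>
    (\<exists>N. rec_eval prog (encode_input \<Gamma> v) N \<and>
      (\<forall>n\<ge>N. n \<ge> card (pverts \<Gamma>) \<longrightarrow>
        (let \<Gamma>n = add_path \<Gamma> v (n - card (pverts \<Gamma>));
             M = adjacency_matrix \<Gamma>n
         in
           ((\<forall>\<mu>. eigenvalue M \<mu> \<longrightarrow> (\<exists>\<zeta>. root_of_unity \<zeta> \<and> \<mu> = \<zeta> + inverse \<zeta>)) \<and>
            (graph_iso \<Gamma>n (dynkin_A n) \<or> n \<ge> 4 \<and> graph_iso \<Gamma>n (dynkin_D n)))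
         \<or> (\<exists>\<mu>. eigenvalue M \<mu> \<and> Polynomial.order \<mu> (char_poly M) = 1 \<and>
                \<not> abelian_number_field (rat_adjoin (\<mu>\<^sup>2))))))"
proof -
  obtain prog where prog: "\<And>xs. length xs = 3 \<Longrightarrow> rec_eval prog xs (threshold (xs ! 0))"
    using computable_threshold unfolding computable_def by blast
  show ?thesis
  proof (intro exI[of _ prog] allI impI, elim conjE)
    fix \<Gamma> :: "nat pair_pre_digraph" and v :: nat
    define k where "k = card (pverts \<Gamma>)"
    assume \<Gamma>: "pair_graph \<Gamma>" "Digraph_Component.connected (with_proj \<Gamma>)"
      and V: "pverts \<Gamma> = {..<card (pverts \<Gamma>)}" "v \<in> pverts \<Gamma>"
    have V': "pverts \<Gamma> = {..<k}" using V(1) unfolding k_def .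
    then have vk: "v < k" using V(2) by simp
    interpret tail_graph \<Gamma> v k by (rule tail_graph.intro[OF \<Gamma> V' vk])
    interpret PR: poly_rec P k by (rule poly_rec)
    have dichotomy: "let \<Gamma>n = add_path \<Gamma> v (n - k); M = adjacency_matrix \<Gamma>n in
        ((\<forall>\<mu>. eigenvalue M \<mu> \<longrightarrow> (\<exists>\<zeta>. root_of_unity \<zeta> \<and> \<mu> = \<zeta> + inverse \<zeta>)) \<and>
          (graph_iso \<Gamma>n (dynkin_A n) \<or> n \<ge> 4 \<and> graph_iso \<Gamma>n (dynkin_D n)))
        \<or> (\<exists>\<mu>. eigenvalue M \<mu> \<and> Polynomial.order \<mu> (char_poly M) = 1 \<and>
              \<not> abelian_number_field (rat_adjoin (\<mu>\<^sup>2)))"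
      if n: "n \<ge> threshold k" for n
    proof -
      define m where "m = n - k"
      have m: "m \<ge> 12" "m \<ge> PR.mb" "n = k + m" using n unfolding PR.threshold_eq m_def by simp_all
      let ?M = "adjacency_matrix (add_path \<Gamma> v m)"
      have "((\<forall>\<mu>. eigenvalue ?M \<mu> \<longrightarrow> (\<exists>\<zeta>. root_of_unity \<zeta> \<and> \<mu> = \<zeta> + inverse \<zeta>)) \<and>
          (graph_iso (add_path \<Gamma> v m) (dynkin_A n) \<or> n \<ge> 4 \<and> graph_iso (add_path \<Gamma> v m) (dynkin_D n)))
        \<or> (\<exists>\<mu>. eigenvalue ?M \<mu> \<and> Polynomial.order \<mu> (char_poly ?M) = 1 \<and>
              \<not> abelian_number_field (rat_adjoin (\<mu>\<^sup>2)))"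
        using graph_dichotomy[OF m(1)]
      proof
        assume "(\<forall>\<mu>. eigenvalue ?M \<mu> \<longrightarrow> zeta_sum \<mu>) \<and>
          (graph_iso (add_path \<Gamma> v m) (dynkin_A (k + m)) \<or> graph_iso (add_path \<Gamma> v m) (dynkin_D (k + m)))"
        moreover have "n \<ge> 4" using m by simp
        ultimately show ?thesis unfolding zeta_sum_def m(3) by blast
      next
        assume "\<exists>l :: real. l \<ge> 2 + 1 / 192 \<and> eigenvalue ?M l \<and>
          Polynomial.order (complex_of_real l) (char_poly ?M) = 1 \<and>
          poly (map_poly of_int (P (m - 1))) (complex_of_real l) \<noteq> 0"
        then obtain l :: real where l: "l \<ge> 2 + 1 / 192" "eigenvalue ?M l"
          "Polynomial.order (complex_of_real l) (char_poly ?M) = 1" "ipoly (P (m - 1)) (complex_of_real l) \<noteq> 0" by blast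
        have "?M \<in> carrier_mat (k + m) (k + m)" unfolding adjacency_matrix_path by simp
        then have "poly (char_poly ?M) (complex_of_real l) = 0" using l(2) eigenvalue_root_char_poly by blast
        then have "ipoly (P m) (complex_of_real l) = 0" unfolding char_poly_path .
        then have "\<not> abelian_number_field (rat_adjoin ((complex_of_real l)\<^sup>2))"
          using m(1) by (intro PR.not_abelian[OF _ m(2) l(1) _ l(4)]) auto
        then show ?thesis using l by blast
      qed
      then show ?thesis unfolding Let_def m_def .
    qed
    have "rec_eval prog (encode_input \<Gamma> v) (threshold k)"
      using prog[of "encode_input \<Gamma> v"] by (simp add: encode_input_def k_def)
    then show "\<exists>N. rec_eval prog (encode_input \<Gamma> v) N \<and>
      (\<forall>n\<ge>N. n \<ge> card (pverts \<Gamma>) \<longrightarrow>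
        (let \<Gamma>n = add_path \<Gamma> v (n - card (pverts \<Gamma>));
             M = adjacency_matrix \<Gamma>n
         in
           ((\<forall>\<mu>. eigenvalue M \<mu> \<longrightarrow> (\<exists>\<zeta>. root_of_unity \<zeta> \<and> \<mu> = \<zeta> + inverse \<zeta>)) \<and>
            (graph_iso \<Gamma>n (dynkin_A n) \<or> n \<ge> 4 \<and> graph_iso \<Gamma>n (dynkin_D n)))
         \<or> (\<exists>\<mu>. eigenvalue M \<mu> \<and> Polynomial.order \<mu> (char_poly M) = 1 \<and>
                \<not> abelian_number_field (rat_adjoin (\<mu>\<^sup>2)))))"
      using dichotomy unfolding k_def[symmetric] by blast
  qed
qed

end
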